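(* There is an absolute constant $C$ such that the following holds. For all finite sets $F,G\subset\mathbb Z$, with $f=\mathbf 1_F$ and $g=\mathbf 1_G$, there is a sparse collection of intervals $\mathcal S$ such that $$\langle A^{\ast}f,g\rangle\le C\sum_{I\in\mathcal S}\langle f\rangle_I\,\langle g\rangle_I\,\bigl(\operatorname{Log}(\langle f\rangle_I\langle g\rangle_I)\bigr)^{t}\,|I|,$$ where $t=2$ unconditionally, and where one can take $t=1$ if the Generalized Riemann Hypothesis is assumed.
   Context: An interval is a finite set of consecutive integers, with cardinality $|I|$. A collection of intervals $\mathcal S$ is sparse if to each $I\in\mathcal S$ there is a set $E_I\subset I$ with $4|E_I|\ge|I|$ such that the sets $\{E_I: I\in\mathcal S\}$ are pairwise disjoint. The von Mangoldt function is $\Lambda(n)=\log p$ if $n=p^a$ with $p$ prime and $a\ge1$, and $\Lambda(n)=0$ otherwise. For finitely supported $f$ on $\mathbb Z$, $$A_Nf(x)=\frac1N\sum_{1\le n\le N}f(x-n)\Lambda(n),\qquad A^{\ast}f=\sup_{N}|A_Nf|,$$ the supremum being over positive integers $N$. $\langle u,v\rangle=\sum_{x\in\mathbb Z}u(x)\overline{v(x)}$. $\langle f\rangle_I=|I|^{-1}\sum_{x\in I}|f(x)|$. $\operatorname{Log}x=1+|\log x|$ for $x>0$; an expression $y(\operatorname{Log}y)^t$ is read as $0$ when $y=0$. The Generalized Riemann Hypothesis is the assertion that, for every Dirichlet character, all zeros of the associated Dirichlet $L$-function in the strip $0<\operatorname{Re}(s)<1$ lie on the line $\operatorname{Re}(s)=\frac12$.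 *)

theory Defs
  imports "HOL-Complex_Analysis.Complex_Analysis" "HOL-Number_Theory.Number_Theory"
    "HOL-Number_Theory.Prime_Powers"
begin

definition int_interval :: "int set \<Rightarrow> bool" where
  "int_interval I \<longleftrightarrow> (\<exists>a b. a \<le> b \<and> I = {a..b})"

definition sparse_collection :: "int set set \<Rightarrow> bool" where
  "sparse_collection S \<longleftrightarrow> (\<forall>I\<in>S. int_interval I) \<and>
     (\<exists>E. (\<forall>I\<in>S. E I \<subseteq> I \<and> 4 * card (E I) \<ge> card I) \<and> disjoint_family_on E S)"

(* Functions on the integers are taken real-valued: only indicator functions and their
   maximal functions occur, and complex conjugation is then trivial. *)

definition prime_avg :: "nat \<Rightarrow> (int \<Rightarrow> real) \<Rightarrow> int \<Rightarrow> real" where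
  "prime_avg N f x = (1 / real N) * (\<Sum>n\<in>{1..N}. f (x - int n) * mangoldt n)"

(* For finitely supported f only finitely many values f (x - int n) are nonzero, so the
   set of averages is bounded and the real supremum is the genuine one. *)
definition prime_max :: "(int \<Rightarrow> real) \<Rightarrow> int \<Rightarrow> real" where
  "prime_max f x = (SUP N\<in>{1..}. \<bar>prime_avg N f x\<bar>)"

definition pairing :: "(int \<Rightarrow> real) \<Rightarrow> (int \<Rightarrow> real) \<Rightarrow> real" where
  "pairing u v = (\<Sum>\<^sub>\<infinity>x. u x * v x)"

definition avg :: "int set \<Rightarrow> (int \<Rightarrow> real) \<Rightarrow> real" where
  "avg I f = (\<Sum>x\<in>I. \<bar>f x\<bar>) / real (card I)"

definition Log :: "real \<Rightarrow> real" where
  "Log x = 1 + \<bar>ln x\<bar>"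

(* The collection S may be infinite. For finitely supported f and g and sparse S the terms
   are always summable: only intervals meeting both supports contribute, at most boundedly
   many of these have length in a given dyadic range, and the contribution of an interval of
   length L is O((1 + ln L)^t / L). When the product of the averages is 0, the term is 0. *)
definition sparse_form :: "nat \<Rightarrow> int set set \<Rightarrow> (int \<Rightarrow> real) \<Rightarrow> (int \<Rightarrow> real) \<Rightarrow> real" where
  "sparse_form t S f g =
     (\<Sum>\<^sub>\<infinity>I\<in>S. avg I f * avg I g * Log (avg I f * avg I g) ^ t * real (card I))"

definition dirichlet_character :: "nat \<Rightarrow> (int \<Rightarrow> complex) \<Rightarrow> bool" where
  "dirichlet_character q \<psi> \<longleftrightarrow> q > 0 \<and>
     (\<forall>m n. \<psi> (m * n) = \<psi> m * \<psi> n) \<and>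
     (\<forall>n. \<psi> (n + int q) = \<psi> n) \<and>
     (\<forall>n. \<psi> n \<noteq> 0 \<longleftrightarrow> coprime n (int q))"

(* The analytic continuation of the Dirichlet series to the plane punctured at 1. It exists
   and is unique there; the value at 1 is unspecified. *)
definition dirichlet_L :: "(int \<Rightarrow> complex) \<Rightarrow> complex \<Rightarrow> complex" where
  "dirichlet_L \<psi> = (SOME L. L holomorphic_on (- {1}) \<and>
     (\<forall>s. Re s > 1 \<longrightarrow> (\<lambda>n. \<psi> (int (Suc n)) / of_nat (Suc n) powr s) sums L s))"

definition GRH :: bool where
  "GRH \<longleftrightarrow> (\<forall>q \<psi> s. dirichlet_character q \<psi> \<longrightarrow> 0 < Re s \<longrightarrow> Re s < 1 \<longrightarrow>
     dirichlet_L \<psi> s = 0 \<longrightarrow> Re s = 1 / 2)"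

end

theory Submission
  imports Defs
begin

text \<open>
The proof yields the exponent one for \<open>Log\<close>, and larger exponents follow because \<open>Log\<close> is at least
one. Its core is that an upper bound for prime averages only needs a majorant of the von Mangoldt
function, and that a sieve which ignores the small primes provides a majorant with almost no structure.

Fix \<open>z \<ge> 2\<close> and a scale \<open>N\<close>. Selberg's upper bound sieve, with only the primes above \<open>z\<close> as sifting
primes and with level a small power of \<open>N\<close>, majorizes the von Mangoldt function on \<open>{1..N}\<close>, up to a
negligible set, by \<open>O(ln z)\<close> times \<open>1 + (\<Sum>q. b\<^sub>q c\<^sub>q(n))\<close>. Here \<open>c\<^sub>q\<close> is a Ramanujan sum, \<open>q > 1\<close> runs
over squarefree numbers up to \<open>N powr (1/24)\<close> all of whose prime factors exceed \<open>z\<close>, and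
\<open>\<bar>b\<^sub>q\<bar> \<le> 4 ^ \<omega>(q) / \<phi>(q)\<close> (\<open>sieve_fun_square\<close>, \<open>sieve_mass_ge\<close>, \<open>prime_avg_le\<close>). Leaving out the
small primes costs the factor \<open>ln z\<close>; in return the low frequencies have disappeared, except for the
constant term, which produces an ordinary average.

The frequencies \<open>q > z\<close> are treated in mean square, uniformly in all scales. For a single modulus
the maximal function of the averages weighted by \<open>c\<^sub>q\<close> is bounded with a loss of \<open>2 ^ \<omega>(q)\<close>, because
\<open>c\<^sub>q\<close> is a combination of indicators of progressions (\<open>ramanujan_maximal\<close>). Adding these bounds for
all \<open>q\<close> of one size just fails to give decay. But weighted averages over different moduli are almost
orthogonal, and an average at a scale much larger than \<open>q\<close> can be preceded by the projection to
the frequencies of \<open>q\<close> (\<open>ramanujan_reproducing\<close>, \<open>almost_orthogonal_bessel\<close>). This replaces the sum of the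
coefficients by the square root of the sum of their squares, and the maximal function of the whole high
frequency part has norm \<open>O(z powr (-1/4))\<close> (\<open>ramanujan_high_maximal\<close>). The arguments take place on
the side of the integers: Young's inequality, the maximal ergodic inequality and correlations over
periods replace the circle method.

For an interval on which \<open>F\<close> and \<open>G\<close> have densities with product \<open>\<delta>\<close>, the choice \<open>z = 2 / \<delta>\<^sup>2\<close>
balances both parts and gives the bound \<open>O(\<delta> * Log \<delta>)\<close> times the length, provided that each point only
uses scales at which \<open>F\<close> is not much denser than on the whole interval (\<open>admissible_sum_le\<close>). Stopping
at dyadic intervals where the density of \<open>F\<close> has grown by a factor 16, and repeating the argument inside
them, leads to the sparse collection (\<open>local_sparse_domination\<close>). Its members are dyadic intervals joined
with their left neighbours, since the averages look to the left.
\<close>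

section \<open>Square norms of functions on the integers\<close>

text \<open>
The norm is tested on finite sets only, so that shifts, convolutions and pointwise maxima can be
handled without any discussion of supports or summability.
\<close>
definition l2_bounded :: "(int \<Rightarrow> real) \<Rightarrow> real \<Rightarrow> bool" where
  "l2_bounded f B \<longleftrightarrow> (\<forall>X. finite X \<longrightarrow> L2_set f X \<le> B)"

lemma l2_boundedD:
  assumes "l2_bounded f B"
  shows "L2_set f X \<le> B"
proof (cases "finite X")
  case False
  have "L2_set f {} \<le> B" using assms unfolding l2_bounded_def by blast
  thus ?thesis using False by simp
qed (use assms in \<open>simp add: l2_bounded_def\<close>)

lemma l2_bounded_nonneg: "l2_bounded f B \<Longrightarrow> 0 \<le> B"
  using l2_boundedD[of f B "{}"] by simp

lemma L2_set_mono_abs: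
  assumes "\<And>x. x \<in> X \<Longrightarrow> \<bar>f x\<bar> \<le> \<bar>g x\<bar>"
  shows "L2_set f X \<le> L2_set g X"
  unfolding L2_set_def using assms
  by (intro real_sqrt_le_mono sum_mono) (simp add: abs_le_square_iff)

lemma l2_bounded_mono:
  assumes "l2_bounded g B" "\<And>x. \<bar>f x\<bar> \<le> \<bar>g x\<bar>" "B \<le> B'"
  shows "l2_bounded f B'"
  unfolding l2_bounded_def
proof (intro allI impI)
  fix X :: "int set"
  have "L2_set f X \<le> L2_set g X" by (rule L2_set_mono_abs) (rule assms(2))
  also have "\<dots> \<le> B" by (rule l2_boundedD[OF assms(1)])
  finally show "L2_set f X \<le> B'" using assms(3) by simp
qed

lemma l2_bounded_zero: "l2_bounded (\<lambda>_. 0) 0"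
  by (simp add: l2_bounded_def L2_set_def)

lemma l2_bounded_add:
  assumes "l2_bounded f B" "l2_bounded g C"
  shows "l2_bounded (\<lambda>x. f x + g x) (B + C)"
  unfolding l2_bounded_def
proof (intro allI impI)
  fix X :: "int set"
  have "L2_set (\<lambda>x. f x + g x) X \<le> L2_set f X + L2_set g X" by (rule L2_set_triangle_ineq)
  also have "\<dots> \<le> B + C" by (intro add_mono l2_boundedD assms)
  finally show "L2_set (\<lambda>x. f x + g x) X \<le> B + C" .
qed

lemma l2_bounded_scale:
  assumes "l2_bounded f B"
  shows "l2_bounded (\<lambda>x. c * f x) (\<bar>c\<bar> * B)"
proof -
  have "L2_set (\<lambda>x. c * f x) X = \<bar>c\<bar> * L2_set f X" for X
    by (subst L2_set_right_distrib) (auto simp: L2_set_def power_mult_distrib)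
  thus ?thesis using assms by (auto simp: l2_bounded_def intro: mult_left_mono)
qed

lemma l2_bounded_sum:
  assumes "\<And>i. i \<in> I \<Longrightarrow> l2_bounded (f i) (B i)"
  shows "l2_bounded (\<lambda>x. \<Sum>i\<in>I. f i x) (\<Sum>i\<in>I. B i)"
  using assms
proof (induction I rule: infinite_finite_induct)
  case (insert i I)
  thus ?case using l2_bounded_add[of "f i" "B i" "\<lambda>x. \<Sum>i\<in>I. f i x" "\<Sum>i\<in>I. B i"] by simp
qed (auto simp: l2_bounded_zero)

lemma l2_bounded_shift:
  assumes "l2_bounded f B"
  shows "l2_bounded (\<lambda>x. f (x - n)) B"
  unfolding l2_bounded_def
proof (intro allI impI)
  fix X :: "int set" assume "finite X"
  have "L2_set (\<lambda>x. f (x - n)) X = L2_set f ((\<lambda>x. x - n) ` X)"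
    unfolding L2_set_def by (subst sum.reindex) (auto simp: inj_on_def)
  thus "L2_set (\<lambda>x. f (x - n)) X \<le> B" using l2_boundedD[OF assms] by simp
qed

text \<open>
Young's inequality: a convolution with a finite kernel is a combination of shifts, and shifts are
isometries.
\<close>
lemma l2_bounded_convolution:
  assumes "l2_bounded f B"
  shows "l2_bounded (\<lambda>x. \<Sum>n\<in>D. k n * f (x - n)) ((\<Sum>n\<in>D. \<bar>k n\<bar>) * B)"
  unfolding sum_distrib_right
  by (intro l2_bounded_sum l2_bounded_scale l2_bounded_shift assms)

section \<open>The maximal ergodic inequality\<close>

text \<open>
Garsia's argument for the shift by \<open>d\<close>. Let \<open>M x\<close> be the largest partial sum of \<open>h - lam\<close> along
\<open>x, x - d, x - 2 d, \<dots>\<close>, the empty sum included; then \<open>E\<close> is the set where \<open>M\<close> is positive. On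
\<open>E\<close> a maximizing sum is nonempty, and removing its first term gives
\<open>M x \<le> (h x - lam) + M (x - d)\<close>. After summation over \<open>E\<close> the two sums of \<open>M\<close> cancel with the
right sign, because the shift preserves counting measure and \<open>M\<close> vanishes off \<open>E\<close>.
\<close>
lemma maximal_ergodic:
  fixes h :: "int \<Rightarrow> real" and d :: int and lam :: real and L :: nat
  assumes h0: "\<And>x. 0 \<le> h x" and fin: "finite W" and supp: "\<And>x. x \<notin> W \<Longrightarrow> h x = 0" and lam: "lam > 0"
  defines "E \<equiv> {x. \<exists>n\<in>{1..L}. (\<Sum>m<n. h (x - d * int m)) > lam * real n}"
  shows "finite E" "lam * real (card E) \<le> (\<Sum>x\<in>E. h x)"
proof -
  define S where "S n x = (\<Sum>m<n. h (x - d * int m) - lam)" for n x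
  define M where "M x = Max ((\<lambda>n. S n x) ` {0..L})" for x
  have S_eq: "S n x = (\<Sum>m<n. h (x - d * int m)) - lam * real n" for n x
    by (simp add: S_def sum_subtractf)
  have Mge: "S n x \<le> M x" if "n \<le> L" for n x
    unfolding M_def using that by (intro Max_ge) auto
  have M0: "0 \<le> M x" for x using Mge[of 0 x] by (simp add: S_def)
  have Min: "\<exists>n\<le>L. M x = S n x" for x
  proof -
    have "M x \<in> (\<lambda>n. S n x) ` {0..L}" unfolding M_def by (intro Max_in) auto
    thus ?thesis by auto
  qed
  have E_iff: "x \<in> E \<longleftrightarrow> M x > 0" for x
  proof
    assume "x \<in> E"
    then obtain n where "n \<le> L" "S n x > 0" by (auto simp: E_def S_eq)
    thus "M x > 0" using Mge[of n x] by linarith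
  next
    assume M: "M x > 0"
    obtain n where n: "n \<le> L" "M x = S n x" using Min by blast
    have "n \<noteq> 0" using M n by (intro notI) (simp add: S_def)
    thus "x \<in> E" using n M by (auto simp: E_def S_eq)
  qed
  have "E \<subseteq> (\<Union>m\<in>{..L}. (\<lambda>w. w + d * int m) ` W)"
  proof
    fix x assume "x \<in> E"
    then obtain n where n: "n \<le> L" "(\<Sum>m<n. h (x - d * int m)) > lam * real n" by (auto simp: E_def)
    have "(\<Sum>m<n. h (x - d * int m)) \<noteq> 0" using n(2) lam by (smt (verit) mult_nonneg_nonneg of_nat_0_le_iff)
    then obtain m where "m < n" "h (x - d * int m) \<noteq> 0" by (meson lessThan_iff sum.not_neutral_contains_not_neutral)
    hence "x - d * int m \<in> W" "m \<le> L" using supp n(1) by (auto intro: ccontr)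
    thus "x \<in> (\<Union>m\<in>{..L}. (\<lambda>w. w + d * int m) ` W)" by (intro UN_I[of m]) (auto intro: image_eqI[of _ _ "x - d * int m"])
  qed
  thus finE: "finite E" by (rule finite_subset) (use fin in auto)
  have step: "M x \<le> (h x - lam) + M (x - d)" if "x \<in> E" for x
  proof -
    obtain n where n: "n \<le> L" "M x = S n x" using Min by blast
    have "n \<noteq> 0" using that n by (intro notI) (simp add: S_def E_iff)
    then obtain n' where n': "n = Suc n'" by (cases n) auto
    have "S n x = (h x - lam) + S n' (x - d)"
      unfolding S_def n' by (subst sum.lessThan_Suc_shift) (simp add: algebra_simps)
    thus ?thesis using Mge[of n' "x - d"] n n' by simp
  qed
  have "(\<Sum>x\<in>E. M (x - d)) = (\<Sum>y\<in>(\<lambda>x. x - d) ` E. M y)"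
    by (subst sum.reindex) (auto simp: inj_on_def)
  also have "\<dots> = (\<Sum>y\<in>(\<lambda>x. x - d) ` E \<inter> E. M y)"
    using finE M0 by (intro sum.mono_neutral_right) (auto simp: E_iff less_le)
  also have "\<dots> \<le> (\<Sum>y\<in>E. M y)" using finE M0 by (intro sum_mono2) auto
  also have "\<dots> \<le> (\<Sum>x\<in>E. (h x - lam) + M (x - d))" by (intro sum_mono step)
  finally have "0 \<le> (\<Sum>x\<in>E. h x - lam)" by (simp add: sum.distrib)
  thus "lam * real (card E) \<le> (\<Sum>x\<in>E. h x)" by (simp add: sum_subtractf mult.commute)
qed

text \<open>
The layer cake formula: \<open>u\<^sup>2\<close> is the integral of \<open>2 t\<close> over \<open>0 < t < u\<close>, and the hypothesis bounds
the integrand for every \<open>t\<close>.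
\<close>
lemma sum_square_le_of_level_sets:
  fixes u v :: "'a \<Rightarrow> real"
  assumes fin: "finite X" and u: "\<And>x. x \<in> X \<Longrightarrow> 0 \<le> u x" and v: "\<And>x. x \<in> X \<Longrightarrow> 0 \<le> v x"
    and lev: "\<And>lam. lam > 0 \<Longrightarrow> lam * real (card {x\<in>X. u x > lam}) \<le> (\<Sum>x\<in>{x\<in>X. u x > lam}. v x)"
  shows "(\<Sum>x\<in>X. (u x)\<^sup>2) \<le> 2 * (\<Sum>x\<in>X. u x * v x)"
proof -
  define V where "V = Max (insert 0 (u ` X))"
  have uV: "u x \<le> V" if "x \<in> X" for x unfolding V_def using fin that by (intro Max_ge) auto
  have I1: "((\<lambda>t. if t \<in> {0..<u x} then 2 * t else 0) has_integral (u x)\<^sup>2) {0..V}" if "x \<in> X" for x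
  proof -
    have "((\<lambda>t::real. 2 * t) has_integral ((u x)\<^sup>2 - 0\<^sup>2)) {0..u x}"
      by (intro fundamental_theorem_of_calculus u that)
         (auto intro!: derivative_eq_intros simp: has_real_derivative_iff_has_vector_derivative[symmetric])
    hence "((\<lambda>t::real. if t \<in> {0..<u x} then 2 * t else 0) has_integral (u x)\<^sup>2) {0..u x}"
      by (subst (asm) has_integral_spike_finite_eq[of "{u x}" _ "\<lambda>t. if t \<in> {0..<u x} then 2 * t else 0"]) auto
    hence "((\<lambda>t::real. if t \<in> {0..u x} then (if t \<in> {0..<u x} then 2 * t else 0) else 0) has_integral (u x)\<^sup>2) {0..V}"
      using uV[OF that] by (subst has_integral_restrict) auto
    thus ?thesis by (rule has_integral_eq[rotated]) auto
  qed
  have I2: "((\<lambda>t. if t \<in> {0..<u x} then v x else 0) has_integral (u x * v x)) {0..V}" if "x \<in> X" for x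
  proof -
    have "((\<lambda>t::real. v x) has_integral (u x * v x)) {0..u x}"
      using has_integral_const_real[of "v x" 0 "u x"] u[OF that] by simp
    hence "((\<lambda>t::real. if t \<in> {0..<u x} then v x else 0) has_integral (u x * v x)) {0..u x}"
      by (subst (asm) has_integral_spike_finite_eq[of "{u x}" _ "\<lambda>t. if t \<in> {0..<u x} then v x else 0"]) auto
    hence "((\<lambda>t::real. if t \<in> {0..u x} then (if t \<in> {0..<u x} then v x else 0) else 0) has_integral (u x * v x)) {0..V}"
      using uV[OF that] by (subst has_integral_restrict) auto
    thus ?thesis by (rule has_integral_eq[rotated]) auto
  qed
  have J1: "((\<lambda>t. \<Sum>x\<in>X. if t \<in> {0..<u x} then 2 * t else 0) has_integral (\<Sum>x\<in>X. (u x)\<^sup>2)) {0..V}"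
    by (intro has_integral_sum fin I1)
  have J2: "((\<lambda>t. 2 * (\<Sum>x\<in>X. if t \<in> {0..<u x} then v x else 0)) has_integral 2 * (\<Sum>x\<in>X. u x * v x)) {0..V}"
    by (intro has_integral_mult_right has_integral_sum fin I2)
  show ?thesis
  proof (rule has_integral_le[OF J1 J2])
    fix t assume t: "t \<in> {0..V}"
    have "(\<Sum>x\<in>X. if t \<in> {0..<u x} then 2 * t else 0) = 2 * (t * real (card {x\<in>X. u x > t}))"
      using t fin by (simp add: sum.If_cases Int_def mult_ac)
    also have "\<dots> \<le> 2 * (\<Sum>x\<in>{x\<in>X. u x > t}. v x)"
    proof (cases "t = 0")
      case True thus ?thesis using v by (auto intro!: sum_nonneg)
    next
      case False thus ?thesis using lev[of t] t by auto
    qed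
    also have "(\<Sum>x\<in>{x\<in>X. u x > t}. v x) = (\<Sum>x\<in>X. if t \<in> {0..<u x} then v x else 0)"
      using t fin by (simp add: sum.If_cases Int_def)
    finally show "(\<Sum>x\<in>X. if t \<in> {0..<u x} then 2 * t else 0) \<le> 2 * (\<Sum>x\<in>X. if t \<in> {0..<u x} then v x else 0)" .
  qed
qed

text \<open>
The level sets of the maximal function \<open>w\<close> are controlled by the maximal ergodic inequality, and the
layer cake formula turns this into \<open>\<parallel>w\<parallel>\<^sup>2 \<le> 2 \<langle>w, h\<rangle>\<close>. Cauchy's inequality then removes one factor \<open>\<parallel>w\<parallel>\<close>.
The step \<open>d\<close> does not enter the constant, which is what makes averages along progressions as good as
averages along all integers. The statement is about any \<open>u\<close> dominated by such averages.
\<close>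
lemma maximal_function_l2:
  fixes u h :: "int \<Rightarrow> real" and d :: int
  assumes h: "l2_bounded h B"
    and u0: "\<And>x. 0 \<le> u x"
    and u: "\<And>x. u x > 0 \<Longrightarrow> \<exists>n\<in>{1..L}. u x * real n \<le> (\<Sum>m<n. \<bar>h (x - d * int m)\<bar>)"
  shows "l2_bounded u (2 * B)"
  unfolding l2_bounded_def
proof (intro allI impI)
  fix X :: "int set" assume fX: "finite X"
  define W where "W = X \<union> (\<Union>m\<in>{..L}. (\<lambda>x. x - d * int m) ` X)"
  \<comment> \<open>The averages seen from points of X only involve h on the finite set W, so h may be cut off there.\<close>
  define g where "g x = (if x \<in> W then \<bar>h x\<bar> else 0)" for x
  define w where "w x = Max (insert 0 ((\<lambda>n. (\<Sum>m<n. g (x - d * int m)) / real n) ` {1..L}))" for x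
  have fW: "finite W" using fX by (simp add: W_def)
  have uw: "u x \<le> w x" if "x \<in> X" for x
  proof (cases "u x > 0")
    case True
    then obtain n where n: "n \<in> {1..L}" "u x * real n \<le> (\<Sum>m<n. \<bar>h (x - d * int m)\<bar>)" using u by blast
    have "(\<Sum>m<n. \<bar>h (x - d * int m)\<bar>) = (\<Sum>m<n. g (x - d * int m))"
      using n(1) that by (intro sum.cong) (auto simp: g_def W_def)
    hence "u x \<le> (\<Sum>m<n. g (x - d * int m)) / real n" using n by (simp add: field_simps)
    also have "\<dots> \<le> w x" unfolding w_def using n(1) by (intro Max_ge) auto
    finally show ?thesis .
  next
    case False
    moreover have "0 \<le> w x" unfolding w_def by (intro Max_ge) auto
    ultimately show ?thesis by simp
  qed
  have w0: "0 \<le> w x" for x unfolding w_def by (intro Max_ge) auto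
  define Y where "Y = X \<union> W \<union> {x. w x > 0}"
  have wgt: "{x. w x > lam} = {x. \<exists>n\<in>{1..L}. (\<Sum>m<n. g (x - d * int m)) > lam * real n}" if "lam \<ge> 0" for lam
    using that by (auto simp: w_def Max_gr_iff field_simps)
  have wsupp: "finite {x. w x > 0}"
  proof (rule finite_subset)
    show "{x. w x > 0} \<subseteq> (\<Union>m\<in>{..L}. (\<lambda>w. w + d * int m) ` W)"
    proof
      fix x assume "x \<in> {x. w x > 0}"
      then obtain n where n: "n \<le> L" "(\<Sum>m<n. g (x - d * int m)) > 0" using wgt[of 0] by auto
      then obtain m where "m < n" "g (x - d * int m) \<noteq> 0"
        by (metis lessThan_iff less_irrefl sum.neutral)
      hence "x - d * int m \<in> W" "m \<le> L" using n(1) by (auto simp: g_def split: if_splits)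
      thus "x \<in> (\<Union>m\<in>{..L}. (\<lambda>w. w + d * int m) ` W)" by (intro UN_I[of m]) (auto intro: image_eqI[of _ _ "x - d * int m"])
    qed
  qed (use fW in auto)
  have fY: "finite Y" using fX fW wsupp by (simp add: Y_def)
  have g0: "0 \<le> g x" for x by (simp add: g_def)
  have main: "(\<Sum>x\<in>Y. (w x)\<^sup>2) \<le> 2 * (\<Sum>x\<in>Y. w x * g x)"
  proof (rule sum_square_le_of_level_sets)
    fix lam :: real assume lam: "lam > 0"
    have "{x\<in>Y. w x > lam} = {x. w x > lam}" using lam by (auto simp: Y_def)
    also have "\<dots> = {x. \<exists>n\<in>{1..L}. (\<Sum>m<n. g (x - d * int m)) > lam * real n}" using lam by (intro wgt) simp
    finally show "lam * real (card {x\<in>Y. w x > lam}) \<le> (\<Sum>x\<in>{x\<in>Y. w x > lam}. g x)"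
      using maximal_ergodic(2)[of g W lam L d, OF g0 fW _ lam] by (simp add: g_def)
  qed (use fY w0 g0 in auto)
  also have "(\<Sum>x\<in>Y. w x * g x) \<le> L2_set w Y * L2_set g Y"
    using L2_set_mult_ineq[of w g Y] w0 g0 by simp
  finally have "(L2_set w Y)\<^sup>2 \<le> 2 * (L2_set w Y * L2_set g Y)"
    by (simp add: L2_set_def sum_nonneg)
  hence "L2_set w Y \<le> 2 * L2_set g Y"
    using L2_set_nonneg[of w Y] L2_set_nonneg[of g Y]
    by (cases "L2_set w Y = 0") (auto simp: power2_eq_square)
  moreover have "L2_set g Y \<le> L2_set h Y" by (intro L2_set_mono_abs) (simp add: g_def)
  moreover have "L2_set h Y \<le> B" by (rule l2_boundedD[OF h])
  moreover have "L2_set u X \<le> L2_set w X" using uw u0 by (intro L2_set_mono) auto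
  moreover have "L2_set w X \<le> L2_set w Y" unfolding L2_set_def
    using fY by (intro real_sqrt_le_mono sum_mono2) (auto simp: Y_def)
  ultimately show "L2_set u X \<le> 2 * B" by linarith
qed

section \<open>Ramanujan sums of squarefree moduli\<close>

definition prime_set :: "nat set \<Rightarrow> bool" where
  "prime_set C \<longleftrightarrow> finite C \<and> (\<forall>p\<in>C. prime p)"

text \<open>
This is the Ramanujan sum \<open>c\<^sub>q(n)\<close> of the squarefree modulus \<open>q = \<Prod>C\<close>. A modulus is represented by its
set of prime factors, so that multiplicativity in \<open>q\<close> becomes recursion over a finite set.
\<close>
definition ramanujan_sum :: "nat set \<Rightarrow> int \<Rightarrow> real" where
  "ramanujan_sum C n = (\<Prod>p\<in>C. if int p dvd n then real p - 1 else - 1)"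

lemma prime_set_subset: "prime_set C \<Longrightarrow> D \<subseteq> C \<Longrightarrow> prime_set D"
  by (auto simp: prime_set_def intro: finite_subset)

lemma prime_set_finite: "prime_set C \<Longrightarrow> finite C"
  by (simp add: prime_set_def)

lemma prime_set_prod_pos: "prime_set C \<Longrightarrow> 0 < \<Prod>C"
  by (auto simp: prime_set_def intro!: prod_pos prime_gt_0_nat)

lemma prime_set_prod_insert_coprime:
  assumes "prime_set (insert p C)" "p \<notin> C"
  shows "coprime p (\<Prod>C)"
  using assms by (intro prod_coprime_right) (auto simp: prime_set_def intro!: primes_coprime)

lemma prime_set_int_dvd_iff:
  assumes "prime_set C"
  shows "int (\<Prod>C) dvd n \<longleftrightarrow> (\<forall>p\<in>C. int p dvd n)"
proof -
  have "finite C" using assms by (rule prime_set_finite)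
  thus ?thesis using assms
  proof (induction C rule: finite_induct)
    case (insert p C)
    have cop: "coprime (int p) (int (\<Prod>C))"
      using prime_set_prod_insert_coprime[OF insert.prems insert.hyps(2)] by (simp only: coprime_int_iff)
    have C: "prime_set C" using insert.prems by (rule prime_set_subset) auto
    have "int (\<Prod>(insert p C)) = int p * int (\<Prod>C)" using insert.hyps by simp
    hence "int (\<Prod>(insert p C)) dvd n \<longleftrightarrow> int p dvd n \<and> int (\<Prod>C) dvd n"
      using cop by (metis divides_mult dvd_mult_left dvd_mult_right)
    thus ?case using insert.IH[OF C] by simp
  qed simp
qed

lemma ramanujan_sum_periodic:
  assumes "finite C" "int (\<Prod>C) dvd k"
  shows "ramanujan_sum C (n + k) = ramanujan_sum C n"
  unfolding ramanujan_sum_def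
proof (intro prod.cong refl)
  fix p assume "p \<in> C"
  hence "p dvd \<Prod>C" using assms(1) by (intro dvd_prodI) auto
  hence "int p dvd k" using assms(2) by (meson dvd_trans of_nat_dvd_iff)
  thus "(if int p dvd n + k then real p - 1 else - 1) = (if int p dvd n then real p - 1 else - 1)"
    by (simp add: dvd_add_left_iff)
qed

lemma ramanujan_sum_abs_le:
  assumes "prime_set C"
  shows "\<bar>ramanujan_sum C n\<bar> \<le> real (\<Prod>C)"
proof -
  have "(\<Prod>p\<in>C. \<bar>if int p dvd n then real p - 1 else - 1\<bar>) \<le> (\<Prod>p\<in>C. real p)"
  proof (intro prod_mono conjI)
    fix p assume "p \<in> C"
    hence "real p \<ge> 2" using assms prime_ge_2_nat by (fastforce simp: prime_set_def)
    thus "\<bar>if int p dvd n then real p - 1 else - 1\<bar> \<le> real p" by auto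
  qed auto
  thus ?thesis by (simp add: ramanujan_sum_def abs_prod)
qed

text \<open>
For a prime \<open>p\<close> the value is \<open>p\<close> times the indicator of the multiples of \<open>p\<close>, minus one. Multiplying
out exhibits \<open>c\<^sub>q\<close> as a signed sum of \<open>2 ^ card C\<close> normalized indicators of progressions, each of which
has mean about one. Hence the losses \<open>2 ^ card C\<close> in the bounds for sums and maximal functions.
\<close>
lemma ramanujan_sum_expand:
  assumes "prime_set C"
  shows "ramanujan_sum C n = (\<Sum>D\<in>Pow C. (-1) ^ card (C - D) * (if int (\<Prod>D) dvd n then real (\<Prod>D) else 0))"
proof -
  have fin: "finite C" using assms by (rule prime_set_finite)
  have "ramanujan_sum C n = (\<Prod>p\<in>C. (if int p dvd n then real p else 0) + (- 1))"
    unfolding ramanujan_sum_def by (intro prod.cong) auto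
  also have "\<dots> = (\<Sum>D\<in>Pow C. (\<Prod>p\<in>D. if int p dvd n then real p else 0) * (\<Prod>p\<in>C - D. - 1))"
    by (rule prod_add[OF fin])
  also have "\<dots> = (\<Sum>D\<in>Pow C. (-1) ^ card (C - D) * (if int (\<Prod>D) dvd n then real (\<Prod>D) else 0))"
  proof (intro sum.cong refl)
    fix D assume "D \<in> Pow C"
    hence D: "prime_set D" using assms prime_set_subset by auto
    have "(\<Prod>p\<in>D. if int p dvd n then real p else 0) = (if int (\<Prod>D) dvd n then real (\<Prod>D) else 0)"
    proof (cases "\<forall>p\<in>D. int p dvd n")
      case True
      thus ?thesis using prime_set_int_dvd_iff[OF D] by (simp del: of_nat_prod add: of_nat_prod[where 'a=real])
    next
      case False
      hence "(\<Prod>p\<in>D. if int p dvd n then real p else 0) = 0"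
        using prime_set_finite[OF D] by (auto simp: prod_zero_iff)
      thus ?thesis using False prime_set_int_dvd_iff[OF D] by auto
    qed
    thus "(\<Prod>p\<in>D. if int p dvd n then real p else 0) * (\<Prod>p\<in>C - D. - 1) =
      (-1) ^ card (C - D) * (if int (\<Prod>D) dvd n then real (\<Prod>D) else 0)" by simp
  qed
  finally show ?thesis .
qed

lemma sum_multiples:
  fixes g :: "int \<Rightarrow> real"
  assumes "d > 0"
  shows "(\<Sum>n\<in>{1..int N}. if int d dvd n then g n else 0) = (\<Sum>m\<in>{1..N div d}. g (int d * int m))"
proof -
  have "(\<Sum>n\<in>{1..int N}. if int d dvd n then g n else 0) = (\<Sum>n\<in>{n\<in>{1..int N}. int d dvd n}. g n)"
    by (subst sum.inter_filter) auto
  also have "\<dots> = (\<Sum>m\<in>{1..N div d}. g (int d * int m))"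
  proof (rule sum.reindex_bij_witness[of _ "\<lambda>m. int d * int m" "\<lambda>n. nat (n div int d)"])
    fix n assume n: "n \<in> {n \<in> {1..int N}. int d dvd n}"
    then obtain k where k: "n = int d * k" by auto
    have k0: "k \<ge> 1" using n k assms by (auto simp: int_one_le_iff_zero_less zero_less_mult_iff)
    then obtain m where m: "k = int m" by (metis nonneg_int_cases order_trans zero_le_one)
    have e: "nat (n div int d) = m" using k m assms by simp
    show "int d * int (nat (n div int d)) = n" using e k m by simp
    have "int (d * m) \<le> int N" using n k m by simp
    hence "d * m \<le> N" by (simp only: of_nat_le_iff)
    hence "m \<le> N div d" using assms by (simp add: less_eq_div_iff_mult_less_eq mult.commute)
    thus "nat (n div int d) \<in> {1..N div d}" using e k0 m by simp
    show "g (int d * int (nat (n div int d))) = g n" using e k m by simp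
  next
    fix m assume m: "m \<in> {1..N div d}"
    show "nat (int d * int m div int d) = m" using assms by simp
    have "d * m \<le> N" using m assms by (metis atLeastAtMost_iff less_eq_div_iff_mult_less_eq mult.commute)
    hence "int d * int m \<le> int N" by (metis of_nat_le_iff of_nat_mult)
    thus "int d * int m \<in> {n \<in> {1..int N}. int d dvd n}" using m assms by (auto simp: int_one_le_iff_zero_less)
  qed
  finally show ?thesis .
qed

lemma ramanujan_sum_l1:
  assumes "prime_set C"
  shows "(\<Sum>n\<in>{1..int N}. \<bar>ramanujan_sum C n\<bar>) \<le> 2 ^ card C * real N"
proof -
  have "(\<Sum>n\<in>{1..int N}. \<bar>ramanujan_sum C n\<bar>)
      \<le> (\<Sum>n\<in>{1..int N}. \<Sum>D\<in>Pow C. if int (\<Prod>D) dvd n then real (\<Prod>D) else 0)"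
    unfolding ramanujan_sum_expand[OF assms]
    by (intro sum_mono order_trans[OF sum_abs]) (auto simp: abs_mult power_abs simp del: of_nat_prod)
  also have "\<dots> = (\<Sum>D\<in>Pow C. \<Sum>n\<in>{1..int N}. if int (\<Prod>D) dvd n then real (\<Prod>D) else 0)"
    by (rule sum.swap)
  also have "\<dots> \<le> (\<Sum>D\<in>Pow C. real N)"
  proof (rule sum_mono)
    fix D assume "D \<in> Pow C"
    hence "prime_set D" using assms prime_set_subset by auto
    hence "\<Prod>D > 0" by (rule prime_set_prod_pos)
    hence "(\<Sum>n\<in>{1..int N}. if int (\<Prod>D) dvd n then real (\<Prod>D) else 0) = real (N div \<Prod>D * \<Prod>D)"
      by (subst sum_multiples) auto
    also have "\<dots> \<le> real N" by (subst of_nat_le_iff) simp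
    finally show "(\<Sum>n\<in>{1..int N}. if int (\<Prod>D) dvd n then real (\<Prod>D) else 0) \<le> real N" .
  qed
  also have "\<dots> = 2 ^ card C * real N" using prime_set_finite[OF assms] by (simp add: card_Pow)
  finally show ?thesis .
qed

section \<open>Sums over periods\<close>

definition periodic :: "(int \<Rightarrow> real) \<Rightarrow> nat \<Rightarrow> bool" where
  "periodic G q \<longleftrightarrow> q > 0 \<and> (\<forall>n. G (n + int q) = G n)"

lemma periodic_add_mult:
  assumes "periodic G q"
  shows "G (n + int q * k) = G n"
proof -
  have nat: "G (n + int q * int j) = G n" for n j
  proof (induction j)
    case (Suc j)
    have "n + int q * int (Suc j) = (n + int q * int j) + int q" by (simp add: algebra_simps)
    thus ?case using assms Suc by (metis periodic_def)
  qed simp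
  show ?thesis
  proof (cases "k \<ge> 0")
    case True thus ?thesis using nat[of n "nat k"] by simp
  next
    case False thus ?thesis using nat[of "n + int q * k" "nat (- k)"] by simp
  qed
qed

lemma periodic_mod: "periodic G q \<Longrightarrow> G (n mod int q) = G n"
  using periodic_add_mult[of G q "n mod int q" "n div int q"] by (simp add: add.commute)

lemma int_dvd_small:
  assumes "int q dvd d" "\<bar>d\<bar> < int q"
  shows "d = 0"
  using dvd_imp_le_int[of d "int q"] assms by fastforce

lemma periodic_sum_shift:
  assumes "periodic G q"
  shows "(\<Sum>m\<in>{a..<a + int q}. G m) = (\<Sum>m\<in>{0..<int q}. G m)"
proof -
  have q: "q > 0" using assms by (simp add: periodic_def)
  have inj: "inj_on (\<lambda>m. m mod int q) {a..<a + int q}"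
  proof (rule inj_onI)
    fix x y assume xy: "x \<in> {a..<a + int q}" "y \<in> {a..<a + int q}" "x mod int q = y mod int q"
    have "int q dvd x - y" using xy(3) by (simp add: mod_eq_dvd_iff)
    moreover have "\<bar>x - y\<bar> < int q" using xy(1,2) unfolding atLeastLessThan_iff by linarith
    ultimately show "x = y" using int_dvd_small[of q "x - y"] by simp
  qed
  have "(\<lambda>m. m mod int q) ` {a..<a + int q} = {0..<int q}"
    using q by (intro card_subset_eq) (auto simp: card_image[OF inj])
  hence "bij_betw (\<lambda>m. m mod int q) {a..<a + int q} {0..<int q}" using inj by (simp add: bij_betw_def)
  hence "(\<Sum>m\<in>{a..<a + int q}. G (m mod int q)) = (\<Sum>m\<in>{0..<int q}. G m)"
    by (rule sum.reindex_bij_betw)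
  thus ?thesis using periodic_mod[OF assms] by simp
qed

lemma periodic_sum_mult:
  assumes "periodic G q"
  shows "(\<Sum>m\<in>{a..<a + int (t * q)}. G m) = real t * (\<Sum>m\<in>{0..<int q}. G m)"
proof (induction t)
  case (Suc t)
  have "int (t * q) \<ge> 0" "int (Suc t * q) = int (t * q) + int q" by (simp_all del: of_nat_mult add: of_nat_mult[symmetric])
  hence "{a..<a + int (Suc t * q)} = {a..<a + int (t * q)} \<union> {a + int (t * q)..<(a + int (t * q)) + int q}"
    by (auto simp del: of_nat_mult)
  hence "(\<Sum>m\<in>{a..<a + int (Suc t * q)}. G m) = (\<Sum>m\<in>{a..<a + int (t * q)}. G m) + (\<Sum>m\<in>{a + int (t * q)..<(a + int (t * q)) + int q}. G m)"
    by (simp only:) (rule sum.union_disjoint, auto)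
  also have "\<dots> = real (Suc t) * (\<Sum>m\<in>{0..<int q}. G m)"
    by (simp only: Suc.IH periodic_sum_shift[OF assms]) (simp add: algebra_simps)
  finally show ?case .
qed simp

text \<open>
Complete periods contribute nothing; fewer than \<open>q\<close> terms remain.
\<close>
lemma periodic_sum_abs_le:
  assumes "periodic G q" "(\<Sum>m\<in>{0..<int q}. G m) = 0" "\<And>n. \<bar>G n\<bar> \<le> B"
  shows "\<bar>\<Sum>m\<in>{a..b}. G m\<bar> \<le> real q * B"
proof (cases "a \<le> b + 1")
  case True
  have q: "q > 0" using assms(1) by (simp add: periodic_def)
  have B: "B \<ge> 0" using assms(3)[of 0] by linarith
  define t r where "t = nat (b + 1 - a) div q" and "r = nat (b + 1 - a) mod q"
  have tr: "t * q + r = nat (b + 1 - a)" by (simp add: t_def r_def)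
  have "int (t * q) + int r = b + 1 - a" using True tr by linarith
  moreover have "int (t * q) \<ge> 0" by (rule of_nat_0_le_iff)
  ultimately have e: "{a..b} = {a..<a + int (t * q)} \<union> {a + int (t * q)..<a + int (t * q) + int r}"
    by (auto simp del: of_nat_mult)
  have "(\<Sum>m\<in>{a..b}. G m) = (\<Sum>m\<in>{a..<a + int (t * q)}. G m) + (\<Sum>m\<in>{a + int (t * q)..<a + int (t * q) + int r}. G m)"
    unfolding e by (rule sum.union_disjoint) auto
  also have "\<dots> = (\<Sum>m\<in>{a + int (t * q)..<a + int (t * q) + int r}. G m)"
    using periodic_sum_mult[OF assms(1)] assms(2) by simp
  also have "\<bar>\<dots>\<bar> \<le> (\<Sum>m\<in>{a + int (t * q)..<a + int (t * q) + int r}. B)"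
    by (intro order_trans[OF sum_abs] sum_mono assms(3))
  also have "\<dots> = real r * B" by simp
  also have "\<dots> \<le> real q * B" using B q by (intro mult_right_mono) (auto simp: r_def less_imp_le)
  finally show ?thesis .
next
  case False
  thus ?thesis using assms(3)[of 0] by auto
qed

text \<open>
The Chinese remainder theorem: \<open>m\<close> modulo \<open>a b\<close> is the same as the pair of its residues.
\<close>
lemma periodic_sum_coprime:
  assumes F: "periodic F a" and G: "periodic G b" and cop: "coprime a b"
  shows "(\<Sum>m\<in>{0..<int (a * b)}. F m * G m) = (\<Sum>m\<in>{0..<int a}. F m) * (\<Sum>m\<in>{0..<int b}. G m)"
proof -
  have ab: "a > 0" "b > 0" using F G by (auto simp: periodic_def)
  let ?h = "\<lambda>m. (m mod int a, m mod int b)"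
  have inj: "inj_on ?h {0..<int (a * b)}"
  proof (rule inj_onI)
    fix x y assume xy: "x \<in> {0..<int (a * b)}" "y \<in> {0..<int (a * b)}" "?h x = ?h y"
    have "int a dvd x - y" "int b dvd x - y" using xy(3) by (auto simp: mod_eq_dvd_iff)
    hence "int a * int b dvd x - y" using cop by (intro divides_mult) auto
    hence "int (a * b) dvd x - y" by simp
    moreover have "\<bar>x - y\<bar> < int (a * b)" using xy(1,2) unfolding atLeastLessThan_iff by linarith
    ultimately show "x = y" using int_dvd_small[of "a * b" "x - y"] by simp
  qed
  have "?h ` {0..<int (a * b)} = {0..<int a} \<times> {0..<int b}"
  proof (rule card_subset_eq)
    show "?h ` {0..<int (a * b)} \<subseteq> {0..<int a} \<times> {0..<int b}" using ab by auto
    show "card (?h ` {0..<int (a * b)}) = card ({0..<int a} \<times> {0..<int b})"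
      unfolding card_image[OF inj] card_cartesian_product by (simp add: nat_mult_distrib)
  qed simp
  hence bij: "bij_betw ?h {0..<int (a * b)} ({0..<int a} \<times> {0..<int b})" using inj by (simp add: bij_betw_def)
  have "(\<Sum>m\<in>{0..<int (a * b)}. F m * G m) = (\<Sum>m\<in>{0..<int (a * b)}. (\<lambda>(x, y). F x * G y) (?h m))"
    by (intro sum.cong refl) (simp add: periodic_mod[OF F] periodic_mod[OF G])
  also have "\<dots> = (\<Sum>z\<in>{0..<int a} \<times> {0..<int b}. (\<lambda>(x, y). F x * G y) z)"
    by (rule sum.reindex_bij_betw[OF bij])
  also have "\<dots> = (\<Sum>m\<in>{0..<int a}. F m) * (\<Sum>m\<in>{0..<int b}. G m)"
    unfolding sum_product sum.cartesian_product by (intro sum.cong) auto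
  finally show ?thesis .
qed

section \<open>Correlations of Ramanujan sums\<close>

lemma ramanujan_sum_insert:
  assumes "prime_set (insert p C)" "p \<notin> C"
  shows "ramanujan_sum (insert p C) n = (if int p dvd n then real p - 1 else - 1) * ramanujan_sum C n"
  using assms by (simp add: ramanujan_sum_def prime_set_def)

lemma sum_single_prime:
  assumes "p > 0"
  shows "(\<Sum>m\<in>{0..<int p}. if int p dvd m + c then real p - 1 else - 1) = 0"
proof -
  have "(\<Sum>m\<in>{0..<int p}. if int p dvd m + c then real p - 1 else - 1) = (\<Sum>m\<in>{c..<c + int p}. if int p dvd m then real p - 1 else - 1)"
    by (rule sum.reindex_bij_witness[of _ "\<lambda>m. m - c" "\<lambda>m. m + c"]) auto
  also have "\<dots> = (\<Sum>m\<in>{0..<int p}. if int p dvd m then real p - 1 else - 1)"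
    using assms by (intro periodic_sum_shift) (auto simp: periodic_def dvd_add_left_iff)
  also have "\<dots> = (\<Sum>m\<in>{0..<int p}. (if m = 0 then real p else 0) - 1)"
  proof (intro sum.cong refl)
    fix m assume "m \<in> {0..<int p}"
    thus "(if int p dvd m then real p - 1 else - 1) = (if m = 0 then real p else 0) - 1"
      using zdvd_not_zless[of m "int p"] by (cases "m = 0") auto
  qed
  also have "\<dots> = 0" using assms by (simp add: sum_subtractf)
  finally show ?thesis .
qed

lemma dvd_diff_swap: "int p dvd n - m \<longleftrightarrow> int p dvd m - n"
  by (rule dvd_diff_commute)

lemma sum_single_prime_correlation:
  assumes "p > 0"
  shows "(\<Sum>m\<in>{0..<int p}. (if int p dvd m then real p - 1 else - 1) * (if int p dvd n - m then real p - 1 else - 1))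
     = real p * (if int p dvd n then real p - 1 else - 1)"
proof -
  have "(\<Sum>m\<in>{0..<int p}. (if int p dvd m then real p - 1 else - 1) * (if int p dvd n - m then real p - 1 else - 1))
    = (\<Sum>m\<in>{0..<int p}. (if m = 0 then real p else 0) * (if int p dvd n then real p - 1 else - 1)
         - (if int p dvd m + (- n) then real p - 1 else - 1))"
  proof (intro sum.cong refl)
    fix m assume m: "m \<in> {0..<int p}"
    have "int p dvd n - m \<longleftrightarrow> int p dvd m + - n" using dvd_diff_swap[of p n m] by simp
    thus "(if int p dvd m then real p - 1 else - 1) * (if int p dvd n - m then real p - 1 else - 1)
      = (if m = 0 then real p else 0) * (if int p dvd n then real p - 1 else - 1)
         - (if int p dvd m + (- n) then real p - 1 else - 1)"
      using m zdvd_not_zless[of m "int p"] by (cases "m = 0") (simp_all add: algebra_simps)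
  qed
  also have "\<dots> = real p * (if int p dvd n then real p - 1 else - 1)"
    using assms sum_single_prime[OF assms, of "- n"] by (simp add: sum_subtractf flip: sum_distrib_right)
  finally show ?thesis .
qed

lemma periodic_ramanujan_product:
  assumes "prime_set C" "prime_set D" "\<Prod>C dvd q" "\<Prod>D dvd q" "q > 0"
  shows "periodic (\<lambda>m. ramanujan_sum C m * ramanujan_sum D (m - n)) q"
    "periodic (\<lambda>m. ramanujan_sum C m * ramanujan_sum D (n - m)) q"
proof -
  have C: "ramanujan_sum C (x + int q) = ramanujan_sum C x" for x
    using assms by (intro ramanujan_sum_periodic) (auto simp: prime_set_finite simp del: of_nat_prod)
  have D: "ramanujan_sum D (x + int q) = ramanujan_sum D x" "ramanujan_sum D (x + - int q) = ramanujan_sum D x" for x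
    using assms by (intro ramanujan_sum_periodic; auto simp: prime_set_finite simp del: of_nat_prod)+
  show "periodic (\<lambda>m. ramanujan_sum C m * ramanujan_sum D (m - n)) q"
    using C D(1)[of "_ - n"] assms(5) by (auto simp: periodic_def algebra_simps)
  show "periodic (\<lambda>m. ramanujan_sum C m * ramanujan_sum D (n - m)) q"
    using C D(2)[of "n - _"] assms(5) by (auto simp: periodic_def algebra_simps)
qed

text \<open>
Up to the factor \<open>q\<close>, the function \<open>c\<^sub>q\<close> is idempotent under cyclic convolution, as it is the sum of all
primitive characters \<open>n \<mapsto> e(a n / q)\<close>. By the Chinese remainder theorem it suffices to check one
prime.
\<close>
lemma ramanujan_sum_autocorrelation:
  assumes "prime_set C"
  shows "(\<Sum>m\<in>{0..<int (\<Prod>C)}. ramanujan_sum C m * ramanujan_sum C (n - m)) = real (\<Prod>C) * ramanujan_sum C n"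
proof -
  have "finite C" using assms by (rule prime_set_finite)
  thus ?thesis using assms
  proof (induction C rule: finite_induct)
    case empty
    have "{0..<1::int} = {0}" by auto
    thus ?case by (simp add: ramanujan_sum_def)
  next
    case (insert p C)
    have C: "prime_set C" using insert.prems by (rule prime_set_subset) auto
    have p: "p > 0" using insert.prems by (auto simp: prime_set_def prime_gt_0_nat)
    let ?c = "\<lambda>m. if int p dvd m then real p - 1 else - 1"
    have per: "periodic (\<lambda>m. ?c m * ?c (n - m)) p"
    proof -
      have "prime_set {p}" using insert.prems by (simp add: prime_set_def)
      hence "periodic (\<lambda>m. ramanujan_sum {p} m * ramanujan_sum {p} (n - m)) p"
        using p by (intro periodic_ramanujan_product) auto
      thus ?thesis by (simp add: ramanujan_sum_def)
    qed
    have perC: "periodic (\<lambda>m. ramanujan_sum C m * ramanujan_sum C (n - m)) (\<Prod>C)"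
      by (intro periodic_ramanujan_product C) (auto simp: prime_set_prod_pos[OF C])
    have e: "\<Prod>(insert p C) = p * \<Prod>C" using insert.hyps by simp
    have "(\<Sum>m\<in>{0..<int (\<Prod>(insert p C))}. ramanujan_sum (insert p C) m * ramanujan_sum (insert p C) (n - m))
       = (\<Sum>m\<in>{0..<int (p * \<Prod>C)}. (?c m * ?c (n - m)) * (ramanujan_sum C m * ramanujan_sum C (n - m)))"
      unfolding e ramanujan_sum_insert[OF insert.prems insert.hyps(2)] by (simp only: mult.assoc mult.commute mult.left_commute)
    also have "\<dots> = (\<Sum>m\<in>{0..<int p}. ?c m * ?c (n - m)) * (\<Sum>m\<in>{0..<int (\<Prod>C)}. ramanujan_sum C m * ramanujan_sum C (n - m))"
      by (rule periodic_sum_coprime[OF per perC prime_set_prod_insert_coprime[OF insert.prems insert.hyps(2)]])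
    also have "\<dots> = (real p * ?c n) * (real (\<Prod>C) * ramanujan_sum C n)"
      by (simp only: sum_single_prime_correlation[OF p] insert.IH[OF C])
    also have "\<dots> = real (\<Prod>(insert p C)) * ramanujan_sum (insert p C) n"
      unfolding e ramanujan_sum_insert[OF insert.prems insert.hyps(2)] of_nat_mult by (simp only: mult.assoc mult.commute mult.left_commute)
    finally show ?case .
  qed
qed

text \<open>
A prime \<open>p\<close> that divides only one of the two moduli splits off a factor, the sum of \<open>c\<^sub>p\<close> over a full
period, and this factor is zero.
\<close>
lemma ramanujan_sum_orthogonal_not_subset:
  assumes C: "prime_set C" and D: "prime_set D" and p: "p \<in> C" "p \<notin> D"
  shows "(\<Sum>m\<in>{0..<int (\<Prod>C * \<Prod>D)}. ramanujan_sum C m * ramanujan_sum D (m - n)) = 0"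
proof -
  define C' where "C' = C - {p}"
  have ins: "C = insert p C'" "p \<notin> C'" using p by (auto simp: C'_def)
  have C': "prime_set C'" using C by (rule prime_set_subset) (auto simp: C'_def)
  have pp: "prime p" using C p by (auto simp: prime_set_def)
  have p0: "p > 0" using pp prime_gt_0_nat by blast
  let ?c = "\<lambda>m. if int p dvd m then real p - 1 else - 1"
  have per: "periodic ?c p" using p0 by (auto simp: periodic_def dvd_add_left_iff)
  have perC: "periodic (\<lambda>m. ramanujan_sum C' m * ramanujan_sum D (m - n)) (\<Prod>C' * \<Prod>D)"
    by (intro periodic_ramanujan_product C' D) (auto simp: prime_set_prod_pos[OF C'] prime_set_prod_pos[OF D])
  have "coprime p (\<Prod>C' * \<Prod>D)"
  proof -
    have "coprime p (\<Prod>C')" using prime_set_prod_insert_coprime[of p C'] C ins by simp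
    moreover have "prime_set (insert p D)" using D pp by (auto simp: prime_set_def)
    hence "coprime p (\<Prod>D)" using p(2) by (rule prime_set_prod_insert_coprime)
    ultimately show ?thesis by simp
  qed
  note cop = this
  have insC: "ramanujan_sum C m = ?c m * ramanujan_sum C' m" for m
    using ramanujan_sum_insert[of p C'] C ins by simp
  have e: "\<Prod>C * \<Prod>D = p * (\<Prod>C' * \<Prod>D)" using ins prime_set_finite[OF C'] by simp
  have "(\<Sum>m\<in>{0..<int (\<Prod>C * \<Prod>D)}. ramanujan_sum C m * ramanujan_sum D (m - n))
     = (\<Sum>m\<in>{0..<int (p * (\<Prod>C' * \<Prod>D))}. ?c m * (ramanujan_sum C' m * ramanujan_sum D (m - n)))"
    unfolding e insC by (simp only: mult.assoc)
  also have "\<dots> = (\<Sum>m\<in>{0..<int p}. ?c m) * (\<Sum>m\<in>{0..<int (\<Prod>C' * \<Prod>D)}. ramanujan_sum C' m * ramanujan_sum D (m - n))"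
    by (rule periodic_sum_coprime[OF per perC cop])
  also have "\<dots> = 0" using sum_single_prime[OF p0, of 0] by simp
  finally show ?thesis .
qed

lemma ramanujan_sum_orthogonal:
  assumes C: "prime_set C" and D: "prime_set D" and ne: "C \<noteq> D"
  shows "(\<Sum>m\<in>{0..<int (\<Prod>C * \<Prod>D)}. ramanujan_sum C m * ramanujan_sum D (m - n)) = 0"
proof (cases "C \<subseteq> D")
  case False
  thus ?thesis using ramanujan_sum_orthogonal_not_subset[OF C D] by blast
next
  case True
  then obtain p where p: "p \<in> D" "p \<notin> C" using ne by blast
  let ?Q = "\<Prod>C * \<Prod>D"
  have per: "periodic (\<lambda>m. ramanujan_sum D m * ramanujan_sum C (m - (- n))) ?Q"
    by (intro periodic_ramanujan_product C D) (auto simp: prime_set_prod_pos[OF C] prime_set_prod_pos[OF D])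
  have "(\<Sum>m\<in>{0..<int ?Q}. ramanujan_sum C m * ramanujan_sum D (m - n))
     = (\<Sum>m\<in>{- n..<- n + int ?Q}. ramanujan_sum D m * ramanujan_sum C (m - (- n)))"
    by (rule sum.reindex_bij_witness[of _ "\<lambda>m. m + n" "\<lambda>m. m - n"]) auto
  also have "\<dots> = (\<Sum>m\<in>{0..<int ?Q}. ramanujan_sum D m * ramanujan_sum C (m - (- n)))"
    by (rule periodic_sum_shift[OF per])
  also have "\<dots> = 0" using ramanujan_sum_orthogonal_not_subset[OF D C p, of "- n"] by (simp add: mult.commute)
  finally show ?thesis .
qed

section \<open>Maximal averages weighted by Ramanujan sums\<close>

definition weighted_avg :: "nat \<Rightarrow> (int \<Rightarrow> real) \<Rightarrow> (int \<Rightarrow> real) \<Rightarrow> int \<Rightarrow> real" where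
  "weighted_avg N k f x = (\<Sum>n\<in>{1..int N}. k n * f (x - n)) / real N"

text \<open>
The value \<open>0\<close> is inserted so that the maximum over an empty set of scales is \<open>0\<close>.
\<close>
definition max_over :: "nat set \<Rightarrow> (nat \<Rightarrow> real) \<Rightarrow> real" where
  "max_over A g = Max (insert 0 ((\<lambda>N. \<bar>g N\<bar>) ` A))"

lemma max_over_ge: "finite A \<Longrightarrow> N \<in> A \<Longrightarrow> \<bar>g N\<bar> \<le> max_over A g"
  unfolding max_over_def by (intro Max_ge) auto

lemma max_over_nonneg: "finite A \<Longrightarrow> 0 \<le> max_over A g"
  unfolding max_over_def by (intro Max_ge) auto

lemma max_over_le: "finite A \<Longrightarrow> 0 \<le> b \<Longrightarrow> (\<And>N. N \<in> A \<Longrightarrow> \<bar>g N\<bar> \<le> b) \<Longrightarrow> max_over A g \<le> b"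
  unfolding max_over_def by (subst Max_le_iff) auto

abbreviation ramanujan_max :: "nat set \<Rightarrow> nat set \<Rightarrow> (int \<Rightarrow> real) \<Rightarrow> int \<Rightarrow> real" where
  "ramanujan_max A C f x \<equiv> max_over A (\<lambda>N. weighted_avg N (ramanujan_sum C) f x)"

text \<open>
Up to \<open>N\<close> there are \<open>n = N div d\<close> multiples of \<open>d\<close>, so the weight \<open>d / N\<close> is at most \<open>1 / n\<close>, and the
average is dominated by a plain average along \<open>x - d, x - 2 d, \<dots>\<close>.
\<close>
lemma progression_maximal:
  assumes h: "l2_bounded h B" and d: "d > 0" and A: "finite A"
  shows "l2_bounded (\<lambda>x. max_over A (\<lambda>N. weighted_avg N (\<lambda>n. if int d dvd n then real d else 0) (\<lambda>y. \<bar>h y\<bar>) x)) (2 * B)"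
proof (rule maximal_function_l2[OF l2_bounded_shift[OF h, of "int d"], of _ "Max (insert 0 A)" "int d"])
  show "0 \<le> max_over A (\<lambda>N. weighted_avg N (\<lambda>n. if int d dvd n then real d else 0) (\<lambda>y. \<bar>h y\<bar>) x)" for x
    by (rule max_over_nonneg[OF A])
next
  fix x :: int
  let ?w = "\<lambda>N. weighted_avg N (\<lambda>n. if int d dvd n then real d else 0) (\<lambda>y. \<bar>h y\<bar>) x"
  assume pos: "max_over A ?w > 0"
  have "max_over A ?w \<in> insert 0 ((\<lambda>N. \<bar>?w N\<bar>) ` A)" unfolding max_over_def using A by (intro Max_in) auto
  then obtain N where N: "N \<in> A" "max_over A ?w = \<bar>?w N\<bar>" using pos by auto
  define n where "n = N div d"
  let ?s = "\<Sum>m<n. \<bar>h (x - int d - int d * int m)\<bar>"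
  have "(\<Sum>k\<in>{1..int N}. (if int d dvd k then real d else 0) * \<bar>h (x - k)\<bar>)
     = (\<Sum>k\<in>{1..int N}. if int d dvd k then real d * \<bar>h (x - k)\<bar> else 0)" by (intro sum.cong) auto
  also have "\<dots> = (\<Sum>m\<in>{1..n}. real d * \<bar>h (x - int d * int m)\<bar>)"
    unfolding n_def by (rule sum_multiples[OF d])
  also have "\<dots> = (\<Sum>m<n. real d * \<bar>h (x - int d * int (Suc m))\<bar>)"
    by (rule sum.reindex_bij_witness[of _ Suc "\<lambda>m. m - 1"]) auto
  also have "\<dots> = real d * ?s" by (simp add: sum_distrib_left algebra_simps)
  finally have w: "?w N = real d * ?s / real N" by (simp add: weighted_avg_def)
  have s0: "?s \<ge> 0" by (intro sum_nonneg) auto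
  have n1: "n \<ge> 1"
  proof (rule ccontr)
    assume "\<not> n \<ge> 1"
    hence "n = 0" by simp
    hence "?w N = 0" unfolding w by simp
    thus False using pos N by simp
  qed
  have N0: "N > 0" using n1 d by (auto simp: n_def intro: Nat.gr0I)
  have "max_over A ?w * real n = (real (n * d) / real N) * ?s"
    using N(2) w s0 by (simp add: field_simps)
  also have "\<dots> \<le> 1 * ?s"
    using N0 by (intro mult_right_mono s0) (simp add: n_def del: of_nat_mult)
  finally have "max_over A ?w * real n \<le> ?s" by simp
  moreover have "n \<le> Max (insert 0 A)"
  proof -
    have "n \<le> N" by (simp add: n_def)
    also have "N \<le> Max (insert 0 A)" using N A by (intro Max_ge) auto
    finally show ?thesis .
  qed
  ultimately show "\<exists>n\<in>{1..Max (insert 0 A)}. max_over A ?w * real n \<le> (\<Sum>m<n. \<bar>h (x - int d * int m - int d)\<bar>)"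
    using n1 by (intro bexI[of _ n]) (simp_all add: algebra_simps)
qed

lemma ramanujan_maximal:
  assumes C: "prime_set C" and h: "l2_bounded h B" and A: "finite A"
  shows "l2_bounded (\<lambda>x. ramanujan_max A C h x) (2 ^ card C * (2 * B))"
proof -
  let ?u = "\<lambda>D x. max_over A (\<lambda>N. weighted_avg N (\<lambda>n. if int (\<Prod>D) dvd n then real (\<Prod>D) else 0) (\<lambda>y. \<bar>h y\<bar>) x)"
  have l2: "l2_bounded (\<lambda>x. \<Sum>D\<in>Pow C. ?u D x) (\<Sum>D\<in>Pow C. 2 * B)"
    using prime_set_prod_pos prime_set_subset[OF C] by (intro l2_bounded_sum progression_maximal h A) auto
  show ?thesis
  proof (rule l2_bounded_mono[OF l2])
    fix x
    have u0: "?u D x \<ge> 0" for D by (rule max_over_nonneg[OF A])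
    have "ramanujan_max A C h x \<le> (\<Sum>D\<in>Pow C. ?u D x)"
    proof (rule max_over_le[OF A])
      show "0 \<le> (\<Sum>D\<in>Pow C. ?u D x)" using u0 by (intro sum_nonneg) auto
      fix N assume N: "N \<in> A"
      have "\<bar>\<Sum>n\<in>{1..int N}. ramanujan_sum C n * h (x - n)\<bar>
         \<le> (\<Sum>n\<in>{1..int N}. \<Sum>D\<in>Pow C. (if int (\<Prod>D) dvd n then real (\<Prod>D) else 0) * \<bar>h (x - n)\<bar>)"
      proof (rule order_trans[OF sum_abs], rule sum_mono)
        fix n
        have "\<bar>ramanujan_sum C n\<bar> \<le> (\<Sum>D\<in>Pow C. if int (\<Prod>D) dvd n then real (\<Prod>D) else 0)"
          unfolding ramanujan_sum_expand[OF C]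
          by (rule order_trans[OF sum_abs], rule sum_mono) (auto simp: abs_mult power_abs simp del: of_nat_prod)
        thus "\<bar>ramanujan_sum C n * h (x - n)\<bar> \<le> (\<Sum>D\<in>Pow C. (if int (\<Prod>D) dvd n then real (\<Prod>D) else 0) * \<bar>h (x - n)\<bar>)"
          unfolding abs_mult sum_distrib_right[symmetric] by (rule mult_right_mono) simp
      qed
      also have "\<dots> = (\<Sum>D\<in>Pow C. \<Sum>n\<in>{1..int N}. (if int (\<Prod>D) dvd n then real (\<Prod>D) else 0) * \<bar>h (x - n)\<bar>)"
        by (rule sum.swap)
      finally have "\<bar>weighted_avg N (ramanujan_sum C) h x\<bar> \<le> (\<Sum>D\<in>Pow C. weighted_avg N (\<lambda>n. if int (\<Prod>D) dvd n then real (\<Prod>D) else 0) (\<lambda>y. \<bar>h y\<bar>) x)"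
        unfolding weighted_avg_def by (simp add: divide_right_mono del: of_nat_prod flip: sum_divide_distrib)
      also have "\<dots> \<le> (\<Sum>D\<in>Pow C. ?u D x)"
      proof (rule sum_mono)
        fix D
        show "weighted_avg N (\<lambda>n. if int (\<Prod>D) dvd n then real (\<Prod>D) else 0) (\<lambda>y. \<bar>h y\<bar>) x \<le> ?u D x"
          using max_over_ge[OF A N, of "\<lambda>N. weighted_avg N (\<lambda>n. if int (\<Prod>D) dvd n then real (\<Prod>D) else 0) (\<lambda>y. \<bar>h y\<bar>) x"] by linarith
      qed
      finally show "\<bar>weighted_avg N (ramanujan_sum C) h x\<bar> \<le> (\<Sum>D\<in>Pow C. ?u D x)" .
    qed
    thus "\<bar>ramanujan_max A C h x\<bar> \<le> \<bar>\<Sum>D\<in>Pow C. ?u D x\<bar>"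
      using max_over_nonneg[OF A, of "\<lambda>N. weighted_avg N (ramanujan_sum C) h x"] by linarith
  qed (simp add: card_Pow prime_set_finite[OF C])
qed

text \<open>
Since \<open>M\<close> is a multiple of \<open>q\<close>, the autocorrelation of \<open>c\<^sub>q\<close> over \<open>{1..M}\<close> is exactly \<open>M c\<^sub>q\<close>.
Convolving the long average with the short one therefore reproduces the long average, apart from the
two end pieces of length at most \<open>M\<close> where the windows do not match. This is what allows the
maximal function over the long scales \<open>N\<close> to be applied to the projections
\<open>weighted_avg M c f\<close>, which do not depend on \<open>N\<close> and are almost orthogonal for different moduli.
\<close>
lemma ramanujan_reproducing:
  assumes C: "prime_set C" and f: "l2_bounded f B" and M: "M = t * \<Prod>C" "0 < M" "M \<le> N"
  defines "c \<equiv> ramanujan_sum C"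
  shows "l2_bounded (\<lambda>x. weighted_avg N c f x - weighted_avg N c (weighted_avg M c f) x)
     (2 * real M * real (\<Prod>C) ^ 2 / real N * B)"
proof -
  let ?q = "real (\<Prod>C)"
  have B0: "B \<ge> 0" by (rule l2_bounded_nonneg[OF f])
  have c: "\<bar>c n\<bar> \<le> ?q" for n unfolding c_def by (rule ramanujan_sum_abs_le[OF C])
  have q0: "?q \<ge> 0" by (rule of_nat_0_le_iff)
  have NM: "N > 0" using M(2,3) by linarith
  let ?r = "\<lambda>m x. (\<Sum>n\<in>{1..m}. c (n - m) * f (x - n)) - (\<Sum>n\<in>{int N + 1..int N + m}. c (n - m) * f (x - n))"
  have auto_corr: "(\<Sum>m\<in>{1..int M}. c m * c (n - m)) = real M * c n" for n
  proof -
    have per: "periodic (\<lambda>m. c m * c (n - m)) (\<Prod>C)"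
      unfolding c_def by (intro periodic_ramanujan_product C) (auto simp: prime_set_prod_pos[OF C])
    have "{1..int M} = {1..<1 + int (t * \<Prod>C)}" using M by auto
    hence "(\<Sum>m\<in>{1..int M}. c m * c (n - m)) = real t * (\<Sum>m\<in>{0..<int (\<Prod>C)}. c m * c (n - m))"
      using periodic_sum_mult[OF per, of 1 t] by simp
    thus ?thesis using ramanujan_sum_autocorrelation[OF C, of n] M by (simp add: c_def)
  qed
  have eq: "weighted_avg N c f x - weighted_avg N c (weighted_avg M c f) x
      = (1 / (real N * real M)) * (\<Sum>m\<in>{1..int M}. c m * ?r m x)" for x
  proof -
    have "(\<Sum>n\<in>{1..int N}. c n * weighted_avg M c f (x - n))
        = (\<Sum>n\<in>{1..int N}. \<Sum>m\<in>{1..int M}. c m * (c n * f (x - n - m))) / real M"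
      by (simp add: weighted_avg_def sum_distrib_left sum_divide_distrib mult_ac)
    also have "(\<Sum>n\<in>{1..int N}. \<Sum>m\<in>{1..int M}. c m * (c n * f (x - n - m)))
        = (\<Sum>m\<in>{1..int M}. c m * (\<Sum>n\<in>{1..int N}. c n * f (x - n - m)))"
      by (subst sum.swap) (simp add: sum_distrib_left)
    also have "\<dots> = (\<Sum>m\<in>{1..int M}. c m * (\<Sum>n\<in>{m+1..int N+m}. c (n - m) * f (x - n)))"
    proof (rule sum.cong[OF refl])
      fix m :: int
      have "(\<Sum>n\<in>{1..int N}. c n * f (x - n - m)) = (\<Sum>n\<in>{m+1..int N+m}. c (n - m) * f (x - n))"
        by (rule sum.reindex_bij_witness[of _ "\<lambda>n. n - m" "\<lambda>n. n + m"]) (auto simp: algebra_simps)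
      thus "c m * (\<Sum>n\<in>{1..int N}. c n * f (x - n - m)) = c m * (\<Sum>n\<in>{m+1..int N+m}. c (n - m) * f (x - n))"
        by (rule arg_cong)
    qed
    finally have 1: "weighted_avg N c (weighted_avg M c f) x =
       (1 / (real N * real M)) * (\<Sum>m\<in>{1..int M}. c m * (\<Sum>n\<in>{m+1..int N+m}. c (n - m) * f (x - n)))"
      unfolding weighted_avg_def[of N c "weighted_avg M c f"] by simp
    have "real M * (\<Sum>n\<in>{1..int N}. c n * f (x - n)) = (\<Sum>n\<in>{1..int N}. \<Sum>m\<in>{1..int M}. c m * c (n - m) * f (x - n))"
      unfolding sum_distrib_left
    proof (rule sum.cong[OF refl])
      fix n
      have "(\<Sum>m\<in>{1..int M}. c m * c (n - m) * f (x - n)) = real M * c n * f (x - n)"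
        by (simp only: sum_distrib_right[symmetric] auto_corr)
      thus "real M * (c n * f (x - n)) = (\<Sum>m\<in>{1..int M}. c m * c (n - m) * f (x - n))" by (simp only: mult.assoc)
    qed
    also have "\<dots> = (\<Sum>m\<in>{1..int M}. c m * (\<Sum>n\<in>{1..int N}. c (n - m) * f (x - n)))"
      by (subst sum.swap) (simp add: sum_distrib_left mult.assoc)
    finally have 2: "weighted_avg N c f x = (1 / (real N * real M)) * (\<Sum>m\<in>{1..int M}. c m * (\<Sum>n\<in>{1..int N}. c (n - m) * f (x - n)))"
      using M(2) NM by (simp add: weighted_avg_def[of N c f] field_simps)
    have 3: "(\<Sum>n\<in>{1..int N}. c (n - m) * f (x - n)) - (\<Sum>n\<in>{m+1..int N+m}. c (n - m) * f (x - n)) = ?r m x"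
      if m: "m \<in> {1..int M}" for m
    proof -
      have a: "{1..int N} = {1..m} \<union> {m+1..int N}" "{m+1..int N+m} = {m+1..int N} \<union> {int N+1..int N+m}"
        using m M(3) by auto
      have "(\<Sum>n\<in>{1..int N}. c (n - m) * f (x - n)) = (\<Sum>n\<in>{1..m}. c (n - m) * f (x - n)) + (\<Sum>n\<in>{m+1..int N}. c (n - m) * f (x - n))"
        unfolding a(1) by (rule sum.union_disjoint) auto
      moreover have "(\<Sum>n\<in>{m+1..int N+m}. c (n - m) * f (x - n)) = (\<Sum>n\<in>{m+1..int N}. c (n - m) * f (x - n)) + (\<Sum>n\<in>{int N+1..int N+m}. c (n - m) * f (x - n))"
        unfolding a(2) by (rule sum.union_disjoint) auto
      ultimately show ?thesis by simp
    qed
    have "weighted_avg N c f x - weighted_avg N c (weighted_avg M c f) x = (1 / (real N * real M)) * (\<Sum>m\<in>{1..int M}. c m *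
      ((\<Sum>n\<in>{1..int N}. c (n - m) * f (x - n)) - (\<Sum>n\<in>{m+1..int N+m}. c (n - m) * f (x - n))))"
      unfolding 1 2 by (simp add: sum_subtractf right_diff_distrib)
    also have "(\<Sum>m\<in>{1..int M}. c m * ((\<Sum>n\<in>{1..int N}. c (n - m) * f (x - n)) - (\<Sum>n\<in>{m+1..int N+m}. c (n - m) * f (x - n))))
       = (\<Sum>m\<in>{1..int M}. c m * ?r m x)" by (intro sum.cong refl) (simp only: 3)
    finally show ?thesis .
  qed
  have r: "l2_bounded (\<lambda>x. ?r m x) (2 * real M * ?q * B)" if m: "m \<in> {1..int M}" for m
  proof -
    have s: "(\<Sum>n\<in>S. \<bar>c (n - m)\<bar>) \<le> real (card S) * ?q" for S
      using sum_bounded_above[of S "\<lambda>n. \<bar>c (n - m)\<bar>" ?q] c by simp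
    have l2: "l2_bounded (\<lambda>x. \<Sum>n\<in>S. c (n - m) * f (x - n)) (real M * ?q * B)" if S: "card S = nat m" for S
    proof (rule l2_bounded_mono[OF l2_bounded_convolution[OF f]])
      have "(\<Sum>n\<in>S. \<bar>c (n - m)\<bar>) \<le> real (card S) * ?q" by (rule s)
      also have "\<dots> \<le> real M * ?q" using S m by (intro mult_right_mono q0) auto
      finally show "(\<Sum>n\<in>S. \<bar>c (n - m)\<bar>) * B \<le> real M * ?q * B" using B0 by (intro mult_right_mono)
    qed auto
    have "l2_bounded (\<lambda>x. (\<Sum>n\<in>{1..m}. c (n - m) * f (x - n)) + (- 1) * (\<Sum>n\<in>{int N + 1..int N + m}. c (n - m) * f (x - n)))
       (real M * ?q * B + \<bar>- 1\<bar> * (real M * ?q * B))"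
      using m by (intro l2_bounded_add l2_bounded_scale l2) auto
    thus ?thesis by (simp add: algebra_simps)
  qed
  have "l2_bounded (\<lambda>x. \<Sum>m\<in>{1..int M}. c m * ?r m x) (\<Sum>m\<in>{1..int M}. \<bar>c m\<bar> * (2 * real M * ?q * B))"
    by (intro l2_bounded_sum l2_bounded_scale r)
  hence "l2_bounded (\<lambda>x. (1 / (real N * real M)) * (\<Sum>m\<in>{1..int M}. c m * ?r m x))
     (\<bar>1 / (real N * real M)\<bar> * (\<Sum>m\<in>{1..int M}. \<bar>c m\<bar> * (2 * real M * ?q * B)))" by (rule l2_bounded_scale)
  moreover have "\<bar>1 / (real N * real M)\<bar> * (\<Sum>m\<in>{1..int M}. \<bar>c m\<bar> * (2 * real M * ?q * B)) \<le> 2 * real M * ?q ^ 2 / real N * B"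
  proof -
    have "(\<Sum>m\<in>{1..int M}. \<bar>c m\<bar> * (2 * real M * ?q * B)) \<le> (\<Sum>m\<in>{1..int M}. ?q * (2 * real M * ?q * B))"
      using B0 q0 c by (intro sum_mono mult_right_mono) auto
    also have "\<dots> = real M * (?q * (2 * real M * ?q * B))" by simp
    finally have "\<bar>1 / (real N * real M)\<bar> * (\<Sum>m\<in>{1..int M}. \<bar>c m\<bar> * (2 * real M * ?q * B)) \<le> \<bar>1 / (real N * real M)\<bar> * (real M * (?q * (2 * real M * ?q * B)))"
      by (intro mult_left_mono) auto
    also have "\<dots> = 2 * real M * ?q ^ 2 / real N * B"
      using M(2) NM by (simp add: field_simps power2_eq_square del: of_nat_prod)
    finally show ?thesis .
  qed
  ultimately show ?thesis unfolding eq using l2_bounded_mono[OF _ order_refl] by blast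
qed

section \<open>Almost orthogonality\<close>

text \<open>
Schur's test: bound \<open>a x * b y\<close> by the mean of the squares and sum the kernel along rows and columns.
\<close>
lemma correlation_form_le:
  fixes a b r :: "int \<Rightarrow> real"
  assumes X: "finite X" and S: "finite S" and supp: "\<And>n. n \<notin> S \<Longrightarrow> r n = 0"
    and a: "(\<Sum>x\<in>X. (a x)\<^sup>2) \<le> 1" and b: "(\<Sum>x\<in>X. (b x)\<^sup>2) \<le> 1"
  shows "(\<Sum>x\<in>X. \<Sum>y\<in>X. a x * b y * r (x - y)) \<le> (\<Sum>n\<in>S. \<bar>r n\<bar>)"
proof -
  define R where "R = (\<Sum>n\<in>S. \<bar>r n\<bar>)"
  have R0: "R \<ge> 0" unfolding R_def by (intro sum_nonneg) auto
  have row: "(\<Sum>y\<in>X. \<bar>r (x - y)\<bar>) \<le> R" for x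
  proof -
    have "(\<Sum>y\<in>X. \<bar>r (x - y)\<bar>) = (\<Sum>n\<in>(\<lambda>y. x - y) ` X. \<bar>r n\<bar>)"
      by (subst sum.reindex) (auto simp: inj_on_def)
    also have "\<dots> = (\<Sum>n\<in>(\<lambda>y. x - y) ` X \<inter> S. \<bar>r n\<bar>)"
      using X supp by (intro sum.mono_neutral_right) auto
    also have "\<dots> \<le> R" unfolding R_def using S by (intro sum_mono2) auto
    finally show ?thesis .
  qed
  have col: "(\<Sum>x\<in>X. \<bar>r (x - y)\<bar>) \<le> R" for y
  proof -
    have "(\<Sum>x\<in>X. \<bar>r (x - y)\<bar>) = (\<Sum>n\<in>(\<lambda>x. x - y) ` X. \<bar>r n\<bar>)"
      by (subst sum.reindex) (auto simp: inj_on_def)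
    also have "\<dots> = (\<Sum>n\<in>(\<lambda>x. x - y) ` X \<inter> S. \<bar>r n\<bar>)"
      using X supp by (intro sum.mono_neutral_right) auto
    also have "\<dots> \<le> R" unfolding R_def using S by (intro sum_mono2) auto
    finally show ?thesis .
  qed
  have "(\<Sum>x\<in>X. \<Sum>y\<in>X. a x * b y * r (x - y)) \<le> (\<Sum>x\<in>X. \<Sum>y\<in>X. ((a x)\<^sup>2 * \<bar>r (x - y)\<bar> + (b y)\<^sup>2 * \<bar>r (x - y)\<bar>) / 2)"
  proof (intro sum_mono)
    fix x y
    have "a x * b y * r (x - y) \<le> \<bar>a x * b y\<bar> * \<bar>r (x - y)\<bar>" by (metis abs_ge_self abs_mult)
    also have "\<dots> \<le> (((a x)\<^sup>2 + (b y)\<^sup>2) / 2) * \<bar>r (x - y)\<bar>"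
      using sum_squares_bound[of "\<bar>a x\<bar>" "\<bar>b y\<bar>"] by (intro mult_right_mono) (auto simp: abs_mult)
    finally show "a x * b y * r (x - y) \<le> ((a x)\<^sup>2 * \<bar>r (x - y)\<bar> + (b y)\<^sup>2 * \<bar>r (x - y)\<bar>) / 2"
      by (simp add: algebra_simps)
  qed
  also have "\<dots> = ((\<Sum>x\<in>X. (a x)\<^sup>2 * (\<Sum>y\<in>X. \<bar>r (x - y)\<bar>)) + (\<Sum>x\<in>X. \<Sum>y\<in>X. (b y)\<^sup>2 * \<bar>r (x - y)\<bar>)) / 2"
    by (simp add: sum.distrib sum_distrib_left flip: sum_divide_distrib)
  also have "(\<Sum>x\<in>X. \<Sum>y\<in>X. (b y)\<^sup>2 * \<bar>r (x - y)\<bar>) = (\<Sum>y\<in>X. (b y)\<^sup>2 * (\<Sum>x\<in>X. \<bar>r (x - y)\<bar>))"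
    by (subst sum.swap) (simp add: sum_distrib_left)
  also have "((\<Sum>x\<in>X. (a x)\<^sup>2 * (\<Sum>y\<in>X. \<bar>r (x - y)\<bar>)) + (\<Sum>y\<in>X. (b y)\<^sup>2 * (\<Sum>x\<in>X. \<bar>r (x - y)\<bar>))) / 2
     \<le> ((\<Sum>x\<in>X. (a x)\<^sup>2 * R) + (\<Sum>y\<in>X. (b y)\<^sup>2 * R)) / 2"
    using row col by (intro divide_right_mono add_mono sum_mono mult_left_mono) auto
  also have "\<dots> = ((\<Sum>x\<in>X. (a x)\<^sup>2) * R + (\<Sum>y\<in>X. (b y)\<^sup>2) * R) / 2"
    by (simp add: sum_distrib_right)
  also have "\<dots> \<le> (1 * R + 1 * R) / 2"
    using a b R0 by (intro divide_right_mono add_mono mult_right_mono) auto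
  finally show ?thesis by (simp add: R_def)
qed

text \<open>
Duality. Testing \<open>U i\<close> against its own normalized values \<open>h i\<close> on the finite set that contains its
support turns the weighted sum of the norms into a single pairing of \<open>f\<close> with
\<open>g = (\<Sum>i\<in>I. \<beta> i * K i\<^sup>* (h i))\<close>. The square of the norm of \<open>g\<close> is a
quadratic form in the correlations of the kernels: the diagonal ones are bounded by Young's
inequality, the others are at most \<open>\<epsilon>\<close> by assumption. Compared with the triangle inequality, the
sum of the \<open>\<beta> i\<close> has been replaced by the square root of the sum of their squares.
\<close>
lemma almost_orthogonal_bessel:
  fixes K :: "'i \<Rightarrow> int \<Rightarrow> real" and f :: "int \<Rightarrow> real" and T :: int
  defines "U \<equiv> \<lambda>i x. \<Sum>n\<in>{1..T}. K i n * f (x - n)"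
  assumes f: "l2_bounded f B" and supp_f: "finite {x. f x \<noteq> 0}" and I: "finite I"
    and K: "\<And>i n. i \<in> I \<Longrightarrow> n \<notin> {1..T} \<Longrightarrow> K i n = 0"
    and beta: "\<And>i. i \<in> I \<Longrightarrow> 0 \<le> \<beta> i"
    and diag: "\<And>i. i \<in> I \<Longrightarrow> (\<Sum>n\<in>{1..T}. \<bar>K i n\<bar>) \<le> e i"
    and off: "\<And>i j. i \<in> I \<Longrightarrow> j \<in> I \<Longrightarrow> i \<noteq> j \<Longrightarrow>
       (\<Sum>n\<in>{-T..T}. \<bar>\<Sum>m\<in>{1..T}. K i m * K j (m - n)\<bar>) \<le> \<epsilon>"
    and eps: "0 \<le> \<epsilon>"
  shows "\<exists>b. (\<forall>i\<in>I. l2_bounded (U i) (b i)) \<and>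
     (\<Sum>i\<in>I. \<beta> i * b i) \<le> B * sqrt ((\<Sum>i\<in>I. (\<beta> i)\<^sup>2 * (e i)\<^sup>2) + \<epsilon> * (\<Sum>i\<in>I. \<beta> i)\<^sup>2)"
proof -
  define X where "X = (\<Union>n\<in>{1..T}. (\<lambda>x. x + n) ` {x. f x \<noteq> 0})"
  define V where "V i = L2_set (U i) X" for i
  define h where "h i x = (if V i = 0 then 0 else U i x / V i)" for i x
  define Y where "Y = (\<Union>n\<in>{1..T}. (\<lambda>x. x - n) ` X)"
  define g where "g y = (\<Sum>i\<in>I. \<beta> i * (\<Sum>x\<in>X. h i x * K i (x - y)))" for y
  define \<rho> where "\<rho> i j n = (\<Sum>m\<in>{1..T}. K i m * K j (m - n))" for i j n
  have finX: "finite X" and finY: "finite Y" using supp_f by (auto simp: X_def Y_def)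
  have U0: "U i x = 0" if "x \<notin> X" for i x
    unfolding U_def
  proof (rule sum.neutral, rule ballI)
    fix n assume n: "n \<in> {1..T}"
    have "f (x - n) = 0"
    proof (rule ccontr)
      assume "f (x - n) \<noteq> 0"
      hence "x \<in> X" unfolding X_def using n by (intro UN_I[of n] image_eqI[of _ _ "x - n"]) auto
      thus False using that by simp
    qed
    thus "K i n * f (x - n) = 0" by simp
  qed
  have l2U: "l2_bounded (U i) (V i)" for i
    unfolding l2_bounded_def
  proof (intro allI impI)
    fix Z :: "int set" assume Z: "finite Z"
    have "(\<Sum>x\<in>Z. (U i x)\<^sup>2) = (\<Sum>x\<in>Z \<inter> X. (U i x)\<^sup>2)" using Z U0 by (intro sum.mono_neutral_right) auto
    also have "\<dots> \<le> (\<Sum>x\<in>X. (U i x)\<^sup>2)" using finX by (intro sum_mono2) auto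
    finally show "L2_set (U i) Z \<le> V i" by (simp add: V_def L2_set_def)
  qed
  have V2: "(\<Sum>x\<in>X. (U i x)\<^sup>2) = (V i)\<^sup>2" for i by (simp add: V_def L2_set_def sum_nonneg)
  have h1: "(\<Sum>x\<in>X. (h i x)\<^sup>2) \<le> 1" for i
  proof (cases "V i = 0")
    case False
    have "(\<Sum>x\<in>X. (h i x)\<^sup>2) = (\<Sum>x\<in>X. (U i x)\<^sup>2) / (V i)\<^sup>2"
      using False by (simp add: h_def power_divide sum_divide_distrib)
    thus ?thesis using False by (simp add: V2)
  qed (simp add: h_def)
  have hU: "(\<Sum>x\<in>X. h i x * U i x) = V i" for i
  proof (cases "V i = 0")
    case False
    have "(\<Sum>x\<in>X. h i x * U i x) = (\<Sum>x\<in>X. (U i x)\<^sup>2) / V i"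
      using False by (simp add: h_def power2_eq_square sum_divide_distrib)
    thus ?thesis using False unfolding V2 by (simp add: power2_eq_square)
  qed (simp add: h_def)
  have Uy: "U i x = (\<Sum>y\<in>Y. K i (x - y) * f y)" if "i \<in> I" "x \<in> X" for i x
  proof -
    have "U i x = (\<Sum>y\<in>(\<lambda>n. x - n) ` {1..T}. K i (x - y) * f y)"
      unfolding U_def by (subst sum.reindex) (auto simp: inj_on_def)
    also have "\<dots> = (\<Sum>y\<in>Y. K i (x - y) * f y)"
    proof (rule sum.mono_neutral_left)
      show "(\<lambda>n. x - n) ` {1..T} \<subseteq> Y" unfolding Y_def using that by blast
      show "\<forall>y\<in>Y - (\<lambda>n. x - n) ` {1..T}. K i (x - y) * f y = 0"
      proof
        fix y assume y: "y \<in> Y - (\<lambda>n. x - n) ` {1..T}"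
        hence "x - y \<notin> {1..T}" by (auto simp: image_iff intro: bexI[of _ "x - y"])
        thus "K i (x - y) * f y = 0" using K that by simp
      qed
    qed (rule finY)
    finally show ?thesis .
  qed
  have rho_Y: "(\<Sum>y\<in>Y. K i (x - y) * K j (x' - y)) = \<rho> i j (x - x')" if "i \<in> I" "j \<in> I" "x \<in> X" for i j x x'
  proof -
    have "\<rho> i j (x - x') = (\<Sum>y\<in>(\<lambda>n. x - n) ` {1..T}. K i (x - y) * K j (x' - y))"
      unfolding \<rho>_def by (subst sum.reindex) (auto simp: inj_on_def algebra_simps)
    also have "\<dots> = (\<Sum>y\<in>Y. K i (x - y) * K j (x' - y))"
    proof (rule sum.mono_neutral_left)
      show "(\<lambda>n. x - n) ` {1..T} \<subseteq> Y" unfolding Y_def using that by blast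
      show "\<forall>y\<in>Y - (\<lambda>n. x - n) ` {1..T}. K i (x - y) * K j (x' - y) = 0"
      proof
        fix y assume y: "y \<in> Y - (\<lambda>n. x - n) ` {1..T}"
        hence "x - y \<notin> {1..T}" by (auto simp: image_iff intro: bexI[of _ "x - y"])
        thus "K i (x - y) * K j (x' - y) = 0" using K that by simp
      qed
    qed (rule finY)
    finally show ?thesis by simp
  qed
  have "(\<Sum>i\<in>I. \<beta> i * V i) = (\<Sum>i\<in>I. \<beta> i * (\<Sum>x\<in>X. h i x * (\<Sum>y\<in>Y. K i (x - y) * f y)))"
    by (intro sum.cong refl) (simp add: Uy flip: hU)
  also have "\<dots> = (\<Sum>i\<in>I. \<Sum>x\<in>X. \<Sum>y\<in>Y. f y * (\<beta> i * (h i x * K i (x - y))))"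
    by (simp add: sum_distrib_left mult_ac)
  also have "\<dots> = (\<Sum>i\<in>I. \<Sum>y\<in>Y. \<Sum>x\<in>X. f y * (\<beta> i * (h i x * K i (x - y))))"
    by (intro sum.cong refl sum.swap)
  also have "\<dots> = (\<Sum>y\<in>Y. \<Sum>i\<in>I. \<Sum>x\<in>X. f y * (\<beta> i * (h i x * K i (x - y))))"
    by (rule sum.swap)
  also have "\<dots> = (\<Sum>y\<in>Y. f y * g y)" by (simp add: g_def sum_distrib_left)
  also have "\<dots> \<le> (\<Sum>y\<in>Y. \<bar>f y\<bar> * \<bar>g y\<bar>)" by (intro sum_mono) (simp flip: abs_mult)
  also have "\<dots> \<le> L2_set f Y * L2_set g Y" by (rule L2_set_mult_ineq)
  also have "\<dots> \<le> B * L2_set g Y" by (intro mult_right_mono l2_boundedD[OF f]) simp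
  finally have main: "(\<Sum>i\<in>I. \<beta> i * V i) \<le> B * L2_set g Y" .
  have rho0: "\<rho> i j n = 0" if "i \<in> I" "j \<in> I" "n \<notin> {-T..T}" for i j n
    unfolding \<rho>_def using that by (intro sum.neutral ballI) (auto simp: K)
  have form: "(\<Sum>x\<in>X. \<Sum>x'\<in>X. h i x * h j x' * \<rho> i j (x - x')) \<le> (\<Sum>n\<in>{-T..T}. \<bar>\<rho> i j n\<bar>)" if "i \<in> I" "j \<in> I" for i j
    using that h1 rho0 by (intro correlation_form_le finX) auto
  have diag': "(\<Sum>n\<in>{-T..T}. \<bar>\<rho> i i n\<bar>) \<le> (e i)\<^sup>2" if i: "i \<in> I" for i
  proof -
    let ?s = "\<Sum>n\<in>{1..T}. \<bar>K i n\<bar>"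
    have s0: "?s \<ge> 0" by (intro sum_nonneg) auto
    have "(\<Sum>n\<in>{-T..T}. \<bar>\<rho> i i n\<bar>) \<le> (\<Sum>n\<in>{-T..T}. \<Sum>m\<in>{1..T}. \<bar>K i m\<bar> * \<bar>K i (m - n)\<bar>)"
      unfolding \<rho>_def by (intro sum_mono order_trans[OF sum_abs]) (simp add: abs_mult)
    also have "\<dots> = (\<Sum>m\<in>{1..T}. \<bar>K i m\<bar> * (\<Sum>n\<in>{-T..T}. \<bar>K i (m - n)\<bar>))"
      by (subst sum.swap) (simp add: sum_distrib_left)
    also have "\<dots> \<le> (\<Sum>m\<in>{1..T}. \<bar>K i m\<bar> * ?s)"
    proof (intro sum_mono mult_left_mono)
      fix m
      have "(\<Sum>n\<in>{-T..T}. \<bar>K i (m - n)\<bar>) = (\<Sum>k\<in>(\<lambda>n. m - n) ` {-T..T}. \<bar>K i k\<bar>)"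
        by (subst sum.reindex) (auto simp: inj_on_def)
      also have "\<dots> = (\<Sum>k\<in>(\<lambda>n. m - n) ` {-T..T} \<inter> {1..T}. \<bar>K i k\<bar>)"
        by (rule sum.mono_neutral_right) (use K[OF i] in auto)
      also have "\<dots> \<le> ?s" by (intro sum_mono2) auto
      finally show "(\<Sum>n\<in>{-T..T}. \<bar>K i (m - n)\<bar>) \<le> ?s" .
    qed auto
    also have "\<dots> = ?s\<^sup>2" by (simp add: power2_eq_square flip: sum_distrib_right)
    also have "\<dots> \<le> (e i)\<^sup>2" by (intro power_mono diag i s0)
    finally show ?thesis .
  qed
  have "(\<Sum>y\<in>Y. (g y)\<^sup>2) = (\<Sum>y\<in>Y. \<Sum>i\<in>I. \<Sum>j\<in>I. \<Sum>x\<in>X. \<Sum>x'\<in>X. \<beta> i * \<beta> j * (h i x * h j x' * (K i (x - y) * K j (x' - y))))"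
  proof (rule sum.cong[OF refl])
    fix y
    let ?s = "\<lambda>i. \<Sum>x\<in>X. h i x * K i (x - y)"
    have "(g y)\<^sup>2 = (\<Sum>i\<in>I. \<Sum>j\<in>I. (\<beta> i * ?s i) * (\<beta> j * ?s j))"
      unfolding g_def power2_eq_square by (rule sum_product)
    also have "\<dots> = (\<Sum>i\<in>I. \<Sum>j\<in>I. \<beta> i * \<beta> j * (?s i * ?s j))" by (simp only: mult_ac)
    also have "\<dots> = (\<Sum>i\<in>I. \<Sum>j\<in>I. \<beta> i * \<beta> j * (\<Sum>x\<in>X. \<Sum>x'\<in>X. (h i x * K i (x - y)) * (h j x' * K j (x' - y))))"
      by (simp only: sum_product)
    also have "\<dots> = (\<Sum>i\<in>I. \<Sum>j\<in>I. \<Sum>x\<in>X. \<Sum>x'\<in>X. \<beta> i * \<beta> j * ((h i x * K i (x - y)) * (h j x' * K j (x' - y))))"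
      by (simp only: sum_distrib_left)
    also have "\<dots> = (\<Sum>i\<in>I. \<Sum>j\<in>I. \<Sum>x\<in>X. \<Sum>x'\<in>X. \<beta> i * \<beta> j * (h i x * h j x' * (K i (x - y) * K j (x' - y))))"
      by (simp only: mult.assoc mult.left_commute[of "K _ _"])
    finally show "(g y)\<^sup>2 = \<dots>" .
  qed
  also have "\<dots> = (\<Sum>i\<in>I. \<Sum>y\<in>Y. \<Sum>j\<in>I. \<Sum>x\<in>X. \<Sum>x'\<in>X. \<beta> i * \<beta> j * (h i x * h j x' * (K i (x - y) * K j (x' - y))))"
    by (rule sum.swap)
  also have "\<dots> = (\<Sum>i\<in>I. \<Sum>j\<in>I. \<Sum>y\<in>Y. \<Sum>x\<in>X. \<Sum>x'\<in>X. \<beta> i * \<beta> j * (h i x * h j x' * (K i (x - y) * K j (x' - y))))"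
    by (intro sum.cong refl sum.swap)
  also have "\<dots> = (\<Sum>i\<in>I. \<Sum>j\<in>I. \<Sum>x\<in>X. \<Sum>y\<in>Y. \<Sum>x'\<in>X. \<beta> i * \<beta> j * (h i x * h j x' * (K i (x - y) * K j (x' - y))))"
    by (intro sum.cong refl sum.swap)
  also have "\<dots> = (\<Sum>i\<in>I. \<Sum>j\<in>I. \<Sum>x\<in>X. \<Sum>x'\<in>X. \<Sum>y\<in>Y. \<beta> i * \<beta> j * (h i x * h j x' * (K i (x - y) * K j (x' - y))))"
    by (intro sum.cong refl sum.swap)
  also have "\<dots> = (\<Sum>i\<in>I. \<Sum>j\<in>I. \<beta> i * \<beta> j * (\<Sum>x\<in>X. \<Sum>x'\<in>X. h i x * h j x' * \<rho> i j (x - x')))"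
  proof (intro sum.cong refl)
    fix i j assume ij: "i \<in> I" "j \<in> I"
    show "(\<Sum>x\<in>X. \<Sum>x'\<in>X. \<Sum>y\<in>Y. \<beta> i * \<beta> j * (h i x * h j x' * (K i (x - y) * K j (x' - y))))
       = \<beta> i * \<beta> j * (\<Sum>x\<in>X. \<Sum>x'\<in>X. h i x * h j x' * \<rho> i j (x - x'))"
      unfolding sum_distrib_left
    proof (intro sum.cong refl)
      fix x x' assume x: "x \<in> X" "x' \<in> X"
      show "(\<Sum>y\<in>Y. \<beta> i * \<beta> j * (h i x * h j x' * (K i (x - y) * K j (x' - y)))) = \<beta> i * \<beta> j * (h i x * h j x' * \<rho> i j (x - x'))"
        unfolding rho_Y[OF ij x(1), symmetric] sum_distrib_left ..
    qed
  qed
  also have "\<dots> \<le> (\<Sum>i\<in>I. \<Sum>j\<in>I. \<beta> i * \<beta> j * (\<Sum>n\<in>{-T..T}. \<bar>\<rho> i j n\<bar>))"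
    using beta by (intro sum_mono mult_left_mono form) auto
  also have "\<dots> \<le> (\<Sum>i\<in>I. \<Sum>j\<in>I. (if j = i then (\<beta> i)\<^sup>2 * (e i)\<^sup>2 else 0) + \<epsilon> * (\<beta> i * \<beta> j))"
  proof (intro sum_mono)
    fix i j assume ij: "i \<in> I" "j \<in> I"
    have bb: "0 \<le> \<beta> i * \<beta> j" using beta ij by simp
    show "\<beta> i * \<beta> j * (\<Sum>n\<in>{-T..T}. \<bar>\<rho> i j n\<bar>) \<le> (if j = i then (\<beta> i)\<^sup>2 * (e i)\<^sup>2 else 0) + \<epsilon> * (\<beta> i * \<beta> j)"
    proof (cases "j = i")
      case True
      have "\<beta> i * \<beta> i * (\<Sum>n\<in>{-T..T}. \<bar>\<rho> i i n\<bar>) \<le> \<beta> i * \<beta> i * (e i)\<^sup>2"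
        using ij by (intro mult_left_mono diag') auto
      thus ?thesis using True mult_nonneg_nonneg[OF eps bb] by (simp add: power2_eq_square)
    next
      case False
      have "\<beta> i * \<beta> j * (\<Sum>n\<in>{-T..T}. \<bar>\<rho> i j n\<bar>) \<le> \<beta> i * \<beta> j * \<epsilon>"
        unfolding \<rho>_def using ij False by (intro mult_left_mono off bb) auto
      thus ?thesis using False by (simp add: mult_ac)
    qed
  qed
  also have "\<dots> = (\<Sum>i\<in>I. (\<beta> i)\<^sup>2 * (e i)\<^sup>2) + \<epsilon> * (\<Sum>i\<in>I. \<beta> i)\<^sup>2"
    using I by (simp add: sum.distrib power2_eq_square sum_product flip: sum_distrib_left)
  finally have "L2_set g Y \<le> sqrt ((\<Sum>i\<in>I. (\<beta> i)\<^sup>2 * (e i)\<^sup>2) + \<epsilon> * (\<Sum>i\<in>I. \<beta> i)\<^sup>2)"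
    by (simp add: L2_set_def)
  hence "(\<Sum>i\<in>I. \<beta> i * V i) \<le> B * sqrt ((\<Sum>i\<in>I. (\<beta> i)\<^sup>2 * (e i)\<^sup>2) + \<epsilon> * (\<Sum>i\<in>I. \<beta> i)\<^sup>2)"
    using main l2_bounded_nonneg[OF f] by (meson mult_left_mono order_trans)
  thus ?thesis using l2U by blast
qed

section \<open>Summation over large moduli\<close>

abbreviation totient_prod :: "nat set \<Rightarrow> real" where
  "totient_prod A \<equiv> (\<Prod>p\<in>A. real p - 1)"

text \<open>
The value \<open>4 ^ \<omega>(q) / \<phi>(q)\<close>, which will bound the coefficient of \<open>c\<^sub>q\<close> in the sieve majorant.
\<close>
definition prime_weight :: "nat set \<Rightarrow> real" where
  "prime_weight C = 4 ^ card C / totient_prod C"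

lemma prime_set_dvd_prod_iff:
  assumes "prime_set C" "prime p"
  shows "p dvd \<Prod>C \<longleftrightarrow> p \<in> C"
proof
  assume "p dvd \<Prod>C"
  then obtain r where "r \<in> C" "p dvd r"
    using assms prime_dvd_prod_iff[of C p id] by (auto simp: prime_set_def)
  thus "p \<in> C" using assms primes_dvd_imp_eq[of p r] by (auto simp: prime_set_def)
next
  assume "p \<in> C"
  thus "p dvd \<Prod>C" using assms by (intro dvd_prodI) (auto simp: prime_set_def)
qed

lemma prime_set_prod_inject:
  assumes "prime_set C" "prime_set D" "\<Prod>C = \<Prod>D"
  shows "C = D"
proof -
  have "p \<in> C \<longleftrightarrow> p \<in> D" for p
    using prime_set_dvd_prod_iff[OF assms(1), of p] prime_set_dvd_prod_iff[OF assms(2), of p] assms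
    by (auto simp: prime_set_def)
  thus ?thesis by blast
qed

lemma prime_set_minus_one_ge: "prime_set C \<Longrightarrow> p \<in> C \<Longrightarrow> 1 \<le> real p - 1"
proof -
  assume "prime_set C" "p \<in> C"
  hence "2 \<le> p" by (auto simp: prime_set_def prime_ge_2_nat)
  hence "real 2 \<le> real p" by (subst of_nat_le_iff)
  thus "1 \<le> real p - 1" by simp
qed

lemma prime_set_totient_ge: "prime_set C \<Longrightarrow> 1 \<le> totient_prod C"
  using prime_set_minus_one_ge by (intro prod_ge_1) auto

lemma prime_set_card_le: 
  assumes "prime_set C"
  shows "2 ^ card C \<le> \<Prod>C"
proof -
  have "(\<Prod>p\<in>C. 2) \<le> (\<Prod>p\<in>C. p)"
    using assms by (intro prod_mono) (auto simp: prime_set_def prime_ge_2_nat)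
  thus ?thesis by simp
qed

lemma prime_weight_nonneg: "prime_set C \<Longrightarrow> 0 \<le> prime_weight C"
  using prime_set_totient_ge[of C] by (simp add: prime_weight_def)

lemma prime_weight_le: 
  assumes C: "prime_set C"
  shows "prime_weight C \<le> real (\<Prod>C) ^ 2"
proof -
  have "prime_weight C \<le> 4 ^ card C / 1"
    unfolding prime_weight_def using prime_set_totient_ge[OF C] by (intro divide_left_mono) auto
  also have "4 ^ card C = (real (2 ^ card C))\<^sup>2" by (simp add: power2_eq_square flip: power_mult_distrib)
  also have "\<dots> \<le> real (\<Prod>C) ^ 2" using prime_set_card_le[OF C] by (intro power_mono) (simp_all only: of_nat_le_iff of_nat_0_le_iff)
  finally show ?thesis by simp
qed

lemma prime_sets_card_le:
  assumes "finite \<C>" "\<And>C. C \<in> \<C> \<Longrightarrow> prime_set C" "\<And>C. C \<in> \<C> \<Longrightarrow> \<Prod>C < Z"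
  shows "card \<C> \<le> Z"
proof -
  have "card \<C> \<le> card {..<Z}"
  proof (rule card_inj_on_le[of "\<lambda>C. \<Prod>C"])
    show "inj_on (\<lambda>C. \<Prod>C) \<C>" using assms(2) prime_set_prod_inject by (intro inj_onI) blast
  qed (use assms(3) in auto)
  thus ?thesis by simp
qed

lemma summable_three_halves: "summable (\<lambda>n. real n powr (-(3/2)))"
  using summable_real_powr_iff[of "-(3/2)"] by simp

text \<open>
Rankin's trick: the factor \<open>(q / Y) powr (1/2)\<close> is at least one and turns the sum over \<open>q\<close> into
an Euler product with factors \<open>1 + O(p powr (-3/2))\<close>, which converges.
\<close>
lemma weighted_square_sum_le:
  "\<exists>K>0. \<forall>\<C> Y. finite \<C> \<longrightarrow> Y > 0 \<longrightarrow> (\<forall>C\<in>\<C>. prime_set C \<and> Y \<le> real (\<Prod>C)) \<longrightarrow>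
     (\<Sum>C\<in>\<C>. 256 ^ card C / (totient_prod C)\<^sup>2) \<le> K * Y powr (-(1/2))"
proof (intro exI conjI allI impI)
  define Z where "Z = suminf (\<lambda>n. real n powr (-(3/2)))"
  show "exp (1024 * Z) > 0" by simp
  fix \<C> :: "nat set set" and Y :: real
  assume fin: "finite \<C>" and Y: "Y > 0" and C: "\<forall>C\<in>\<C>. prime_set C \<and> Y \<le> real (\<Prod>C)"
  define P where "P = \<Union>\<C>"
  have P: "prime_set P" using fin C by (auto simp: P_def prime_set_def)
  have "(\<Sum>C\<in>\<C>. \<Prod>p\<in>C. 1024 * real p powr (-(3/2))) \<le> (\<Sum>C\<in>Pow P. \<Prod>p\<in>C. 1024 * real p powr (-(3/2)))"
    using prime_set_finite[OF P] by (intro sum_mono2) (auto simp: P_def intro!: prod_nonneg)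
  also have "\<dots> = (\<Prod>p\<in>P. 1024 * real p powr (-(3/2)) + 1)"
    using prod_add[OF prime_set_finite[OF P], of "\<lambda>p. 1024 * real p powr (-(3/2))" "\<lambda>_. 1"] by simp
  also have "\<dots> \<le> (\<Prod>p\<in>P. exp (1024 * real p powr (-(3/2))))"
    by (intro prod_mono) (auto intro: add_nonneg_nonneg simp: add.commute)
  also have "\<dots> = exp (1024 * (\<Sum>p\<in>P. real p powr (-(3/2))))"
    using prime_set_finite[OF P] by (simp add: exp_sum sum_distrib_left)
  also have "\<dots> \<le> exp (1024 * Z)"
    unfolding Z_def using summable_three_halves prime_set_finite[OF P] by (auto intro!: sum_le_suminf)
  finally have inner: "(\<Sum>C\<in>\<C>. \<Prod>p\<in>C. 1024 * real p powr (-(3/2))) \<le> exp (1024 * Z)" .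
  have "(\<Sum>C\<in>\<C>. 256 ^ card C / (totient_prod C)\<^sup>2) \<le> (\<Sum>C\<in>\<C>. Y powr (-(1/2)) * (\<Prod>p\<in>C. 1024 * real p powr (-(3/2))))"
  proof (rule sum_mono)
    fix C assume "C \<in> \<C>"
    hence pC: "prime_set C" and YC: "Y \<le> real (\<Prod>C)" using C by auto
    have pp: "real p \<ge> 2" if "p \<in> C" for p using prime_set_minus_one_ge[OF pC that] by simp
    have term_le: "256 / (real p - 1)\<^sup>2 \<le> 1024 * real p powr (-(3/2)) * real p powr (-(1/2))" if "p \<in> C" for p
    proof -
      have "real p powr (-(3/2)) * real p powr (-(1/2)) = real p powr (-2)" by (simp flip: powr_add)
      also have "\<dots> = 1 / (real p)\<^sup>2" using pp[OF that] by (simp add: powr_minus powr_numeral divide_simps)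
      finally have e: "1024 * real p powr (-(3/2)) * real p powr (-(1/2)) = 1024 / (real p)\<^sup>2" by simp
      have "real p \<le> 2 * (real p - 1)" using pp[OF that] by simp
      hence "(real p)\<^sup>2 \<le> (2 * (real p - 1))\<^sup>2" by (intro power_mono) auto
      hence "256 * (real p)\<^sup>2 \<le> 1024 * (real p - 1)\<^sup>2" unfolding power_mult_distrib by simp
      thus ?thesis unfolding e using pp[OF that] by (simp add: divide_simps)
    qed
    have "256 ^ card C / (totient_prod C)\<^sup>2 = (\<Prod>p\<in>C. 256 / (real p - 1)\<^sup>2)"
      by (simp add: prod_dividef prod_power_distrib)
    also have "\<dots> \<le> (\<Prod>p\<in>C. 1024 * real p powr (-(3/2)) * real p powr (-(1/2)))"
      using term_le by (intro prod_mono) auto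
    also have "\<dots> = (\<Prod>p\<in>C. 1024 * real p powr (-(3/2))) * (\<Prod>p\<in>C. real p powr (-(1/2)))"
      by (rule prod.distrib)
    also have "(\<Prod>p\<in>C. real p powr (-(1/2))) = real (\<Prod>C) powr (-(1/2))"
      by (subst prod_powr_distrib[symmetric]) auto
    also have "(\<Prod>p\<in>C. 1024 * real p powr (-(3/2))) * \<dots> \<le> (\<Prod>p\<in>C. 1024 * real p powr (-(3/2))) * Y powr (-(1/2))"
      using YC Y by (intro mult_left_mono powr_mono2' prod_nonneg) auto
    finally have "256 ^ card C / (totient_prod C)\<^sup>2 \<le> (\<Prod>p\<in>C. 1024 * real p powr (-(3/2))) * Y powr (-(1/2))"
      .
    thus "256 ^ card C / (totient_prod C)\<^sup>2 \<le> Y powr (-(1/2)) * (\<Prod>p\<in>C. 1024 * real p powr (-(3/2)))"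
      by (simp only: mult.commute)
  qed
  also have "\<dots> = Y powr (-(1/2)) * (\<Sum>C\<in>\<C>. \<Prod>p\<in>C. 1024 * real p powr (-(3/2)))" by (simp add: sum_distrib_left)
  also have "\<dots> \<le> Y powr (-(1/2)) * exp (1024 * Z)" by (intro mult_left_mono inner) simp
  finally have "(\<Sum>C\<in>\<C>. 256 ^ card C / (totient_prod C)\<^sup>2) \<le> Y powr (-(1/2)) * exp (1024 * Z)" .
  thus "(\<Sum>C\<in>\<C>. 256 ^ card C / (totient_prod C)\<^sup>2) \<le> exp (1024 * Z) * Y powr (-(1/2))"
    by (simp add: mult.commute)
qed

lemma ramanujan_cross_correlation_le:
  assumes C: "prime_set C" and D: "prime_set D" and ne: "C \<noteq> D"
  shows "\<bar>\<Sum>m\<in>{a..b}. ramanujan_sum C m * ramanujan_sum D (m - n)\<bar> \<le> (real (\<Prod>C) * real (\<Prod>D))\<^sup>2"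
proof -
  have "\<bar>\<Sum>m\<in>{a..b}. ramanujan_sum C m * ramanujan_sum D (m - n)\<bar> \<le> real (\<Prod>C * \<Prod>D) * (real (\<Prod>C) * real (\<Prod>D))"
  proof (rule periodic_sum_abs_le)
    show "periodic (\<lambda>m. ramanujan_sum C m * ramanujan_sum D (m - n)) (\<Prod>C * \<Prod>D)"
      by (intro periodic_ramanujan_product C D) (auto simp: prime_set_prod_pos[OF C] prime_set_prod_pos[OF D])
    show "(\<Sum>m\<in>{0..<int (\<Prod>C * \<Prod>D)}. ramanujan_sum C m * ramanujan_sum D (m - n)) = 0"
      by (rule ramanujan_sum_orthogonal[OF C D ne])
    fix m
    show "\<bar>ramanujan_sum C m * ramanujan_sum D (m - n)\<bar> \<le> real (\<Prod>C) * real (\<Prod>D)"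
      unfolding abs_mult by (intro mult_mono ramanujan_sum_abs_le C D of_nat_0_le_iff abs_ge_zero)
  qed
  thus ?thesis by (simp only: power2_eq_square of_nat_mult)
qed

text \<open>
The moduli lie in one dyadic block \<open>Y \<le> q < 2 Y\<close> with \<open>Y = 2 ^ j\<close>, and the scales are at least \<open>Y ^ 24\<close>.
Each modulus uses the projection of length \<open>M = Y ^ 15 * q\<close>, so that all lengths are comparable
to \<open>Y ^ 16\<close>. They are far longer than \<open>q * q'\<close>, which makes the projections of different moduli nearly
orthogonal: a cross correlation is \<open>O(Y ^ (-12))\<close>, negligible against the sum of all weights,
\<open>O(Y ^ 4)\<close>. They are also far shorter than the scales, so that the reproducing errors, summed over
scales and moduli, are \<open>O(Y ^ (-3))\<close>. What remains is the diagonal, the square root of the sum of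
the squares of \<open>O(8 ^ \<omega>(q) / \<phi>(q)) * 2 ^ \<omega>(q)\<close>, which is \<open>O(Y powr (-1/4))\<close>. Summing the
individual maximal inequalities without orthogonality would not give any decay in \<open>Y\<close>.
\<close>
lemma ramanujan_block_maximal:
  "\<exists>K>0. \<forall>\<C> j A f B. finite \<C> \<longrightarrow> (\<forall>C\<in>\<C>. prime_set C \<and> 2 ^ j \<le> \<Prod>C \<and> \<Prod>C < 2 * 2 ^ j) \<longrightarrow>
     finite A \<longrightarrow> A \<subseteq> (\<lambda>k. 2 ^ k) ` {24 * j..} \<longrightarrow> l2_bounded f B \<longrightarrow> finite {x. f x \<noteq> 0} \<longrightarrow>
     l2_bounded (\<lambda>x. \<Sum>C\<in>\<C>. prime_weight C * ramanujan_max A C f x)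
       (K * (2 ^ j) powr (-(1/4)) * B)"
proof -
  from weighted_square_sum_le obtain K1 where K1: "K1 > 0" and K1_sum: "\<forall>\<C> Y. finite \<C> \<longrightarrow> Y > 0 \<longrightarrow> (\<forall>C\<in>\<C>. prime_set C \<and> Y \<le> real (\<Prod>C)) \<longrightarrow>
     (\<Sum>C\<in>\<C>. 256 ^ card C / (totient_prod C)\<^sup>2) \<le> K1 * Y powr (-(1/2))"
    by (elim exE conjE)
  have sq: "(\<Sum>C\<in>\<C>. 256 ^ card C / (totient_prod C)\<^sup>2) \<le> K1 * Y powr (-(1/2))"
    if "finite \<C>" "Y > 0" "\<And>C. C \<in> \<C> \<Longrightarrow> prime_set C \<and> Y \<le> real (\<Prod>C)" for \<C> Y
    by (rule K1_sum[rule_format]) (use that in blast)+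
  define K where "K = sqrt (4 * K1 + 81920) + 256"
  have "0 \<le> sqrt (4 * K1 + 81920)" using K1 by (intro real_sqrt_ge_zero) simp
  hence K0: "K > 0" unfolding K_def by linarith
  have bound: "l2_bounded (\<lambda>x. \<Sum>C\<in>\<C>. prime_weight C * ramanujan_max A C f x)
       (K * (2 ^ j) powr (-(1/4)) * B)"
    if fin: "finite \<C>" and C: "\<And>C. C \<in> \<C> \<Longrightarrow> prime_set C \<and> 2 ^ j \<le> \<Prod>C \<and> \<Prod>C < 2 * 2 ^ j"
      and A: "finite A" "A \<subseteq> (\<lambda>k. 2 ^ k) ` {24 * j..}" and f: "l2_bounded f B" and suppf: "finite {x. f x \<noteq> 0}"
    for \<C> j A f B
  proof -
    define Y :: nat where "Y = 2 ^ j"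
    define y where "y = real Y"
    \<comment> \<open>The length of the projection: a multiple of q, comparable to the 16th power of Y.\<close>
    define M where "M C = Y ^ 15 * \<Prod>C" for C
    define T where "T = 2 * Y ^ 16"
    define Kr where "Kr C n = (if n \<in> {1..int (M C)} then ramanujan_sum C n / real (M C) else 0)" for C n
    \<comment> \<open>The weight of q, multiplied by the norm of its maximal operator.\<close>
    define \<beta> where "\<beta> C = prime_weight C * 2 ^ card C * 2" for C
    define \<epsilon> where "\<epsilon> = 80 / y ^ 12"
    have Y1: "Y \<ge> 1" by (simp add: Y_def)
    have y1: "y \<ge> 1" using Y1 by (simp add: y_def)
    have B0: "B \<ge> 0" by (rule l2_bounded_nonneg[OF f])
    have pC: "prime_set C" if "C \<in> \<C>" for C using C[OF that] by simp
    have qC: "Y \<le> \<Prod>C" "\<Prod>C < 2 * Y" if "C \<in> \<C>" for C using C[OF that] by (auto simp: Y_def)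
    have qr: "real (\<Prod>C) \<le> 2 * y" if "C \<in> \<C>" for C using qC(2)[OF that] by (simp add: y_def del: of_nat_prod)
    have Y16: "Y ^ 16 = Y ^ 15 * Y" using power_Suc2[of Y 15] by simp
    have MT: "M C \<le> T" if "C \<in> \<C>" for C
    proof -
      have "M C \<le> Y ^ 15 * (2 * Y)" unfolding M_def using qC[OF that] by (intro mult_left_mono) auto
      thus ?thesis by (simp add: T_def Y16)
    qed
    have MY: "Y ^ 16 \<le> M C" if "C \<in> \<C>" for C
    proof -
      have "Y ^ 15 * Y \<le> M C" unfolding M_def using qC[OF that] by (intro mult_left_mono) auto
      thus ?thesis by (simp add: Y16)
    qed
    have MYr: "y ^ 16 \<le> real (M C)" if "C \<in> \<C>" for C

    proof -
      have "real (Y ^ 16) \<le> real (M C)" using MY[OF that] by (simp only: of_nat_le_iff)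
      thus ?thesis by (simp add: y_def)
    qed
    have M0: "M C > 0" if "C \<in> \<C>" for C 
    proof -
      have "0 < Y ^ 16" using Y1 by simp
      thus ?thesis using MY[OF that] by (rule less_le_trans)
    qed
    have U: "(\<Sum>n\<in>{1..int T}. Kr C n * f (x - n)) = weighted_avg (M C) (ramanujan_sum C) f x" if "C \<in> \<C>" for C x
    proof -
      have "(\<Sum>n\<in>{1..int T}. Kr C n * f (x - n)) = (\<Sum>n\<in>{1..int (M C)}. Kr C n * f (x - n))"
        using MT[OF that] by (intro sum.mono_neutral_right) (auto simp: Kr_def)
      also have "\<dots> = (\<Sum>n\<in>{1..int (M C)}. ramanujan_sum C n * f (x - n)) / real (M C)"
        unfolding sum_divide_distrib by (intro sum.cong) (auto simp: Kr_def)
      finally show ?thesis by (simp add: weighted_avg_def)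
    qed
    have diag: "(\<Sum>n\<in>{1..int T}. \<bar>Kr C n\<bar>) \<le> 2 ^ card C" if "C \<in> \<C>" for C
    proof -
      have "(\<Sum>n\<in>{1..int T}. \<bar>Kr C n\<bar>) = (\<Sum>n\<in>{1..int (M C)}. \<bar>Kr C n\<bar>)"
        using MT[OF that] by (intro sum.mono_neutral_right) (auto simp: Kr_def)
      also have "\<dots> = (\<Sum>n\<in>{1..int (M C)}. \<bar>ramanujan_sum C n\<bar>) / real (M C)"
        unfolding sum_divide_distrib by (intro sum.cong) (auto simp: Kr_def)
      also have "\<dots> \<le> 2 ^ card C" using ramanujan_sum_l1[OF pC[OF that], of "M C"] M0[OF that] by (simp add: divide_le_eq)
      finally show ?thesis .
    qed
    have off: "(\<Sum>n\<in>{-int T..int T}. \<bar>\<Sum>m\<in>{1..int T}. Kr C m * Kr D (m - n)\<bar>) \<le> \<epsilon>"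
      if CD: "C \<in> \<C>" "D \<in> \<C>" "C \<noteq> D" for C D
    proof -
      have each: "\<bar>\<Sum>m\<in>{1..int T}. Kr C m * Kr D (m - n)\<bar> \<le> 16 / y ^ 28" for n
      proof -
        \<comment> \<open>The overlap of the two windows is an interval, possibly empty.\<close>
        let ?S = "{max 1 (1 + n)..min (int (M C)) (int (M D) + n)}"
        have "(\<Sum>m\<in>{1..int T}. Kr C m * Kr D (m - n)) = (\<Sum>m\<in>?S. Kr C m * Kr D (m - n))"
          using MT[OF CD(1)] by (intro sum.mono_neutral_right) (auto simp: Kr_def)
        also have "\<dots> = (\<Sum>m\<in>?S. ramanujan_sum C m * ramanujan_sum D (m - n)) / (real (M C) * real (M D))"
          unfolding sum_divide_distrib by (intro sum.cong) (auto simp: Kr_def)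
        also have "\<bar>\<dots>\<bar> \<le> (real (\<Prod>C) * real (\<Prod>D))\<^sup>2 / (real (M C) * real (M D))"
          unfolding abs_divide using ramanujan_cross_correlation_le[OF pC[OF CD(1)] pC[OF CD(2)] CD(3)]
          by (intro frac_le) (simp_all add: M0 CD del: of_nat_prod)
        also have "\<dots> \<le> ((2 * y) * (2 * y))\<^sup>2 / (y ^ 16 * y ^ 16)"
          using y1 by (intro frac_le power_mono mult_mono qr MYr CD) (auto simp del: of_nat_prod intro!: mult_nonneg_nonneg of_nat_0_le_iff)
        also have "\<dots> = 16 / y ^ 28" using y1 by (simp add: power_mult_distrib field_simps flip: power_add)
        finally show ?thesis .
      qed
      have "(\<Sum>n\<in>{-int T..int T}. \<bar>\<Sum>m\<in>{1..int T}. Kr C m * Kr D (m - n)\<bar>) \<le> (\<Sum>n\<in>{-int T..int T}. 16 / y ^ 28)"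
        by (intro sum_mono each)
      also have "\<dots> = (4 * y ^ 16 + 1) * (16 / y ^ 28)" by (simp add: T_def y_def)
      also have "\<dots> \<le> (5 * y ^ 16) * (16 / y ^ 28)" using y1 by (intro mult_right_mono) auto
      also have "\<dots> = \<epsilon>" unfolding \<epsilon>_def using y1 by (simp add: field_simps flip: power_add)
      finally show ?thesis .
    qed
    have beta0: "\<beta> C \<ge> 0" if "C \<in> \<C>" for C using prime_weight_nonneg[OF pC[OF that]] by (simp add: \<beta>_def)
    have wC: "prime_weight C \<le> 4 * y ^ 2" if "C \<in> \<C>" for C
    proof -
      have "prime_weight C \<le> real (\<Prod>C) ^ 2" by (rule prime_weight_le[OF pC[OF that]])
      also have "\<dots> \<le> (2 * y) ^ 2" by (intro power_mono qr that of_nat_0_le_iff)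
      finally show ?thesis by (simp add: power_mult_distrib)
    qed
    have card_C: "real (card \<C>) \<le> 2 * y"
    proof -
      have "card \<C> \<le> 2 * Y" by (rule prime_sets_card_le[OF fin]) (use pC qC in auto)
      thus ?thesis by (simp add: y_def)
    qed
    have eps0: "\<epsilon> \<ge> 0" using y1 by (simp add: \<epsilon>_def)
    obtain b where b: "\<And>C. C \<in> \<C> \<Longrightarrow> l2_bounded (weighted_avg (M C) (ramanujan_sum C) f) (b C)"
      and bsum: "(\<Sum>C\<in>\<C>. \<beta> C * b C) \<le> B * sqrt ((\<Sum>C\<in>\<C>. (\<beta> C)\<^sup>2 * (2 ^ card C)\<^sup>2) + \<epsilon> * (\<Sum>C\<in>\<C>. \<beta> C)\<^sup>2)"
    proof -
      have "\<exists>b. (\<forall>C\<in>\<C>. l2_bounded (\<lambda>x. \<Sum>n\<in>{1..int T}. Kr C n * f (x - n)) (b C)) \<and>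
        (\<Sum>C\<in>\<C>. \<beta> C * b C) \<le> B * sqrt ((\<Sum>C\<in>\<C>. (\<beta> C)\<^sup>2 * (2 ^ card C)\<^sup>2) + \<epsilon> * (\<Sum>C\<in>\<C>. \<beta> C)\<^sup>2)"
      proof (rule almost_orthogonal_bessel[OF f suppf fin])
        fix C n assume "C \<in> \<C>" "n \<notin> {1..int T}"
        thus "Kr C n = 0" using MT[of C] by (auto simp: Kr_def)
      qed (use beta0 diag off eps0 in auto)
      then obtain b where "\<forall>C\<in>\<C>. l2_bounded (\<lambda>x. \<Sum>n\<in>{1..int T}. Kr C n * f (x - n)) (b C)"
        "(\<Sum>C\<in>\<C>. \<beta> C * b C) \<le> B * sqrt ((\<Sum>C\<in>\<C>. (\<beta> C)\<^sup>2 * (2 ^ card C)\<^sup>2) + \<epsilon> * (\<Sum>C\<in>\<C>. \<beta> C)\<^sup>2)" by blast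
      moreover have "(\<lambda>x. \<Sum>n\<in>{1..int T}. Kr C n * f (x - n)) = weighted_avg (M C) (ramanujan_sum C) f" if "C \<in> \<C>" for C
        by (rule ext) (rule U[OF that])
      ultimately show ?thesis by (intro that[of b]) auto
    qed
    have main: "(\<Sum>C\<in>\<C>. \<beta> C * b C) \<le> sqrt (4 * K1 + 81920) * y powr (-(1/4)) * B"
    proof -
      have "(\<Sum>C\<in>\<C>. (\<beta> C)\<^sup>2 * (2 ^ card C)\<^sup>2) = (\<Sum>C\<in>\<C>. 4 * (256 ^ card C / (totient_prod C)\<^sup>2))"
      proof (intro sum.cong refl)
        fix C :: "nat set"
        have p4: "(4::real) ^ card C = 2 ^ card C * 2 ^ card C" by (simp flip: power_mult_distrib)
        have "(256::real) ^ card C = (2 ^ 8) ^ card C" by simp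
        also have "\<dots> = (2 ^ card C) ^ 8" by (simp only: power_mult[symmetric] mult.commute)
        finally have p256: "(256::real) ^ card C = (2 ^ card C) ^ 8" .
        have "(u * u / v * u * 2)\<^sup>2 * u\<^sup>2 = 4 * (u ^ 8 / v\<^sup>2)" for u v :: real
          by (simp add: eval_nat_numeral)
        thus "(\<beta> C)\<^sup>2 * (2 ^ card C)\<^sup>2 = 4 * (256 ^ card C / (totient_prod C)\<^sup>2)"
          unfolding \<beta>_def prime_weight_def p4 p256 by blast
      qed
      also have "\<dots> \<le> 4 * (K1 * y powr (-(1/2)))"
        unfolding sum_distrib_left[symmetric] using y1 qC pC
        by (intro mult_left_mono sq fin) (auto simp: y_def simp del: of_nat_prod)
      finally have s1: "(\<Sum>C\<in>\<C>. (\<beta> C)\<^sup>2 * (2 ^ card C)\<^sup>2) \<le> 4 * (K1 * y powr (-(1/2)))" .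
      have "(\<Sum>C\<in>\<C>. \<beta> C) \<le> (\<Sum>C\<in>\<C>. 16 * y ^ 3)"
      proof (intro sum_mono)
        fix C assume CC: "C \<in> \<C>"
        have "real (2 ^ card C) \<le> real (\<Prod>C)" using prime_set_card_le[OF pC[OF CC]] by (simp only: of_nat_le_iff)
        hence "real (2 ^ card C) \<le> 2 * y" using qr[OF CC] by (rule order_trans)
        hence "2 ^ card C \<le> 2 * y" by simp
        hence "\<beta> C \<le> (4 * y ^ 2) * (2 * y) * 2"
          unfolding \<beta>_def using y1 wC[OF CC] by (intro mult_mono) auto
        thus "\<beta> C \<le> 16 * y ^ 3" by (simp add: eval_nat_numeral)
      qed
      also have "\<dots> \<le> 2 * y * (16 * y ^ 3)" using mult_right_mono[OF card_C, of "16 * y ^ 3"] y1 by simp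
      finally have "(\<Sum>C\<in>\<C>. \<beta> C) \<le> 32 * y ^ 4" by (simp add: eval_nat_numeral)
      hence "(\<Sum>C\<in>\<C>. \<beta> C)\<^sup>2 \<le> (32 * y ^ 4)\<^sup>2" using beta0 by (intro power_mono sum_nonneg)
      hence "\<epsilon> * (\<Sum>C\<in>\<C>. \<beta> C)\<^sup>2 \<le> \<epsilon> * (32 * y ^ 4)\<^sup>2" by (intro mult_left_mono eps0)
      also have "\<dots> = 81920 / y ^ 4" unfolding \<epsilon>_def using y1 by (simp add: field_simps flip: power_add power_mult)
      also have "\<dots> = 81920 * y powr (-4)" using y1 by (simp add: powr_minus powr_numeral divide_inverse)
      also have "\<dots> \<le> 81920 * y powr (-(1/2))" using y1 by (intro mult_left_mono powr_mono) auto
      finally have s2: "\<epsilon> * (\<Sum>C\<in>\<C>. \<beta> C)\<^sup>2 \<le> 81920 * y powr (-(1/2))" .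
      have "sqrt ((\<Sum>C\<in>\<C>. (\<beta> C)\<^sup>2 * (2 ^ card C)\<^sup>2) + \<epsilon> * (\<Sum>C\<in>\<C>. \<beta> C)\<^sup>2) \<le> sqrt ((4 * K1 + 81920) * y powr (-(1/2)))"
        using s1 s2 by (intro real_sqrt_le_mono) (simp add: algebra_simps)
      also have "\<dots> = sqrt (4 * K1 + 81920) * sqrt (y powr (-(1/2)))" by (rule real_sqrt_mult)
      also have "sqrt (y powr (-(1/2))) = y powr (-(1/4))" using y1 by (simp add: powr_half_sqrt[symmetric] powr_powr)
      finally have "B * sqrt ((\<Sum>C\<in>\<C>. (\<beta> C)\<^sup>2 * (2 ^ card C)\<^sup>2) + \<epsilon> * (\<Sum>C\<in>\<C>. \<beta> C)\<^sup>2) \<le> B * (sqrt (4 * K1 + 81920) * y powr (-(1/4)))"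
        by (intro mult_left_mono B0)
      thus ?thesis using bsum by (simp add: mult_ac)
    qed
    define R where "R C N x = weighted_avg N (ramanujan_sum C) f x - weighted_avg N (ramanujan_sum C) (weighted_avg (M C) (ramanujan_sum C) f) x" for C N x
    have NA: "y ^ 24 \<le> real N" "N > 0" if "N \<in> A" for N
    proof -
      have "N \<in> (\<lambda>k. 2 ^ k) ` {24 * j..}" using that A(2) by blast
      then obtain k where k: "k \<ge> 24 * j" "N = 2 ^ k" by auto
      have "(2::real) ^ (24 * j) \<le> 2 ^ k" using k by (intro power_increasing) auto
      thus "y ^ 24 \<le> real N" using k by (simp add: y_def Y_def power_mult mult.commute flip: power_mult)
      show "N > 0" using k by simp
    qed
    have inv_sum: "(\<Sum>N\<in>A. 1 / real N) \<le> 2 / y ^ 24"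
    proof -
      obtain I where I: "I \<subseteq> {24 * j..}" "A = (\<lambda>k. 2 ^ k) ` I" using A(2) by (metis subset_imageE)
      have inj: "inj_on (\<lambda>k. 2 ^ k :: nat) I" by (auto intro: inj_onI)
      have finI: "finite I" using A(1) I(2) inj finite_imageD by blast
      have "(\<Sum>N\<in>A. 1 / real N) = (\<Sum>k\<in>I. (1/2) ^ k)"
        unfolding I(2) by (subst sum.reindex[OF inj]) (simp add: power_one_over)
      also have "\<dots> \<le> (\<Sum>k\<in>(\<lambda>i. i + 24 * j) ` {..Max (insert 0 I)}. (1/2) ^ k)"
      proof (rule sum_mono2)
        show "I \<subseteq> (\<lambda>i. i + 24 * j) ` {..Max (insert 0 I)}"
        proof
          fix k assume k: "k \<in> I"
          have "k \<le> Max (insert 0 I)" using finI k by (intro Max_ge) auto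
          thus "k \<in> (\<lambda>i. i + 24 * j) ` {..Max (insert 0 I)}" using I(1) k by (intro image_eqI[of _ _ "k - 24 * j"]) auto
        qed
      qed auto
      also have "\<dots> = (\<Sum>i\<le>Max (insert 0 I). (1/2) ^ i) * (1/2) ^ (24 * j)"
        by (subst sum.reindex) (auto simp: inj_on_def power_add sum_distrib_right)
      also have "(\<Sum>i\<le>Max (insert 0 I). (1/2) ^ i) \<le> (2::real)"
        by (subst sum_gp0) (auto simp: field_simps)
      also have "2 * (1/2) ^ (24 * j) = 2 / y ^ 24"
        by (simp add: y_def Y_def power_one_over mult.commute flip: power_mult)
      finally show ?thesis by simp
    qed
    have l2R: "l2_bounded (\<lambda>x. \<Sum>N\<in>A. \<bar>R C N x\<bar>) (32 / y ^ 6 * B)" if CC: "C \<in> \<C>" for C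
    proof -
      have "l2_bounded (\<lambda>x. \<bar>R C N x\<bar>) (16 * y ^ 18 * B * (1 / real N))" if N: "N \<in> A" for N
      proof -
        have MN: "real (M C) \<le> 2 * y ^ 16" using MT[OF CC] unfolding T_def y_def

        proof -
          assume "M C \<le> 2 * Y ^ 16"
          hence "real (M C) \<le> real (2 * Y ^ 16)" by (simp only: of_nat_le_iff)
          thus "real (M C) \<le> 2 * real Y ^ 16" by simp
        qed
        have "2 * y ^ 16 \<le> y ^ 24 \<or> Y = 1"
        proof (cases "j = 0")
          case False
          hence "y \<ge> 2 ^ 1" unfolding y_def Y_def by (simp add: self_le_power)
          hence "2 * y ^ 16 \<le> y * y ^ 16" by (intro mult_right_mono) auto
          also have "\<dots> = y ^ 17" by (simp add: eval_nat_numeral)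
          also have "\<dots> \<le> y ^ 24" using y1 by (intro power_increasing) auto
          finally show ?thesis by simp
        qed (simp add: Y_def)
        hence "M C \<le> N"
        proof
          assume "2 * y ^ 16 \<le> y ^ 24"
          hence "real (M C) \<le> real N" using MN NA(1)[OF N] by linarith
          thus ?thesis by simp
        next
          assume Y1': "Y = 1"
          hence "\<Prod>C = 1" using qC[OF CC] by simp
          thus ?thesis using NA(2)[OF N] Y1' by (simp add: M_def)
        qed
        hence "l2_bounded (R C N) (2 * real (M C) * real (\<Prod>C) ^ 2 / real N * B)"
          unfolding R_def by (intro ramanujan_reproducing[OF pC[OF CC] f M_def M0[OF CC]])
        moreover have "2 * real (M C) * real (\<Prod>C) ^ 2 / real N * B \<le> 16 * y ^ 18 * B * (1 / real N)"
        proof -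
          have "2 * real (M C) * real (\<Prod>C) ^ 2 \<le> 2 * (2 * y ^ 16) * (2 * y) ^ 2"
            using MN y1 by (intro mult_mono power_mono qr CC) (auto simp del: of_nat_prod intro: of_nat_0_le_iff)
          also have "\<dots> = 16 * y ^ 18" by (simp add: power_mult_distrib flip: power_add)
          finally have "2 * real (M C) * real (\<Prod>C) ^ 2 * (B / real N) \<le> 16 * y ^ 18 * (B / real N)"
            using B0 by (intro mult_right_mono) auto
          thus ?thesis by simp
        qed
        ultimately show ?thesis using l2_bounded_mono[of "R C N" _ "\<lambda>x. \<bar>R C N x\<bar>"] by simp
      qed
      hence "l2_bounded (\<lambda>x. \<Sum>N\<in>A. \<bar>R C N x\<bar>) (\<Sum>N\<in>A. 16 * y ^ 18 * B * (1 / real N))" by (intro l2_bounded_sum)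
      moreover have "(\<Sum>N\<in>A. 16 * y ^ 18 * B * (1 / real N)) \<le> 32 / y ^ 6 * B"
      proof -
        have "(\<Sum>N\<in>A. 16 * y ^ 18 * B * (1 / real N)) = 16 * y ^ 18 * B * (\<Sum>N\<in>A. 1 / real N)" by (simp add: sum_distrib_left)
        also have "\<dots> \<le> 16 * y ^ 18 * B * (2 / y ^ 24)" using y1 B0 by (intro mult_left_mono inv_sum) auto
        also have "\<dots> = 32 / y ^ 6 * B" using y1 by (simp add: field_simps flip: power_add)
        finally show ?thesis .
      qed
      ultimately show ?thesis using l2_bounded_mono[OF _ order_refl] by blast
    qed
    define G where "G C x = max_over A (\<lambda>N. weighted_avg N (ramanujan_sum C) (weighted_avg (M C) (ramanujan_sum C) f) x)" for C x
    have l2G: "l2_bounded (G C) (2 ^ card C * (2 * b C))" if "C \<in> \<C>" for C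
      unfolding G_def by (rule ramanujan_maximal[OF pC[OF that] b[OF that] A(1)])
    have l2: "l2_bounded (\<lambda>x. \<Sum>C\<in>\<C>. prime_weight C * (G C x + (\<Sum>N\<in>A. \<bar>R C N x\<bar>)))
       (\<Sum>C\<in>\<C>. \<bar>prime_weight C\<bar> * (2 ^ card C * (2 * b C) + 32 / y ^ 6 * B))"
      by (intro l2_bounded_sum l2_bounded_scale l2_bounded_add l2G l2R)
    have "(\<Sum>C\<in>\<C>. \<bar>prime_weight C\<bar> * (2 ^ card C * (2 * b C) + 32 / y ^ 6 * B))
        = (\<Sum>C\<in>\<C>. \<beta> C * b C) + (\<Sum>C\<in>\<C>. prime_weight C * (32 / y ^ 6 * B))"
      unfolding sum.distrib[symmetric] using prime_weight_nonneg[OF pC]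
      by (intro sum.cong refl) (simp add: \<beta>_def algebra_simps)
    also have "(\<Sum>C\<in>\<C>. prime_weight C * (32 / y ^ 6 * B)) \<le> (\<Sum>C\<in>\<C>. 4 * y ^ 2 * (32 / y ^ 6 * B))"
      using B0 y1 by (intro sum_mono mult_right_mono wC) auto
    also have "\<dots> \<le> 2 * y * (4 * y ^ 2 * (32 / y ^ 6 * B))"
      using mult_right_mono[OF card_C, of "4 * y ^ 2 * (32 / y ^ 6 * B)"] B0 y1 by simp
    also have "\<dots> = 256 * B * y powr (-3)" using y1 by (simp add: powr_minus powr_numeral field_simps eval_nat_numeral)
    also have "\<dots> \<le> 256 * B * y powr (-(1/4))" using y1 B0 by (intro mult_left_mono powr_mono) auto
    finally have "(\<Sum>C\<in>\<C>. \<bar>prime_weight C\<bar> * (2 ^ card C * (2 * b C) + 32 / y ^ 6 * B)) \<le> K * y powr (-(1/4)) * B"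
      using main by (simp add: K_def algebra_simps)
    moreover have "y = 2 ^ j" by (simp add: y_def Y_def)
    ultimately have le: "(\<Sum>C\<in>\<C>. \<bar>prime_weight C\<bar> * (2 ^ card C * (2 * b C) + 32 / y ^ 6 * B)) \<le> K * (2 ^ j) powr (-(1/4)) * B" by simp
    show ?thesis
    proof (rule l2_bounded_mono[OF l2 _ le])
      fix x
      have "prime_weight C * ramanujan_max A C f x \<le> prime_weight C * (G C x + (\<Sum>N\<in>A. \<bar>R C N x\<bar>))"
        if CC: "C \<in> \<C>" for C
      proof (rule mult_left_mono[OF max_over_le])
        show "0 \<le> G C x + (\<Sum>N\<in>A. \<bar>R C N x\<bar>)" unfolding G_def using max_over_nonneg[OF A(1)] by (intro add_nonneg_nonneg sum_nonneg) auto
        fix N assume N: "N \<in> A"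
        have "\<bar>weighted_avg N (ramanujan_sum C) (weighted_avg (M C) (ramanujan_sum C) f) x\<bar> \<le> G C x"
          unfolding G_def by (rule max_over_ge[OF A(1) N])
        moreover have "\<bar>R C N x\<bar> \<le> (\<Sum>N\<in>A. \<bar>R C N x\<bar>)" using A(1) N by (intro member_le_sum) auto
        ultimately show "\<bar>weighted_avg N (ramanujan_sum C) f x\<bar> \<le> G C x + (\<Sum>N\<in>A. \<bar>R C N x\<bar>)"
          unfolding R_def by linarith
      qed (use A prime_weight_nonneg[OF pC[OF CC]] in auto)
      hence "(\<Sum>C\<in>\<C>. prime_weight C * ramanujan_max A C f x) \<le> (\<Sum>C\<in>\<C>. prime_weight C * (G C x + (\<Sum>N\<in>A. \<bar>R C N x\<bar>)))"
        by (rule sum_mono)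
      moreover have "0 \<le> (\<Sum>C\<in>\<C>. prime_weight C * ramanujan_max A C f x)"
        using prime_weight_nonneg[OF pC] max_over_nonneg[OF A(1)] by (intro sum_nonneg mult_nonneg_nonneg) auto
      ultimately show "\<bar>\<Sum>C\<in>\<C>. prime_weight C * ramanujan_max A C f x\<bar> \<le> \<bar>\<Sum>C\<in>\<C>. prime_weight C * (G C x + (\<Sum>N\<in>A. \<bar>R C N x\<bar>))\<bar>"
        by linarith
    qed
  qed
  show ?thesis
  proof (intro exI[of _ K] conjI allI impI K0)
    fix \<C> :: "nat set set" and j :: nat and A :: "nat set" and f :: "int \<Rightarrow> real" and B :: real
    assume h: "finite \<C>" "\<forall>C\<in>\<C>. prime_set C \<and> 2 ^ j \<le> \<Prod>C \<and> \<Prod>C < 2 * 2 ^ j" "finite A"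
      "A \<subseteq> (\<lambda>k. 2 ^ k) ` {24 * j..}" "l2_bounded f B" "finite {x. f x \<noteq> 0}"
    show "l2_bounded (\<lambda>x. \<Sum>C\<in>\<C>. prime_weight C * ramanujan_max A C f x)
       (K * (2 ^ j) powr (-(1/4)) * B)"
      by (rule bound[OF h(1) bspec[OF h(2)] h(3-6)])
  qed
qed

text \<open>
A modulus \<open>q\<close> is only used at dyadic scales that exceed \<open>q ^ 24\<close>, as its block requires.
\<close>
definition scales :: "nat \<Rightarrow> nat \<Rightarrow> nat set" where
  "scales m q = (\<lambda>k. 2 ^ k) ` {k. k \<le> m \<and> q ^ 24 \<le> 2 ^ k}"

lemma scales_finite: "finite (scales m q)"
  by (simp add: scales_def)

lemma dyadic_block_exists:
  fixes m :: nat
  assumes "m > 0"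
  shows "\<exists>j. 2 ^ j \<le> m \<and> m < 2 * 2 ^ (j::nat)"
proof -
  obtain j where "2 ^ j \<le> m" "m < 2 ^ (j + 1)" using ex_power_ivl1[of 2 m] assms by auto
  thus ?thesis by auto
qed

lemma geometric_tail_le:
  fixes r :: real
  assumes "0 < r" "r < 1" "finite J" "J \<subseteq> {j0..}"
  shows "(\<Sum>j\<in>J. r ^ j) \<le> r ^ j0 / (1 - r)"
proof -
  define m where "m = Max (insert 0 J)"
  have "(\<Sum>j\<in>J. r ^ j) \<le> (\<Sum>j\<in>(\<lambda>i. i + j0) ` {..m}. r ^ j)"
  proof (rule sum_mono2)
    show "J \<subseteq> (\<lambda>i. i + j0) ` {..m}"
    proof
      fix k assume k: "k \<in> J"
      have "k \<le> m" unfolding m_def using assms k by (intro Max_ge) auto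
      thus "k \<in> (\<lambda>i. i + j0) ` {..m}" using assms(4) k by (intro image_eqI[of _ _ "k - j0"]) auto
    qed
  qed (use assms in auto)
  also have "\<dots> = r ^ j0 * (\<Sum>i\<le>m. r ^ i)"
    by (subst sum.reindex) (auto simp: inj_on_def power_add sum_distrib_left mult.commute)
  also have "(\<Sum>i\<le>m. r ^ i) = (1 - r ^ Suc m) / (1 - r)" using assms by (subst sum_gp0) auto
  also have "\<dots> \<le> 1 / (1 - r)" using assms by (intro divide_right_mono) auto
  finally show ?thesis using assms by (simp add: mult_left_mono)
qed

text \<open>
The bounds for the dyadic blocks form a geometric series that starts near \<open>z\<close>.
\<close>
lemma ramanujan_high_maximal:
  "\<exists>K>0. \<forall>\<C> z m f B. finite \<C> \<longrightarrow> z \<ge> 2 \<longrightarrow> (\<forall>C\<in>\<C>. prime_set C \<and> z < real (\<Prod>C)) \<longrightarrow>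
     l2_bounded f B \<longrightarrow> finite {x. f x \<noteq> 0} \<longrightarrow>
     l2_bounded (\<lambda>x. \<Sum>C\<in>\<C>. prime_weight C * ramanujan_max (scales m (\<Prod>C)) C f x)
       (K * z powr (-(1/4)) * B)"
proof -
  from ramanujan_block_maximal obtain K where K: "K > 0" and K_block: "\<forall>\<C> j A f B. finite \<C> \<longrightarrow> (\<forall>C\<in>\<C>. prime_set C \<and> 2 ^ j \<le> \<Prod>C \<and> \<Prod>C < 2 * 2 ^ j) \<longrightarrow>
     finite A \<longrightarrow> A \<subseteq> (\<lambda>k. 2 ^ k) ` {24 * j..} \<longrightarrow> l2_bounded f B \<longrightarrow> finite {x. f x \<noteq> 0} \<longrightarrow>
     l2_bounded (\<lambda>x. \<Sum>C\<in>\<C>. prime_weight C * ramanujan_max A C f x)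
       (K * (2 ^ j) powr (-(1/4)) * B)"
    by (elim exE conjE)
  define r :: real where "r = 2 powr (-(1/4))"
  have r: "0 < r" "r < 1" by (auto simp: r_def intro: powr_less_one)
  define K2 where "K2 = K * (2 powr (1/4) / (1 - r))"
  have K2: "K2 > 0" using K r by (simp add: K2_def)
  show ?thesis
  proof (intro exI[of _ K2] conjI allI impI K2)
    fix \<C> :: "nat set set" and z :: real and m :: nat and f :: "int \<Rightarrow> real" and B :: real
    assume fin: "finite \<C>" and z: "z \<ge> 2" and C: "\<forall>C\<in>\<C>. prime_set C \<and> z < real (\<Prod>C)"
      and f: "l2_bounded f B" and suppf: "finite {x. f x \<noteq> 0}"
    have B0: "B \<ge> 0" by (rule l2_bounded_nonneg[OF f])
    define e where "e C = (SOME j. 2 ^ j \<le> \<Prod>C \<and> \<Prod>C < 2 * 2 ^ (j::nat))" for C :: "nat set"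
    have e: "2 ^ e C \<le> \<Prod>C" "\<Prod>C < 2 * 2 ^ e C" if "C \<in> \<C>" for C
    proof -
      have "\<Prod>C > 0" using C that prime_set_prod_pos by blast
      from someI_ex[OF dyadic_block_exists[OF this]] show "2 ^ e C \<le> \<Prod>C" "\<Prod>C < 2 * 2 ^ e C" by (simp_all add: e_def)
    qed
    define J where "J = e ` \<C>"
    have finJ: "finite J" using fin by (simp add: J_def)
    let ?F = "\<lambda>C x. prime_weight C * ramanujan_max (scales m (\<Prod>C)) C f x"
    have l2j: "l2_bounded (\<lambda>x. \<Sum>C\<in>{C\<in>\<C>. e C = j}. ?F C x) (K * B * r ^ j)" for j
    proof -
      define A where "A = (\<lambda>k. 2 ^ k :: nat) ` {24 * j..m}"
      have A: "finite A" by (simp add: A_def)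
      have "l2_bounded (\<lambda>x. \<Sum>C\<in>{C\<in>\<C>. e C = j}. prime_weight C * ramanujan_max A C f x)
         (K * (2 ^ j) powr (-(1/4)) * B)"
      proof (intro K_block[rule_format] f suppf A)
        show "A \<subseteq> (\<lambda>k. 2 ^ k) ` {24 * j..}" by (auto simp: A_def)
      qed (use fin C e in auto)
      moreover have "(2 ^ j) powr (-(1/4)) = r ^ j"
      proof -
        have "(2 ^ j) powr (-(1/4)) = (2 powr real j) powr (-(1/4))" by (simp add: powr_realpow)
        also have "\<dots> = r powr real j" by (simp add: r_def powr_powr mult.commute)
        also have "\<dots> = r ^ j" using r by (simp add: powr_realpow)
        finally show ?thesis .
      qed
      ultimately have "l2_bounded (\<lambda>x. \<Sum>C\<in>{C\<in>\<C>. e C = j}. prime_weight C * ramanujan_max A C f x)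
         (K * B * r ^ j)" by (simp add: mult_ac)
      thus ?thesis
      proof (rule l2_bounded_mono)
        fix x
        have F: "?F C x \<le> prime_weight C * ramanujan_max A C f x" "0 \<le> ?F C x" if CC: "C \<in> {C\<in>\<C>. e C = j}" for C
        proof -
          have w: "0 \<le> prime_weight C" using C CC prime_weight_nonneg by blast
          show "?F C x \<le> prime_weight C * ramanujan_max A C f x"
          proof (intro mult_left_mono max_over_le scales_finite max_over_nonneg A w)
            fix N assume "N \<in> scales m (\<Prod>C)"
            then obtain k where k: "N = 2 ^ k" "k \<le> m" "(\<Prod>C) ^ 24 \<le> 2 ^ k" unfolding scales_def by blast
            have "(2 ^ j) ^ 24 \<le> (\<Prod>C) ^ 24" using e(1)[of C] CC by (intro power_mono) auto
            also note k(3)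
            finally have "(2::nat) ^ (24 * j) \<le> 2 ^ k" by (simp only: power_mult[symmetric] mult.commute)
            hence "24 * j \<le> k" by (simp only: power_increasing_iff[of "2::nat"] one_less_numeral_iff semiring_norm)
            hence "N \<in> A" using k by (auto simp: A_def)
            thus "\<bar>weighted_avg N (ramanujan_sum C) f x\<bar> \<le> ramanujan_max A C f x"
              by (intro max_over_ge[OF A, of _ "\<lambda>N. weighted_avg N (ramanujan_sum C) f x"])
          qed
          show "0 \<le> ?F C x" by (intro mult_nonneg_nonneg w max_over_nonneg scales_finite)
        qed
        have "(\<Sum>C\<in>{C\<in>\<C>. e C = j}. ?F C x) \<le> (\<Sum>C\<in>{C\<in>\<C>. e C = j}. prime_weight C * ramanujan_max A C f x)"
          by (rule sum_mono) (rule F(1))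
        moreover have "0 \<le> (\<Sum>C\<in>{C\<in>\<C>. e C = j}. ?F C x)" by (rule sum_nonneg) (rule F(2))
        ultimately show "\<bar>\<Sum>C\<in>{C\<in>\<C>. e C = j}. ?F C x\<bar> \<le> \<bar>\<Sum>C\<in>{C\<in>\<C>. e C = j}. prime_weight C * ramanujan_max A C f x\<bar>"
          by linarith
      qed simp
    qed
    have "l2_bounded (\<lambda>x. \<Sum>j\<in>J. \<Sum>C\<in>{C\<in>\<C>. e C = j}. ?F C x) (\<Sum>j\<in>J. K * B * r ^ j)"
      by (intro l2_bounded_sum l2j)
    moreover have "(\<Sum>j\<in>J. \<Sum>C\<in>{C\<in>\<C>. e C = j}. ?F C x) = (\<Sum>C\<in>\<C>. ?F C x)" for x
      unfolding J_def by (rule sum.image_gen[OF fin, symmetric])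
    ultimately have l2: "l2_bounded (\<lambda>x. \<Sum>C\<in>\<C>. ?F C x) (K * B * (\<Sum>j\<in>J. r ^ j))" by (simp add: sum_distrib_left)
    have "(\<Sum>j\<in>J. r ^ j) \<le> 2 powr (1/4) / (1 - r) * z powr (-(1/4))"
    proof (cases "J = {}")
      case False
      define j0 where "j0 = Min J"
      have "j0 \<in> J" unfolding j0_def using finJ False by (rule Min_in)
      then obtain C0 where C0: "C0 \<in> \<C>" "j0 = e C0" by (auto simp: J_def)
      have "z < real (\<Prod>C0)" using C C0 by blast
      also have "real (\<Prod>C0) \<le> real (2 * 2 ^ j0)" using e(2)[OF C0(1)] C0(2) by (simp only: of_nat_le_iff less_imp_le)
      finally have zj: "z \<le> 2 * 2 ^ j0" by simp
      have "(\<Sum>j\<in>J. r ^ j) \<le> r ^ j0 / (1 - r)"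
        using finJ by (intro geometric_tail_le r) (auto simp: j0_def)
      also have "r ^ j0 = (2 ^ j0) powr (-(1/4))"
      proof -
        have "(2 ^ j0) powr (-(1/4)) = (2 powr real j0) powr (-(1/4))" by (simp add: powr_realpow)
        also have "\<dots> = r powr real j0" by (simp add: r_def powr_powr mult.commute)
        also have "\<dots> = r ^ j0" using r by (simp add: powr_realpow)
        finally show ?thesis ..
      qed
      also have "\<dots> \<le> (z / 2) powr (-(1/4))" using z zj by (intro powr_mono2') auto
      also have "\<dots> = 2 powr (1/4) * z powr (-(1/4))" using z by (simp add: powr_divide powr_minus divide_simps)
      finally show ?thesis using r by (simp add: divide_right_mono)
    qed (use r in simp)
    hence "K * B * (\<Sum>j\<in>J. r ^ j) \<le> K * B * (2 powr (1/4) / (1 - r) * z powr (-(1/4)))"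
      using K B0 by (intro mult_left_mono) auto
    hence le: "K * B * (\<Sum>j\<in>J. r ^ j) \<le> K2 * z powr (-(1/4)) * B" by (simp add: K2_def mult_ac)
    show "l2_bounded (\<lambda>x. \<Sum>C\<in>\<C>. ?F C x) (K2 * z powr (-(1/4)) * B)"
      by (rule l2_bounded_mono[OF l2 order_refl le])
  qed
qed

section \<open>The mass of a sieve without small primes\<close>

text \<open>
The moduli of the sieve: squarefree numbers up to \<open>R\<close> without prime factors up to \<open>z\<close>.
\<close>
definition sieve_sets :: "real \<Rightarrow> nat \<Rightarrow> nat set set" where
  "sieve_sets z R = {A. prime_set A \<and> (\<forall>p\<in>A. z < real p) \<and> \<Prod>A \<le> R}"

definition sieve_mass :: "real \<Rightarrow> nat \<Rightarrow> real" where
  "sieve_mass z R = (\<Sum>A\<in>sieve_sets z R. 1 / totient_prod A)"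

lemma sieve_sets_prime_set: "A \<in> sieve_sets z R \<Longrightarrow> prime_set A"
  by (simp add: sieve_sets_def)

lemma sieve_sets_finite: "finite (sieve_sets z R)"
proof (rule finite_subset)
  show "sieve_sets z R \<subseteq> Pow {..R}"
  proof
    fix A assume A: "A \<in> sieve_sets z R"
    have "p \<le> R" if "p \<in> A" for p
    proof -
      have "p dvd \<Prod>A" using A that by (intro dvd_prodI) (auto simp: sieve_sets_def prime_set_def)
      hence "p \<le> \<Prod>A" using prime_set_prod_pos[OF sieve_sets_prime_set[OF A]] by (rule dvd_imp_le)
      thus ?thesis using A by (simp add: sieve_sets_def)
    qed
    thus "A \<in> Pow {..R}" by auto
  qed
qed simp

lemma sum_inverse_powers_le:
  assumes "prime p"
  shows "(\<Sum>i\<in>{1..R}. 1 / real p ^ i) \<le> 1 / (real p - 1)"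
proof -
  have p: "real p \<ge> 2" using prime_ge_2_nat[OF assms] by simp
  have "(\<Sum>i\<in>{1..R}. (1 / real p) ^ i) \<le> (1 / real p) ^ 1 / (1 - 1 / real p)"
    using p by (intro geometric_tail_le) auto
  also have "\<dots> = 1 / (real p - 1)" using p by (simp add: field_simps)
  finally show ?thesis by (simp add: power_one_over)
qed

lemma sum_le_sum_cover:
  fixes g :: "'b \<Rightarrow> real"
  assumes "finite I" "S \<subseteq> h ` I" "\<And>i. 0 \<le> g i"
  shows "sum g S \<le> (\<Sum>i\<in>I. g (h i))"
proof -
  have "sum g S \<le> sum g (h ` I)" using assms by (intro sum_mono2) auto
  also have "\<dots> \<le> sum (g \<circ> h) I" using assms by (intro sum_image_le) auto
  finally show ?thesis by (simp add: o_def)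
qed

text \<open>
Adding a prime to the radical multiplies the full sum by \<open>1/p + 1/p\<^sup>2 + \<dots> = 1 / (p - 1)\<close>.
\<close>
lemma sum_inverse_fixed_radical_le:
  assumes "prime_set A"
  shows "(\<Sum>m\<in>{m\<in>{1..R}. prime_factors m = A}. 1 / real m) \<le> 1 / totient_prod A"
proof -
  have "finite A" using assms by (rule prime_set_finite)
  thus ?thesis using assms
  proof (induction A rule: finite_induct)
    case empty
    have "{m\<in>{1..R}. prime_factors m = {}} \<subseteq> {1}" by (auto simp: prime_factorization_empty_iff)
    hence "(\<Sum>m\<in>{m\<in>{1..R}. prime_factors m = {}}. 1 / real m) \<le> (\<Sum>m\<in>{1}. 1 / real m)" by (intro sum_mono2) auto
    thus ?case by simp
  next
    case (insert p A)
    have A: "prime_set A" using insert.prems by (rule prime_set_subset) auto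
    have p: "prime p" using insert.prems by (simp add: prime_set_def)
    let ?M = "{m\<in>{1..R}. prime_factors m = A}"
    have cov: "{m\<in>{1..R}. prime_factors m = insert p A} \<subseteq> (\<lambda>(i, m). p ^ i * m) ` ({1..R} \<times> ?M)"
    proof
      fix m assume m: "m \<in> {m\<in>{1..R}. prime_factors m = insert p A}"
      have m0: "m \<noteq> 0" using m by auto
      have "\<not> is_unit p" using p not_prime_unit by blast
      from multiplicity_decompose'[OF m0 this] obtain k where k: "m = p ^ multiplicity p m * k" "\<not> p dvd k"
        by blast
      define i where "i = multiplicity p m"
      have "p \<in> prime_factors m" using m by simp
      hence "p dvd m" by auto
      hence i1: "i \<ge> 1" using prime_multiplicity_gt_zero_iff[of p m] m0 p unfolding i_def by (simp add: Suc_le_eq)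
      have k0: "k \<noteq> 0" using k(2) by (intro notI) simp
      have mk: "m = p ^ i * k" unfolding i_def by (rule k(1))
      have "prime_factors m = prime_factors (p ^ i * k)" by (rule arg_cong[OF mk])
      also have "\<dots> = prime_factors (p ^ i) \<union> prime_factors k"
        using p k0 by (intro prime_factors_product) auto
      also have "prime_factors (p ^ i) = {p}" using prime_factors_power[of i p] prime_prime_factors[OF p] i1 by simp
      finally have "insert p A = insert p (prime_factors k)" using m by simp
      moreover have "p \<notin> prime_factors k" using k(2) by auto
      ultimately have kA: "prime_factors k = A" using insert.hyps(2) by auto
      have mR: "m \<le> R" using m by simp
      have "i < 2 ^ i" by simp
      also have "2 ^ i \<le> p ^ i" using prime_ge_2_nat[OF p] by (intro power_mono) auto
      also have "p ^ i \<le> p ^ i * k" using k0 by simp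
      also have "\<dots> = m" by (rule mk[symmetric])
      finally have "i \<le> R" using mR by simp
      moreover have "p ^ i > 0" using prime_gt_0_nat[OF p] by simp
      hence "1 * k \<le> p ^ i * k" by (intro mult_right_mono) (simp_all add: Suc_le_eq)
      hence "k \<le> p ^ i * k" by simp
      hence "k \<le> R" using mR unfolding mk[symmetric] by (rule order_trans)
      ultimately show "m \<in> (\<lambda>(i, m). p ^ i * m) ` ({1..R} \<times> ?M)"
        using mk i1 k0 kA by (intro image_eqI[of _ _ "(i, k)"]) auto
    qed
    have "(\<Sum>m\<in>{m\<in>{1..R}. prime_factors m = insert p A}. 1 / real m) \<le> (\<Sum>x\<in>{1..R} \<times> ?M. 1 / real ((\<lambda>(i, m). p ^ i * m) x))"
      by (rule sum_le_sum_cover[OF _ cov]) auto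
    also have "\<dots> = (\<Sum>i\<in>{1..R}. \<Sum>m\<in>?M. (1 / real p ^ i) * (1 / real m))"
      unfolding sum.cartesian_product by (intro sum.cong) auto
    also have "\<dots> = (\<Sum>i\<in>{1..R}. 1 / real p ^ i) * (\<Sum>m\<in>?M. 1 / real m)" by (rule sum_product[symmetric])
    also have "\<dots> \<le> (1 / (real p - 1)) * (1 / totient_prod A)"
      using prime_ge_2_nat[OF p] by (intro mult_mono sum_inverse_powers_le p insert.IH A sum_nonneg) auto
    also have "\<dots> = 1 / totient_prod (insert p A)" using insert.hyps by simp
    finally show ?case .
  qed
qed

lemma smooth_rough_factorization:
  assumes "n \<noteq> (0::nat)"
  shows "\<exists>s m. n = s * m \<and> (\<forall>p\<in>prime_factors s. real p \<le> z) \<and> (\<forall>p\<in>prime_factors m. z < real p)"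
  using assms
proof (induction n rule: prime_divisors_induct)
  case (unit x)
  hence "x = 1" by simp
  thus ?case by (intro exI[of _ 1]) auto
next
  case (factor p x)
  hence "x \<noteq> 0" by auto
  then obtain s m where sm: "x = s * m" "\<forall>p\<in>prime_factors s. real p \<le> z" "\<forall>p\<in>prime_factors m. z < real p"
    using factor.IH by blast
  have nz: "s \<noteq> 0" "m \<noteq> 0" "p \<noteq> 0" using sm \<open>x \<noteq> 0\<close> factor by auto
  show ?case
  proof (cases "real p \<le> z")
    case True
    have "prime_factors (p * s) = insert p (prime_factors s)"
      using nz factor by (simp add: prime_factors_product prime_prime_factors)
    thus ?thesis using sm True by (intro exI[of _ "p * s"] exI[of _ m]) (auto simp: mult_ac)
  next
    case False
    have "prime_factors (p * m) = insert p (prime_factors m)"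
      using nz factor by (simp add: prime_factors_product prime_prime_factors)
    thus ?thesis using sm False by (intro exI[of _ s] exI[of _ "p * m"]) (auto simp: mult_ac)
  qed
qed simp

text \<open>
Count the prime factors of \<open>1, \<dots>, n\<close>: the sum of \<open>ln p * (n div p)\<close> is at most \<open>ln n! \<le> n * ln n\<close>.
For \<open>p \<le> n\<close> the quotient \<open>n div p\<close> is at least half of \<open>n / p\<close>.
\<close>
lemma sum_log_prime_over_prime_le:
  assumes "n \<ge> 1"
  shows "(\<Sum>p\<in>{p\<in>{1..n}. prime p}. ln (real p) / real p) \<le> 2 * ln (real n)"
proof -
  let ?P = "{p\<in>{1..n}. prime p}"
  have "(\<Sum>p\<in>?P. ln (real p) * (real n / (2 * real p))) \<le> (\<Sum>p\<in>?P. ln (real p) * real (n div p))"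
  proof (intro sum_mono mult_left_mono)
    fix p assume p: "p \<in> ?P"
    hence p0: "p > 0" "p \<le> n" by auto
    have "n div p \<ge> 1" using p0 by (simp add: div_greater_zero_iff Suc_le_eq)
    have "n = p * (n div p) + n mod p" by simp
    also have "\<dots> \<le> p * (n div p) + p" using p0 by (intro add_left_mono less_imp_le mod_less_divisor)
    also have "\<dots> \<le> p * (n div p) + p * (n div p)" using \<open>n div p \<ge> 1\<close> by simp
    finally have "real n \<le> real (p * (n div p) + p * (n div p))" by (simp only: of_nat_le_iff)
    hence "real n \<le> 2 * real p * real (n div p)" by simp
    thus "real n / (2 * real p) \<le> real (n div p)" using p0 by (simp add: divide_le_eq mult_ac)
    show "0 \<le> ln (real p)" using p0 by simp
  qed
  also have "\<dots> = (\<Sum>p\<in>?P. \<Sum>m\<in>{1..n}. if p dvd m then ln (real p) else 0)"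
  proof (intro sum.cong refl)
    fix p assume "p \<in> ?P"
    hence p0: "p > 0" by auto
    have "{m\<in>{1..n}. p dvd m} = (\<lambda>k. p * k) ` {1..n div p}"
    proof (intro equalityI subsetI)
      fix m assume m: "m \<in> {m\<in>{1..n}. p dvd m}"
      then obtain k where k: "m = p * k" by auto
      have "k \<ge> 1" using m k by (cases k) auto
      thus "m \<in> (\<lambda>k. p * k) ` {1..n div p}"
        using m k p0 by (auto simp: less_eq_div_iff_mult_less_eq mult.commute)
    next
      fix m assume "m \<in> (\<lambda>k. p * k) ` {1..n div p}"
      thus "m \<in> {m\<in>{1..n}. p dvd m}" using p0 by (auto simp: less_eq_div_iff_mult_less_eq mult.commute)
    qed
    hence "card {m\<in>{1..n}. p dvd m} = n div p"
      using p0 by (simp add: card_image inj_on_def)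
    thus "ln (real p) * real (n div p) = (\<Sum>m\<in>{1..n}. if p dvd m then ln (real p) else 0)"
      by (simp add: sum.If_cases Int_def mult.commute)
  qed
  also have "\<dots> = (\<Sum>m\<in>{1..n}. \<Sum>p\<in>?P. if p dvd m then ln (real p) else 0)" by (rule sum.swap)
  also have "\<dots> \<le> (\<Sum>m\<in>{1..n}. ln (real m))"
  proof (rule sum_mono)
    fix m assume m: "m \<in> {1..n}"
    have "(\<Sum>p\<in>?P. if p dvd m then ln (real p) else 0) = (\<Sum>p\<in>{p\<in>?P. p dvd m}. mangoldt p)"
      by (subst sum.inter_filter[symmetric]) (auto intro!: sum.cong)
    also have "\<dots> \<le> (\<Sum>d | d dvd m. mangoldt d)"
      using m by (intro sum_mono2) (auto simp: mangoldt_nonneg)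
    also have "\<dots> = ln (real m)" using m mangoldt_sum[of m, where 'a = real] by simp
    finally show "(\<Sum>p\<in>?P. if p dvd m then ln (real p) else 0) \<le> ln (real m)" .
  qed
  also have "\<dots> \<le> (\<Sum>m\<in>{1..n}. ln (real n))" by (intro sum_mono) auto
  also have "\<dots> = real n * ln (real n)" by simp
  finally have "(real n / 2) * (\<Sum>p\<in>?P. ln (real p) / real p) \<le> (real n / 2) * (2 * ln (real n))"
    by (simp add: sum_distrib_left mult_ac)
  moreover have "real n / 2 > 0" using assms by simp
  ultimately show ?thesis by (rule mult_left_le_imp_le)
qed

text \<open>
Let the numbers in \<open>S\<close> carry the weights \<open>1 / s\<close>. Writing \<open>ln s\<close> as the sum of \<open>mangoldt d\<close> over the
divisors \<open>d\<close> and pulling \<open>d\<close> out of \<open>s\<close> shows that the mean of \<open>ln s\<close> is at most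
\<open>4 * ln z\<close>. By Markov's inequality at least half of the total weight sits on \<open>s \<le> z ^ 8\<close>, where it is
bounded by a harmonic sum.
\<close>
lemma smooth_sum_le:
  fixes z :: real and R :: nat
  assumes z: "z \<ge> 2"
  defines "S \<equiv> {s\<in>{1..R}. \<forall>p\<in>prime_factors s. real p \<le> z}"
  shows "(\<Sum>s\<in>S. 1 / real s) \<le> 20 * ln z"
proof -
  define T where "T = (\<Sum>s\<in>S. 1 / real s)"
  have T0: "T \<ge> 0" unfolding T_def by (intro sum_nonneg) auto
  have finS: "finite S" by (simp add: S_def)
  have lnz: "ln z \<ge> 1 / 2" 
  proof -
    have "ln z \<ge> ln 2" using z by simp
    thus ?thesis using ln2_ge_two_thirds by simp
  qed
  define Pz where "Pz = {p\<in>{1..nat \<lfloor>z\<rfloor>}. prime p}"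
  define D where "D = {d\<in>{1..R}. primepow d \<and> real (aprimedivisor d) \<le> z}"
  have PzI: "p \<in> Pz" if "prime p" "real p \<le> z" for p
    using that prime_ge_1_nat[of p] unfolding Pz_def by (auto simp: le_nat_floor)
  have D_sum: "(\<Sum>d\<in>D. mangoldt d / real d) \<le> 4 * ln z"
  proof -
    have cov: "D \<subseteq> (\<lambda>(p, i). p ^ i) ` (Pz \<times> {1..R})"
    proof
      fix d assume d: "d \<in> D"
      then obtain p i where pi: "prime p" "i > 0" "d = p ^ i" by (auto simp: D_def primepow_def)
      have "real p \<le> z" using d pi by (simp add: D_def aprimedivisor_prime_power)
      have "i < 2 ^ i" by simp
      also have "2 ^ i \<le> p ^ i" using prime_ge_2_nat[OF pi(1)] by (intro power_mono) auto
      finally have "i \<le> R" using d pi by (simp add: D_def)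
      thus "d \<in> (\<lambda>(p, i). p ^ i) ` (Pz \<times> {1..R})"
        using pi PzI[OF pi(1) \<open>real p \<le> z\<close>] by (intro image_eqI[of _ _ "(p, i)"]) auto
    qed
    have "(\<Sum>d\<in>D. mangoldt d / real d) \<le> (\<Sum>x\<in>Pz \<times> {1..R}. mangoldt ((\<lambda>(p, i). p ^ i) x) / real ((\<lambda>(p, i). p ^ i) x))"
      by (rule sum_le_sum_cover[OF _ cov]) (auto simp: Pz_def mangoldt_nonneg)
    also have "\<dots> = (\<Sum>p\<in>Pz. \<Sum>i\<in>{1..R}. ln (real p) * (1 / real p ^ i))"
      unfolding sum.cartesian_product by (intro sum.cong) (auto simp: Pz_def)
    also have "\<dots> \<le> (\<Sum>p\<in>Pz. 2 * (ln (real p) / real p))"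
    proof (rule sum_mono)
      fix p assume "p \<in> Pz"
      hence p: "prime p" by (simp add: Pz_def)
      have p2: "real p \<ge> 2" using prime_ge_2_nat[OF p] by simp
      have "(\<Sum>i\<in>{1..R}. ln (real p) * (1 / real p ^ i)) = ln (real p) * (\<Sum>i\<in>{1..R}. 1 / real p ^ i)"
        by (simp add: sum_distrib_left)
      also have "\<dots> \<le> ln (real p) * (1 / (real p - 1))" using p2 by (intro mult_left_mono sum_inverse_powers_le p) auto
      also have "\<dots> \<le> ln (real p) * (2 / real p)" using p2 by (intro mult_left_mono) (auto simp: divide_simps)
      finally show "(\<Sum>i\<in>{1..R}. ln (real p) * (1 / real p ^ i)) \<le> 2 * (ln (real p) / real p)" by (simp add: mult_ac)
    qed
    also have "\<dots> = 2 * (\<Sum>p\<in>Pz. ln (real p) / real p)" by (simp add: sum_distrib_left)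
    also have "\<dots> \<le> 2 * (2 * ln (real (nat \<lfloor>z\<rfloor>)))"
      unfolding Pz_def using z by (intro mult_left_mono sum_log_prime_over_prime_le) (auto simp: le_nat_floor)
    also have "\<dots> \<le> 4 * ln z"
    proof -
      have "1 \<le> nat \<lfloor>z\<rfloor>" using z by (simp add: le_nat_floor)
      moreover have "real (nat \<lfloor>z\<rfloor>) \<le> z" using z by (simp add: of_nat_floor)
      ultimately show ?thesis by simp
    qed
    finally show ?thesis .
  qed
  have "(\<Sum>s\<in>S. ln (real s) / real s) = (\<Sum>s\<in>S. \<Sum>d\<in>D. if d dvd s then mangoldt d / real s else 0)"
  proof (rule sum.cong[OF refl])
    fix s assume s: "s \<in> S"
    hence s0: "s > 0" "s \<le> R" by (auto simp: S_def)
    have "ln (real s) = (\<Sum>d | d dvd s. mangoldt d)" using mangoldt_sum[of s, where 'a = real] s0 by simp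
    also have "\<dots> = (\<Sum>d\<in>{d\<in>D. d dvd s}. mangoldt d)"
    proof (rule sum.mono_neutral_right)
      show "\<forall>d\<in>{d. d dvd s} - {d\<in>D. d dvd s}. mangoldt d = 0"
      proof
        fix d assume d: "d \<in> {d. d dvd s} - {d\<in>D. d dvd s}"
        hence ds: "d dvd s" "d \<notin> D" by auto
        have dR: "d \<in> {1..R}" using ds(1) s0 by (auto intro: Nat.gr0I order_trans[OF dvd_imp_le] simp: Suc_le_eq)
        show "mangoldt d = 0"
        proof (cases "primepow d")
          case True
          then obtain p i where pi: "prime p" "i > 0" "d = p ^ i" by (auto simp: primepow_def)
          have "p dvd s" using ds(1) pi by (meson dvd_power dvd_trans)
          hence "p \<in> prime_factors s" using pi s0 by (auto simp: in_prime_factors_iff)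
          hence "real p \<le> z" using s by (simp add: S_def)
          hence "d \<in> D" using dR True pi by (simp add: D_def aprimedivisor_prime_power)
          thus ?thesis using ds by simp
        qed (simp add: mangoldt_def)
      qed
    qed (use s0 in auto)
    finally have "ln (real s) / real s = (\<Sum>d\<in>{d\<in>D. d dvd s}. mangoldt d / real s)" by (simp add: sum_divide_distrib)
    also have "\<dots> = (\<Sum>d\<in>D. if d dvd s then mangoldt d / real s else 0)"
      by (rule sum.inter_filter) (simp add: D_def)
    finally show "ln (real s) / real s = (\<Sum>d\<in>D. if d dvd s then mangoldt d / real s else 0)" .
  qed
  also have "\<dots> = (\<Sum>d\<in>D. \<Sum>s\<in>S. if d dvd s then mangoldt d / real s else 0)" by (rule sum.swap)
  also have "\<dots> \<le> (\<Sum>d\<in>D. mangoldt d / real d * T)"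
  proof (rule sum_mono)
    fix d assume d: "d \<in> D"
    hence d0: "d > 0" by (auto simp: D_def)
    have cov: "{s\<in>S. d dvd s} \<subseteq> (\<lambda>t. d * t) ` S"
    proof
      fix s assume s: "s \<in> {s\<in>S. d dvd s}"
      then obtain t where t: "s = d * t" by auto
      have t0: "t > 0" using s t by (intro Nat.gr0I) (simp add: S_def)
      have "t \<le> d * t" using d0 by simp
      also have "d * t \<le> R" using s t by (auto simp: S_def)
      finally have "t \<le> R" .
      moreover have "prime_factors t \<subseteq> prime_factors s" using t d0 t0 by (intro dvd_prime_factors) auto
      ultimately have "t \<in> S" using s t0 by (auto simp: S_def)
      thus "s \<in> (\<lambda>t. d * t) ` S" using t by auto
    qed
    have "(\<Sum>s\<in>S. if d dvd s then mangoldt d / real s else 0) = mangoldt d * (\<Sum>s\<in>{s\<in>S. d dvd s}. 1 / real s)"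
      using finS by (subst sum.inter_filter[symmetric]) (auto simp: sum_distrib_left)
    also have "\<dots> \<le> mangoldt d * (\<Sum>t\<in>S. 1 / real (d * t))"
      by (intro mult_left_mono sum_le_sum_cover[OF finS cov] mangoldt_nonneg) auto
    also have "\<dots> = mangoldt d / real d * T" by (simp add: T_def sum_distrib_left)
    finally show "(\<Sum>s\<in>S. if d dvd s then mangoldt d / real s else 0) \<le> mangoldt d / real d * T" .
  qed
  also have "\<dots> = (\<Sum>d\<in>D. mangoldt d / real d) * T" by (simp add: sum_distrib_right)
  also have "\<dots> \<le> 4 * ln z * T" by (intro mult_right_mono D_sum T0)
  finally have mean: "(\<Sum>s\<in>S. ln (real s) / real s) \<le> 4 * ln z * T" .
  define S1 where "S1 = {s\<in>S. real s \<le> z ^ 8}"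
  define S2 where "S2 = {s\<in>S. real s > z ^ 8}"
  have "T = (\<Sum>s\<in>S1. 1 / real s) + (\<Sum>s\<in>S2. 1 / real s)"
    unfolding T_def using finS by (subst sum.union_disjoint[symmetric]) (auto simp: S1_def S2_def intro!: sum.cong)
  also have "(\<Sum>s\<in>S2. 1 / real s) \<le> T / 2"
  proof -
    have "(\<Sum>s\<in>S2. 8 * ln z * (1 / real s)) \<le> (\<Sum>s\<in>S2. ln (real s) / real s)"
    proof (rule sum_mono)
      fix s assume s: "s \<in> S2"
      have "z ^ 8 > 0" using z by simp
      hence "ln (z ^ 8) \<le> ln (real s)" using s unfolding S2_def S_def by (subst ln_le_cancel_iff) auto
      hence "8 * ln z \<le> ln (real s)" using z by (simp add: ln_realpow)
      thus "8 * ln z * (1 / real s) \<le> ln (real s) / real s" by (simp add: divide_right_mono)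
    qed
    also have "\<dots> \<le> (\<Sum>s\<in>S. ln (real s) / real s)"
      using finS by (intro sum_mono2) (auto simp: S2_def S_def)
    also note mean
    finally have "4 * ln z * (2 * (\<Sum>s\<in>S2. 1 / real s)) \<le> 4 * ln z * T" by (simp add: sum_distrib_left mult_ac)
    hence "2 * (\<Sum>s\<in>S2. 1 / real s) \<le> T" using lnz by (subst (asm) mult_le_cancel_left_pos) auto
    thus ?thesis by simp
  qed
  also have "(\<Sum>s\<in>S1. 1 / real s) \<le> 1 + 8 * ln z"
  proof -
    define n where "n = nat \<lfloor>z ^ 8\<rfloor>"
    have z8: "z ^ 8 \<ge> 1" using z by simp
    have n1: "n \<ge> 1" unfolding n_def using z8 by (simp add: le_nat_floor)
    have "S1 \<subseteq> {1..n}" by (auto simp: S1_def S_def n_def le_nat_floor)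
    hence "(\<Sum>s\<in>S1. 1 / real s) \<le> (\<Sum>s\<in>{1..n}. 1 / real s)" by (intro sum_mono2) auto
    also have "\<dots> = harm n" by (simp add: harm_def divide_inverse)
    also have "harm n \<le> 1 + ln (real n)"
      using euler_mascheroni_sequence_decreasing[of 1 n] n1 by (simp add: harm_def)
    also have "ln (real n) \<le> ln (z ^ 8)"
    proof -
      have "real n \<le> z ^ 8" unfolding n_def using z8 by (intro of_nat_floor) simp
      thus ?thesis using n1 z8 by (subst ln_le_cancel_iff) auto
    qed
    also have "ln (z ^ 8) = 8 * ln z" using z by (simp add: ln_realpow)
    finally show ?thesis by simp
  qed
  finally have "T \<le> 2 * (1 + 8 * ln z)" by simp
  hence "T \<le> 20 * ln z" using lnz by (simp add: algebra_simps)
  thus ?thesis by (simp only: T_def)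
qed

text \<open>
Every number up to \<open>R\<close> is a smooth number times a rough one, so the harmonic sum is at most the product
of a smooth sum, which is \<open>O(ln z)\<close>, and a rough sum. Sorting the rough numbers by their radical
bounds the latter by the mass of the sieve.
\<close>
lemma sieve_mass_ge:
  assumes z: "z \<ge> 2" and R: "R \<ge> 1"
  shows "ln (real R) \<le> 20 * ln z * sieve_mass z R"
proof -
  define S where "S = {s\<in>{1..R}. \<forall>p\<in>prime_factors s. real p \<le> z}"
  define Q where "Q = {m\<in>{1..R}. \<forall>p\<in>prime_factors m. z < real p}"
  have cov: "{1..R} \<subseteq> (\<lambda>(s, m). s * m) ` (S \<times> Q)"
  proof
    fix n assume n: "n \<in> {1..R}"
    then obtain s m where sm: "n = s * m" "\<forall>p\<in>prime_factors s. real p \<le> z" "\<forall>p\<in>prime_factors m. z < real p"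
      using smooth_rough_factorization[of n z] by auto
    have nz: "s > 0" "m > 0" using n sm by (auto intro: Nat.gr0I)
    have "s \<le> s * m" "m \<le> s * m" using nz by auto
    moreover have "s * m \<le> R" using n sm(1) by simp
    ultimately have "s \<le> R" "m \<le> R" by linarith+
    thus "n \<in> (\<lambda>(s, m). s * m) ` (S \<times> Q)"
      using sm nz by (intro image_eqI[of _ _ "(s, m)"]) (auto simp: S_def Q_def)
  qed
  have "ln (real R) \<le> harm R" using harm_ge_ln[of R] R ln_le_cancel_iff[of "real R" "real R + 1"] by linarith
  also have "harm R = (\<Sum>n\<in>{1..R}. 1 / real n)" by (simp add: harm_def divide_inverse)
  also have "\<dots> \<le> (\<Sum>x\<in>S \<times> Q. 1 / real ((\<lambda>(s, m). s * m) x))"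
    by (rule sum_le_sum_cover[OF _ cov]) (auto simp: S_def Q_def)
  also have "\<dots> = (\<Sum>s\<in>S. \<Sum>m\<in>Q. (1 / real s) * (1 / real m))"
    unfolding sum.cartesian_product by (intro sum.cong) auto
  also have "\<dots> = (\<Sum>s\<in>S. 1 / real s) * (\<Sum>m\<in>Q. 1 / real m)" by (rule sum_product[symmetric])
  also have "\<dots> \<le> (20 * ln z) * sieve_mass z R"
  proof (intro mult_mono)
    show "(\<Sum>s\<in>S. 1 / real s) \<le> 20 * ln z" unfolding S_def by (rule smooth_sum_le[OF z])
    have rad: "prime_factors m \<in> sieve_sets z R" if "m \<in> Q" for m
    proof -
      have m: "m > 0" "m \<le> R" using that by (auto simp: Q_def)
      have "prime_set (prime_factors m)" by (auto simp: prime_set_def)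
      hence "int (\<Prod>(prime_factors m)) dvd int m" by (subst prime_set_int_dvd_iff) auto
      hence "\<Prod>(prime_factors m) dvd m" by (simp only: of_nat_dvd_iff)
      hence "\<Prod>(prime_factors m) \<le> R" using m by (meson dvd_imp_le order_trans)
      thus ?thesis using that by (auto simp: sieve_sets_def prime_set_def Q_def)
    qed
    have "(\<Sum>m\<in>Q. 1 / real m) = (\<Sum>A\<in>prime_factors ` Q. \<Sum>m\<in>{m\<in>Q. prime_factors m = A}. 1 / real m)"
      by (rule sum.image_gen) (simp add: Q_def)
    also have "\<dots> \<le> (\<Sum>A\<in>prime_factors ` Q. 1 / totient_prod A)"
    proof (rule sum_mono)
      fix A assume "A \<in> prime_factors ` Q"
      hence A: "prime_set A" using rad sieve_sets_prime_set by blast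
      have "(\<Sum>m\<in>{m\<in>Q. prime_factors m = A}. 1 / real m) \<le> (\<Sum>m\<in>{m\<in>{1..R}. prime_factors m = A}. 1 / real m)"
        by (intro sum_mono2) (auto simp: Q_def)
      also have "\<dots> \<le> 1 / totient_prod A" by (rule sum_inverse_fixed_radical_le[OF A])
      finally show "(\<Sum>m\<in>{m\<in>Q. prime_factors m = A}. 1 / real m) \<le> 1 / totient_prod A" .
    qed
    also have "\<dots> \<le> sieve_mass z R" unfolding sieve_mass_def
    proof (rule sum_mono2[OF sieve_sets_finite])
      show "prime_factors ` Q \<subseteq> sieve_sets z R" using rad by auto
      show "0 \<le> 1 / totient_prod A" if "A \<in> sieve_sets z R - prime_factors ` Q" for A
        using prime_set_totient_ge[OF sieve_sets_prime_set[of A z R]] that by simp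
    qed
    finally show "(\<Sum>m\<in>Q. 1 / real m) \<le> sieve_mass z R" .
  qed (use z in \<open>auto intro!: sum_nonneg\<close>)
  finally show ?thesis by simp
qed

section \<open>The majorant of the sieve\<close>

text \<open>
Selberg's weights in their Fourier form \<open>(\<Sum>q. \<mu>(q) / \<phi>(q) * c\<^sub>q(n))\<close>. At an argument free of sifting
primes all terms are equal to \<open>1 / \<phi>(q)\<close>, so its value there is the full mass.
\<close>
definition sieve_fun :: "real \<Rightarrow> nat \<Rightarrow> int \<Rightarrow> real" where
  "sieve_fun z R n = (\<Sum>A\<in>sieve_sets z R. (-1) ^ card A / totient_prod A * ramanujan_sum A n)"

lemma ramanujan_sum_union:
  assumes "finite A" "finite B" "A \<inter> B = {}"
  shows "ramanujan_sum (A \<union> B) n = ramanujan_sum A n * ramanujan_sum B n"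
  unfolding ramanujan_sum_def by (rule prod.union_disjoint[OF assms])

text \<open>
For a common prime factor, \<open>c\<^sub>p\<^sup>2 = (p - 1) + (p - 2) * c\<^sub>p\<close>; the set \<open>D\<close> records the primes at which
the second summand is taken.
\<close>
lemma ramanujan_sum_mult:
  assumes A: "finite A" and B: "finite B"
  shows "ramanujan_sum A n * ramanujan_sum B n =
    (\<Sum>D\<in>Pow (A \<inter> B). (\<Prod>p\<in>D. real p - 2) * totient_prod (A \<inter> B - D) * ramanujan_sum ((A - B) \<union> (B - A) \<union> D) n)"
proof -
  let ?c = "\<lambda>p. if int p dvd n then real p - 1 else - 1"
  have "ramanujan_sum A n = ramanujan_sum (A - B) n * ramanujan_sum (A \<inter> B) n"
  proof -
    have "(A - B) \<union> (A \<inter> B) = A" by blast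
    moreover have "ramanujan_sum ((A - B) \<union> (A \<inter> B)) n = ramanujan_sum (A - B) n * ramanujan_sum (A \<inter> B) n"
      using A by (intro ramanujan_sum_union) auto
    ultimately show ?thesis by simp
  qed
  moreover have "ramanujan_sum B n = ramanujan_sum (B - A) n * ramanujan_sum (A \<inter> B) n"
  proof -
    have "(B - A) \<union> (A \<inter> B) = B" by blast
    moreover have "ramanujan_sum ((B - A) \<union> (A \<inter> B)) n = ramanujan_sum (B - A) n * ramanujan_sum (A \<inter> B) n"
      using B by (intro ramanujan_sum_union) auto
    ultimately show ?thesis by simp
  qed
  moreover have "ramanujan_sum ((A - B) \<union> (B - A)) n = ramanujan_sum (A - B) n * ramanujan_sum (B - A) n"
    using A B by (intro ramanujan_sum_union) auto
  ultimately have "ramanujan_sum A n * ramanujan_sum B n = ramanujan_sum ((A - B) \<union> (B - A)) n * (ramanujan_sum (A \<inter> B) n)\<^sup>2"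
    by (simp add: power2_eq_square)
  also have "(ramanujan_sum (A \<inter> B) n)\<^sup>2 = (\<Prod>p\<in>A \<inter> B. (real p - 2) * ?c p + (real p - 1))"
    unfolding ramanujan_sum_def prod_power_distrib by (intro prod.cong refl) (simp add: power2_eq_square algebra_simps)
  also have "\<dots> = (\<Sum>D\<in>Pow (A \<inter> B). (\<Prod>p\<in>D. (real p - 2) * ?c p) * totient_prod (A \<inter> B - D))"
    using A by (intro prod_add) auto
  also have "\<dots> = (\<Sum>D\<in>Pow (A \<inter> B). (\<Prod>p\<in>D. real p - 2) * totient_prod (A \<inter> B - D) * ramanujan_sum D n)"
    by (simp add: prod.distrib ramanujan_sum_def mult_ac)
  also have "ramanujan_sum ((A - B) \<union> (B - A)) n * \<dots> =
     (\<Sum>D\<in>Pow (A \<inter> B). (\<Prod>p\<in>D. real p - 2) * totient_prod (A \<inter> B - D) * ramanujan_sum ((A - B) \<union> (B - A) \<union> D) n)"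
    unfolding sum_distrib_left
  proof (intro sum.cong refl)
    fix D assume D: "D \<in> Pow (A \<inter> B)"
    have "ramanujan_sum ((A - B) \<union> (B - A) \<union> D) n = ramanujan_sum ((A - B) \<union> (B - A)) n * ramanujan_sum D n"
      using D A B finite_subset[of D A] by (intro ramanujan_sum_union) auto
    thus "ramanujan_sum ((A - B) \<union> (B - A)) n * ((\<Prod>p\<in>D. real p - 2) * totient_prod (A \<inter> B - D) * ramanujan_sum D n)
      = (\<Prod>p\<in>D. real p - 2) * totient_prod (A \<inter> B - D) * ramanujan_sum ((A - B) \<union> (B - A) \<union> D) n"
      by simp
  qed
  finally show ?thesis .
qed

lemma prime_set_prod_subset_le:
  assumes "prime_set B" "A \<subseteq> B"
  shows "\<Prod>A \<le> \<Prod>B"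
  using assms prime_set_finite[OF assms(1)] prime_set_prod_pos[OF assms(1)]
  by (intro dvd_imp_le prod_dvd_prod_subset)

lemma sieve_mass_ge_1:
  assumes "R \<ge> 1"
  shows "sieve_mass z R \<ge> 1"
proof -
  have "{{}} \<subseteq> sieve_sets z R" using assms by (simp add: sieve_sets_def prime_set_def)
  hence "(\<Sum>A\<in>{{}}. 1 / totient_prod A) \<le> sieve_mass z R"
    unfolding sieve_mass_def using sieve_sets_finite prime_set_totient_ge[OF sieve_sets_prime_set]
    by (intro sum_mono2) (auto intro: order_trans[OF zero_le_one])
  thus ?thesis by simp
qed

text \<open>
Expand the square into triples \<open>(A, B, D)\<close> with \<open>D \<subseteq> A \<inter> B\<close> and collect the terms
with the same modulus \<open>C = (A - B) \<union> (B - A) \<union> D\<close>. The primes in \<open>K = A \<inter> B - D\<close> leave no trace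
in the modulus, and the size of a term is at most \<open>1 / (\<phi>(C) * \<phi>(K))\<close>. A triple is determined by
\<open>(A - B, B - A, K)\<close> once \<open>C\<close> is known: this leaves at most \<open>4 ^ card C\<close> choices for the first two
components, and the sum over \<open>K\<close> is at most the mass of the sieve. For \<open>C = {}\<close> only the triples
\<open>(A, A, {})\<close> occur and give exactly the mass.
\<close>
lemma sieve_fun_square:
  assumes R: "R \<ge> 1"
  shows "\<exists>b. (\<forall>C. prime_set C \<longrightarrow> \<bar>b C\<bar> \<le> prime_weight C) \<and>
    (\<forall>n. (sieve_fun z R n)\<^sup>2 = sieve_mass z R * (1 + (\<Sum>C\<in>sieve_sets z (R\<^sup>2) - {{}}. b C * ramanujan_sum C n)))"
proof -
  let ?S = "sieve_sets z R" and ?L = "sieve_mass z R"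
  define \<phi> where "\<phi> A = totient_prod A" for A :: "nat set"
  define \<psi> where "\<psi> A = (\<Prod>p\<in>A. real p - 2)" for A :: "nat set"
  define \<Omega> where "\<Omega> = (SIGMA A:?S. SIGMA B:?S. Pow (A \<inter> B))"
  define u where "u = (\<lambda>(A, B, D). (-1) ^ card A / \<phi> A * ((-1) ^ card B / \<phi> B) * (\<psi> D * \<phi> (A \<inter> B - D)))"
  define c where "c = (\<lambda>(A, B, D). (A - B) \<union> (B - A) \<union> D :: nat set)"
  define b where "b C = (\<Sum>x\<in>{x\<in>\<Omega>. c x = C}. u x) / ?L" for C
  have L1: "?L \<ge> 1" by (rule sieve_mass_ge_1[OF R])
  have pS: "prime_set A" if "A \<in> ?S" for A using that by (rule sieve_sets_prime_set)
  have finS: "finite A" if "A \<in> ?S" for A using pS[OF that] by (rule prime_set_finite)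
  have phi1: "\<phi> A \<ge> 1" if "prime_set A" for A unfolding \<phi>_def by (rule prime_set_totient_ge[OF that])
  have fin\<Omega>: "finite \<Omega>" unfolding \<Omega>_def by (intro finite_SigmaI sieve_sets_finite) (auto simp: finS)
  have square: "(sieve_fun z R n)\<^sup>2 = (\<Sum>x\<in>\<Omega>. u x * ramanujan_sum (c x) n)" for n
  proof -
    have "(sieve_fun z R n)\<^sup>2 = (\<Sum>A\<in>?S. \<Sum>B\<in>?S. ((-1) ^ card A / \<phi> A * ramanujan_sum A n) * ((-1) ^ card B / \<phi> B * ramanujan_sum B n))"
      unfolding sieve_fun_def power2_eq_square \<phi>_def by (rule sum_product)
    also have "\<dots> = (\<Sum>A\<in>?S. \<Sum>B\<in>?S. \<Sum>D\<in>Pow (A \<inter> B). u (A, B, D) * ramanujan_sum (c (A, B, D)) n)"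
    proof (intro sum.cong refl)
      fix A B assume AB: "A \<in> ?S" "B \<in> ?S"
      have "((-1) ^ card A / \<phi> A * ramanujan_sum A n) * ((-1) ^ card B / \<phi> B * ramanujan_sum B n)
          = (-1) ^ card A / \<phi> A * ((-1) ^ card B / \<phi> B) * (ramanujan_sum A n * ramanujan_sum B n)" by simp
      also have "\<dots> = (\<Sum>D\<in>Pow (A \<inter> B). u (A, B, D) * ramanujan_sum (c (A, B, D)) n)"
        unfolding ramanujan_sum_mult[OF finS[OF AB(1)] finS[OF AB(2)]] sum_distrib_left
        by (intro sum.cong refl) (simp add: u_def c_def \<phi>_def \<psi>_def)
      finally show "((-1) ^ card A / \<phi> A * ramanujan_sum A n) * ((-1) ^ card B / \<phi> B * ramanujan_sum B n)
        = (\<Sum>D\<in>Pow (A \<inter> B). u (A, B, D) * ramanujan_sum (c (A, B, D)) n)" .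
    qed
    also have "\<dots> = (\<Sum>A\<in>?S. \<Sum>y\<in>(SIGMA B:?S. Pow (A \<inter> B)). u (A, y) * ramanujan_sum (c (A, y)) n)"
    proof (rule sum.cong[OF refl])
      fix A assume A: "A \<in> ?S"
      show "(\<Sum>B\<in>?S. \<Sum>D\<in>Pow (A \<inter> B). u (A, B, D) * ramanujan_sum (c (A, B, D)) n)
        = (\<Sum>y\<in>(SIGMA B:?S. Pow (A \<inter> B)). u (A, y) * ramanujan_sum (c (A, y)) n)"
        using finS[OF A] by (subst sum.Sigma) (auto simp: sieve_sets_finite intro!: sum.cong)
    qed
    also have "\<dots> = (\<Sum>x\<in>\<Omega>. u x * ramanujan_sum (c x) n)"
      unfolding \<Omega>_def by (subst sum.Sigma) (auto simp: sieve_sets_finite finS intro!: sum.cong)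
    finally show ?thesis .
  qed
  have c_in: "c x \<in> sieve_sets z (R\<^sup>2)" if "x \<in> \<Omega>" for x
  proof -
    obtain A B D where x: "x = (A, B, D)" by (cases x) auto
    have AB: "A \<in> ?S" "B \<in> ?S" "D \<subseteq> A \<inter> B" using that by (auto simp: \<Omega>_def x)
    have sub: "c x \<subseteq> A \<union> B" using AB(3) by (auto simp: c_def x)
    have pU: "prime_set (A \<union> B)" using pS[OF AB(1)] pS[OF AB(2)] by (auto simp: prime_set_def)
    have pc: "prime_set (c x)" by (rule prime_set_subset[OF pU sub])
    have "\<Prod>(c x) \<le> \<Prod>(A \<union> B)" by (rule prime_set_prod_subset_le[OF pU sub])
    also have "\<dots> \<le> \<Prod>(A \<union> B) * \<Prod>(A \<inter> B)"
    proof -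
      have "prime_set (A \<inter> B)" using pS[OF AB(1)] by (rule prime_set_subset) auto
      hence "\<Prod>(A \<inter> B) > 0" by (rule prime_set_prod_pos)
      thus ?thesis by simp
    qed
    also have "\<dots> = \<Prod>A * \<Prod>B" using finS[OF AB(1)] finS[OF AB(2)] by (rule prod.union_inter)
    also have "\<dots> \<le> R * R" using AB(1,2) by (intro mult_mono) (auto simp: sieve_sets_def)
    finally have "\<Prod>(c x) \<le> R\<^sup>2" by (simp add: power2_eq_square)
    thus ?thesis using pc sub AB(1,2) by (auto simp: sieve_sets_def)
  qed
  have b_bound: "\<bar>b C\<bar> \<le> prime_weight C" if C: "prime_set C" for C
  proof -
    let ?X = "{x\<in>\<Omega>. c x = C}"
    \<comment> \<open>For fixed C the set D is what remains of C, so these three components determine the triple.\<close>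
    define h where "h = (\<lambda>(A, B, D). (A - B, B - A, A \<inter> B - D :: nat set))"
    define g where "g = (\<lambda>(P :: nat set, Q :: nat set, K). 1 / (\<phi> C * \<phi> K))"
    have inj: "inj_on h ?X"
    proof (rule inj_onI)
      fix x y assume x: "x \<in> ?X" and y: "y \<in> ?X" and e: "h x = h y"
      obtain A B D where xx: "x = (A, B, D)" by (cases x) auto
      obtain A' B' D' where yy: "y = (A', B', D')" by (cases y) auto
      have D: "D \<subseteq> A \<inter> B" "D' \<subseteq> A' \<inter> B'" using x y by (auto simp: \<Omega>_def xx yy)
      have e1: "A - B = A' - B'" "B - A = B' - A'" "A \<inter> B - D = A' \<inter> B' - D'" using e by (auto simp: h_def xx yy)
      have e2: "(A - B) \<union> (B - A) \<union> D = (A' - B') \<union> (B' - A') \<union> D'" using x y by (simp add: c_def xx yy)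
      have "D = ((A - B) \<union> (B - A) \<union> D) - (A - B) - (B - A)" using D(1) by blast
      also have "\<dots> = D'" unfolding e2 unfolding e1(1,2) using D(2) by blast
      finally have DD: "D = D'" .
      have "A = (A - B) \<union> (A \<inter> B - D) \<union> D" using D(1) by blast
      also have "\<dots> = A'" unfolding e1 unfolding DD using D(2) by blast
      finally have AA: "A = A'" .
      have "B = (B - A) \<union> (A \<inter> B - D) \<union> D" using D(1) by blast
      also have "\<dots> = B'" unfolding e1 unfolding DD using D(2) by blast
      finally show "x = y" using AA DD by (simp add: xx yy)
    qed
    have sub: "h ` ?X \<subseteq> Pow C \<times> Pow C \<times> ?S"
    proof
      fix y assume "y \<in> h ` ?X"
      then obtain A B D where x: "(A, B, D) \<in> ?X" "y = h (A, B, D)" by auto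
      have A: "A \<in> ?S" using x by (auto simp: \<Omega>_def)
      have pK: "prime_set (A \<inter> B - D)" using pS[OF A] by (rule prime_set_subset) auto
      have "\<Prod>(A \<inter> B - D) \<le> \<Prod>A" using pS[OF A] by (rule prime_set_prod_subset_le) auto
      hence "A \<inter> B - D \<in> ?S" using A pK by (auto simp: sieve_sets_def)
      thus "y \<in> Pow C \<times> Pow C \<times> ?S" using x by (auto simp: h_def c_def)
    qed
    have u_le: "\<bar>u x\<bar> \<le> g (h x)" if x: "x \<in> ?X" for x
    proof -
      obtain A B D where xx: "x = (A, B, D)" by (cases x) auto
      have AB: "A \<in> ?S" "B \<in> ?S" "D \<subseteq> A \<inter> B" using x by (auto simp: \<Omega>_def xx)
      have CC: "C = (A - B) \<union> (B - A) \<union> D" using x by (simp add: c_def xx)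
      note f = finS[OF AB(1)] finS[OF AB(2)]
      define K where "K = A \<inter> B - D"
      have fD: "finite D" using AB(3) f by (meson finite_Int finite_subset)
      have phi_un: "\<phi> (P \<union> Q) = \<phi> P * \<phi> Q" if "finite P" "finite Q" "P \<inter> Q = {}" for P Q
        unfolding \<phi>_def by (rule prod.union_disjoint[OF that])
      have pA: "\<phi> A = \<phi> (A - B) * \<phi> D * \<phi> K"
      proof -
        have "A = ((A - B) \<union> D) \<union> K" using AB(3) by (auto simp: K_def)
        hence "\<phi> A = \<phi> (((A - B) \<union> D) \<union> K)" by (rule arg_cong)
        also have "\<dots> = \<phi> ((A - B) \<union> D) * \<phi> K" using f fD by (intro phi_un) (auto simp: K_def)
        also have "\<phi> ((A - B) \<union> D) = \<phi> (A - B) * \<phi> D" using f fD AB(3) by (intro phi_un) auto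
        finally show ?thesis .
      qed
      have pB: "\<phi> B = \<phi> (B - A) * \<phi> D * \<phi> K"
      proof -
        have "B = ((B - A) \<union> D) \<union> K" using AB(3) by (auto simp: K_def)
        hence "\<phi> B = \<phi> (((B - A) \<union> D) \<union> K)" by (rule arg_cong)
        also have "\<dots> = \<phi> ((B - A) \<union> D) * \<phi> K" using f fD by (intro phi_un) (auto simp: K_def)
        also have "\<phi> ((B - A) \<union> D) = \<phi> (B - A) * \<phi> D" using f fD AB(3) by (intro phi_un) auto
        finally show ?thesis .
      qed
      have pCC: "\<phi> C = \<phi> (A - B) * \<phi> (B - A) * \<phi> D"
      proof -
        have "\<phi> C = \<phi> ((A - B) \<union> (B - A)) * \<phi> D" unfolding CC using f fD AB(3) by (intro phi_un) auto
        also have "\<phi> ((A - B) \<union> (B - A)) = \<phi> (A - B) * \<phi> (B - A)" using f by (intro phi_un) auto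
        finally show ?thesis .
      qed
      have pr: "prime_set P" if "P \<subseteq> A \<union> B" for P
        using prime_set_subset[OF _ that] pS[OF AB(1)] pS[OF AB(2)] by (auto simp: prime_set_def)
      have pos: "\<phi> (A - B) \<ge> 1" "\<phi> (B - A) \<ge> 1" "\<phi> D \<ge> 1" "\<phi> K \<ge> 1"
        using AB(3) by (auto intro!: phi1 pr simp: K_def)
      have psi: "0 \<le> \<psi> D" "\<psi> D \<le> \<phi> D"
      proof -
        have "prime_set D" using AB(3) by (intro pr) auto
        hence r: "real p \<ge> 2" if "p \<in> D" for p using prime_set_minus_one_ge[of D p] that by simp
        show "0 \<le> \<psi> D" unfolding \<psi>_def using r by (intro prod_nonneg) auto
        show "\<psi> D \<le> \<phi> D" unfolding \<psi>_def \<phi>_def using r by (intro prod_mono) auto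
      qed
      have "\<bar>u x\<bar> = \<psi> D * \<phi> K / (\<phi> A * \<phi> B)"
      proof -
        have "u x = (-1) ^ card A / \<phi> A * ((-1) ^ card B / \<phi> B) * (\<psi> D * \<phi> K)" by (simp add: u_def xx K_def)
        moreover have "\<phi> A \<ge> 1" "\<phi> B \<ge> 1" using AB(1,2) by (auto intro: phi1 pS)
        ultimately show ?thesis using psi pos by (simp add: abs_mult power_abs)
      qed
      also have "\<dots> \<le> \<phi> D * \<phi> K / (\<phi> A * \<phi> B)"
        using psi pos unfolding pA pB by (intro divide_right_mono mult_right_mono) auto
      also have "\<dots> = 1 / (\<phi> C * \<phi> K)" unfolding pA pB pCC using pos by (simp add: field_simps)
      also have "\<dots> = g (h x)" by (simp add: g_def h_def xx K_def)
      finally show ?thesis .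
    qed
    have "\<bar>\<Sum>x\<in>?X. u x\<bar> \<le> (\<Sum>x\<in>?X. g (h x))" by (intro order_trans[OF sum_abs] sum_mono u_le)
    also have "\<dots> = (\<Sum>y\<in>h ` ?X. g y)" by (simp add: sum.reindex[OF inj])
    also have "\<dots> \<le> (\<Sum>y\<in>Pow C \<times> Pow C \<times> ?S. g y)"
    proof (rule sum_mono2[OF _ sub])
      show "finite (Pow C \<times> Pow C \<times> ?S)" using prime_set_finite[OF C] sieve_sets_finite by simp
      fix y assume y: "y \<in> Pow C \<times> Pow C \<times> ?S - h ` ?X"
      thus "0 \<le> g y" using phi1[OF C] phi1[OF pS] by (auto simp: g_def intro!: divide_nonneg_nonneg mult_nonneg_nonneg intro: order_trans[OF zero_le_one])
    qed
    also have "\<dots> = (\<Sum>P\<in>Pow C. \<Sum>Q\<in>Pow C. \<Sum>K\<in>?S. 1 / (\<phi> C * \<phi> K))"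
    proof -
      have sc: "sum k (X \<times> Y) = (\<Sum>x\<in>X. \<Sum>y\<in>Y. k (x, y))" for k :: "'x \<times> 'y \<Rightarrow> real" and X Y
        by (subst sum.cartesian_product) simp
      show ?thesis by (simp add: sc g_def)
    qed
    also have "\<dots> = 2 ^ card C * (2 ^ card C * (?L / \<phi> C))"
      using prime_set_finite[OF C] by (simp add: card_Pow sieve_mass_def \<phi>_def sum_divide_distrib mult.commute)
    also have "\<dots> = prime_weight C * ?L"
      by (simp add: prime_weight_def \<phi>_def flip: power_mult_distrib)
    finally show ?thesis unfolding b_def using L1 by (simp add: divide_le_eq)
  qed
  have b_empty: "b {} = 1"
  proof -
    have X: "{x\<in>\<Omega>. c x = {}} = (\<lambda>A. (A, A, {})) ` ?S" by (auto simp: \<Omega>_def c_def)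
    have "(\<Sum>x\<in>{x\<in>\<Omega>. c x = {}}. u x) = (\<Sum>A\<in>?S. u (A, A, {}))"
      unfolding X by (subst sum.reindex) (auto simp: inj_on_def)
    also have "\<dots> = ?L" unfolding sieve_mass_def
    proof (intro sum.cong refl)
      fix A assume "A \<in> ?S"
      hence "\<phi> A \<ge> 1" by (intro phi1 pS)
      moreover have "(-1::real) ^ card A * (-1) ^ card A = 1" by (simp flip: power_mult_distrib)
      ultimately show "u (A, A, {}) = 1 / totient_prod A"
        by (simp add: u_def \<psi>_def \<phi>_def[symmetric] field_simps)
    qed
    finally show ?thesis using L1 by (simp add: b_def)
  qed
  have "(sieve_fun z R n)\<^sup>2 = ?L * (1 + (\<Sum>C\<in>sieve_sets z (R\<^sup>2) - {{}}. b C * ramanujan_sum C n))" for n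
  proof -
    let ?T = "sieve_sets z (R\<^sup>2)"
    have e: "{} \<in> ?T" using R by (simp add: sieve_sets_def prime_set_def)
    have "(sieve_fun z R n)\<^sup>2 = (\<Sum>C\<in>?T. \<Sum>x\<in>{x\<in>\<Omega>. c x = C}. u x * ramanujan_sum (c x) n)"
      unfolding square by (rule sum.group[symmetric]) (auto simp: fin\<Omega> sieve_sets_finite c_in)
    also have "\<dots> = (\<Sum>C\<in>?T. ?L * (b C * ramanujan_sum C n))"
      using L1 by (intro sum.cong refl) (simp add: b_def sum_distrib_right)
    also have "\<dots> = ?L * (\<Sum>C\<in>?T. b C * ramanujan_sum C n)" by (simp add: sum_distrib_left)
    also have "(\<Sum>C\<in>?T. b C * ramanujan_sum C n) = b {} * ramanujan_sum {} n + (\<Sum>C\<in>?T - {{}}. b C * ramanujan_sum C n)"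
      using e by (rule sum.remove[OF sieve_sets_finite])
    also have "b {} * ramanujan_sum {} n = 1" by (simp add: b_empty ramanujan_sum_def)
    finally show ?thesis .
  qed
  thus ?thesis using b_bound by (intro exI[of _ b]) blast
qed

lemma sieve_fun_eq_mass:
  assumes "\<And>p. prime p \<Longrightarrow> z < real p \<Longrightarrow> p \<le> R \<Longrightarrow> \<not> int p dvd n"
  shows "sieve_fun z R n = sieve_mass z R"
  unfolding sieve_fun_def sieve_mass_def
proof (intro sum.cong refl)
  fix A assume A: "A \<in> sieve_sets z R"
  have pA: "prime_set A" by (rule sieve_sets_prime_set[OF A])
  have "\<not> int p dvd n" if "p \<in> A" for p
  proof -
    have "p dvd \<Prod>A" using pA that by (intro dvd_prodI) (auto simp: prime_set_def)
    hence "p \<le> \<Prod>A" using prime_set_prod_pos[OF pA] by (rule dvd_imp_le)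
    thus ?thesis using A that assms[of p] by (auto simp: sieve_sets_def prime_set_def)
  qed
  hence "ramanujan_sum A n = (\<Prod>p\<in>A. - 1)" unfolding ramanujan_sum_def by (intro prod.cong) auto
  hence "ramanujan_sum A n = (- 1) ^ card A" by simp
  thus "(-1) ^ card A / totient_prod A * ramanujan_sum A n = 1 / totient_prod A"
    by (simp flip: power_mult_distrib)
qed

section \<open>Averages over the primes\<close>

text \<open>
The level of the sieve at scale \<open>2 ^ l\<close> is \<open>R = 2 ^ (l div 48)\<close>, so that every modulus in the square of
the sieve function, being at most \<open>R\<^sup>2\<close>, has its 24th power below the scale. The sum below contains the
moduli of all scales up to \<open>2 ^ m\<close> and therefore dominates the nonconstant part of the majorant
simultaneously for all of them.
\<close>
definition high_part :: "real \<Rightarrow> nat \<Rightarrow> (int \<Rightarrow> real) \<Rightarrow> int \<Rightarrow> real" where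
  "high_part z m f x = (\<Sum>C\<in>sieve_sets z ((2 ^ (m div 48))\<^sup>2) - {{}}.
     prime_weight C * ramanujan_max (scales m (\<Prod>C)) C f x)"

lemma prime_avg_eq: "prime_avg N f x = (\<Sum>n\<in>{1..int N}. mangoldt (nat n) * f (x - n)) / real N"
proof -
  have "(\<Sum>n\<in>{1..N}. f (x - int n) * mangoldt n) = (\<Sum>n\<in>{1..int N}. mangoldt (nat n) * f (x - n))"
    by (rule sum.reindex_bij_witness[of _ nat int]) (auto simp: mult.commute)
  thus ?thesis by (simp add: prime_avg_def)
qed

lemma high_part_ge:
  assumes b: "\<And>C. prime_set C \<Longrightarrow> \<bar>b C\<bar> \<le> prime_weight C" and l: "l \<le> m"
  shows "(\<Sum>C\<in>sieve_sets z ((2 ^ (l div 48))\<^sup>2) - {{}}. b C * weighted_avg (2 ^ l) (ramanujan_sum C) f x) \<le> high_part z m f x"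
proof -
  let ?S = "\<lambda>l. sieve_sets z ((2 ^ (l div 48))\<^sup>2) - {{}}"
  let ?F = "\<lambda>C. prime_weight C * ramanujan_max (scales m (\<Prod>C)) C f x"
  have pS: "prime_set C" if "C \<in> ?S l" for C l using that sieve_sets_prime_set by blast
  have "(\<Sum>C\<in>?S l. b C * weighted_avg (2 ^ l) (ramanujan_sum C) f x) \<le> (\<Sum>C\<in>?S l. ?F C)"
  proof (rule sum_mono)
    fix C assume C: "C \<in> ?S l"
    have "\<Prod>C ^ 24 \<le> ((2 ^ (l div 48))\<^sup>2) ^ 24" using C by (intro power_mono) (auto simp: sieve_sets_def)
    also have "\<dots> = 2 ^ (48 * (l div 48))" by (simp add: mult.commute flip: power_mult)
    also have "\<dots> \<le> 2 ^ l" by (intro power_increasing) auto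
    finally have "2 ^ l \<in> scales m (\<Prod>C)" using l by (auto simp: scales_def)
    hence "\<bar>weighted_avg (2 ^ l) (ramanujan_sum C) f x\<bar> \<le> ramanujan_max (scales m (\<Prod>C)) C f x"
      by (intro max_over_ge[OF scales_finite, of _ _ _ "\<lambda>N. weighted_avg N (ramanujan_sum C) f x"])
    hence "\<bar>b C * weighted_avg (2 ^ l) (ramanujan_sum C) f x\<bar> \<le> ?F C"
      unfolding abs_mult using b[OF pS[OF C]] prime_weight_nonneg[OF pS[OF C]] by (intro mult_mono) auto
    thus "b C * weighted_avg (2 ^ l) (ramanujan_sum C) f x \<le> ?F C" by simp
  qed
  also have "\<dots> \<le> (\<Sum>C\<in>?S m. ?F C)"
  proof (rule sum_mono2)
    have "(2::nat) ^ (l div 48) \<le> 2 ^ (m div 48)" using l by (intro power_increasing div_le_mono) auto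
    hence "((2::nat) ^ (l div 48))\<^sup>2 \<le> (2 ^ (m div 48))\<^sup>2" by (rule power_mono) simp
    thus "?S l \<subseteq> ?S m" unfolding sieve_sets_def by (blast intro: order_trans)
    show "0 \<le> ?F C" if "C \<in> ?S m - ?S l" for C
      using that by (intro mult_nonneg_nonneg max_over_nonneg scales_finite prime_weight_nonneg pS) auto
  qed (simp add: sieve_sets_finite)
  finally show ?thesis unfolding high_part_def .
qed

lemma weighted_avg_mono:
  assumes "\<And>n. n \<in> {1..int N} \<Longrightarrow> k n \<le> k' n" "\<And>x. 0 \<le> f x"
  shows "weighted_avg N k f x \<le> weighted_avg N k' f x"
  unfolding weighted_avg_def using assms by (intro divide_right_mono sum_mono mult_right_mono) auto

lemma prime_avg_conv_weighted_avg: "prime_avg N f x = weighted_avg N (\<lambda>n. mangoldt (nat n)) f x"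
  by (simp add: prime_avg_eq weighted_avg_def)

lemma bad_prime_powers_card:
  assumes "R \<ge> 1"
  shows "card {n\<in>{1..int (2 ^ l)}. \<exists>p i. prime p \<and> p \<le> R \<and> i > 0 \<and> n = int (p ^ i)} \<le> R * l"
proof -
  let ?B = "{n\<in>{1..int (2 ^ l)}. \<exists>p i. prime p \<and> p \<le> R \<and> i > 0 \<and> n = int (p ^ i)}"
  have "?B \<subseteq> (\<lambda>(p, i). int (p ^ i)) ` ({1..R} \<times> {1..l})"
  proof
    fix n assume "n \<in> ?B"
    then obtain p i where pi: "prime p" "p \<le> R" "i > 0" "n = int (p ^ i)" and n: "n \<le> int (2 ^ l)" by auto
    have "2 ^ i \<le> p ^ i" using prime_ge_2_nat[OF pi(1)] by (intro power_mono) auto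
    also have "p ^ i \<le> 2 ^ l" using n pi(4) by (simp only: of_nat_le_iff)
    finally have "i \<le> l" by (simp only: power_increasing_iff[of "2::nat"] one_less_numeral_iff semiring_norm)
    thus "n \<in> (\<lambda>(p, i). int (p ^ i)) ` ({1..R} \<times> {1..l})"
      using pi prime_ge_1_nat[OF pi(1)] by (intro image_eqI[of _ _ "(p, i)"]) auto
  qed
  hence "card ?B \<le> card ((\<lambda>(p, i). int (p ^ i)) ` ({1..R} \<times> {1..l}))" by (intro card_mono) auto
  also have "\<dots> \<le> card ({1..R} \<times> {1..l})" by (rule card_image_le) auto
  finally show ?thesis by simp
qed

text \<open>
On prime powers \<open>p ^ i\<close> where \<open>p\<close> is not a sifting prime, the square of the sieve function divided by the
square of its mass \<open>L\<close> is one, so \<open>ln N\<close> times this quotient majorizes the von Mangoldt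
function there. By \<open>sieve_fun_square\<close> the majorant is \<open>(ln N / L) * (1 + \<dots>)\<close>, with \<open>ln N / L = O(ln z)\<close>
because the sieve has level a power of \<open>N\<close>. Powers of sifting primes are so few that the trivial
bound suffices. If the level \<open>R\<close> is below \<open>z\<close>, then \<open>N\<close> is at most a power of \<open>z\<close> and already
\<open>ln N\<close> is \<open>O(ln z)\<close>.
\<close>
lemma prime_avg_le:
  assumes z: "z \<ge> 2" and f: "\<And>x. 0 \<le> f x" "\<And>x. f x \<le> 1" and l: "l \<le> m"
  shows "prime_avg (2 ^ l) f x \<le> 5000 * ln z * (weighted_avg (2 ^ l) (\<lambda>_. 1) f x + high_part z m f x + 1 / z)"
proof -
  define N :: nat where "N = 2 ^ l"
  define r where "r = l div 48"
  define R :: nat where "R = 2 ^ r"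
  let ?a = "weighted_avg N (\<lambda>_. 1) f x"
  have N0: "N > 0" by (simp add: N_def)
  have R1: "R \<ge> 1" by (simp add: R_def)
  have a0: "?a \<ge> 0" unfolding weighted_avg_def using f by (intro divide_nonneg_nonneg sum_nonneg) auto
  have lnz: "ln z \<ge> 1 / 2"
  proof -
    have "ln z \<ge> ln 2" using z by simp
    thus ?thesis using ln2_ge_two_thirds by simp
  qed
  have h0: "high_part z m f x \<ge> 0"
    unfolding high_part_def using sieve_sets_prime_set
    by (intro sum_nonneg mult_nonneg_nonneg max_over_nonneg scales_finite prime_weight_nonneg) blast+
  have lnN: "ln (real N) = real l * ln 2" by (simp add: N_def ln_realpow)
  have mang: "mangoldt (nat n) \<le> ln (real N)" if "n \<in> {1..int N}" for n
  proof -
    have "mangoldt (nat n) \<le> ln (real (nat n))" using that by (intro mangoldt_le) auto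
    also have "\<dots> \<le> ln (real N)" using that by (subst ln_le_cancel_iff) auto
    finally show ?thesis .
  qed
  have lr: "real l \<le> 48 * real r + 47"
  proof -
    have "l = 48 * r + l mod 48" by (simp add: r_def)
    moreover have "l mod 48 < 48" by simp
    ultimately have "l \<le> 48 * r + 47" by linarith
    thus ?thesis by linarith
  qed
  show ?thesis
  proof (cases "real R < z")
    case True
    have "real r * ln 2 = ln (real R)" by (simp add: R_def ln_realpow)
    also have "\<dots> \<le> ln z" using True R1 by (subst ln_le_cancel_iff) auto
    finally have rz: "real r * ln 2 \<le> ln z" .
    have "real l * ln 2 \<le> (48 * real r + 47) * ln 2" using lr by (intro mult_right_mono) auto
    also have "\<dots> \<le> 48 * ln z + 47 * ln 2" using rz by (simp add: algebra_simps)
    also have "\<dots> \<le> 48 * ln z + 47 * ln z" using z by simp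
    finally have N95: "ln (real N) \<le> 95 * ln z" by (simp add: lnN)
    have "prime_avg N f x \<le> weighted_avg N (\<lambda>_. ln (real N)) f x"
      unfolding prime_avg_conv_weighted_avg using mang f by (intro weighted_avg_mono) auto
    also have "\<dots> = ln (real N) * ?a" by (simp add: weighted_avg_def sum_distrib_left)
    also have "\<dots> \<le> (95 * ln z) * ?a" using N95 a0 by (rule mult_right_mono)
    also have "\<dots> \<le> (5000 * ln z) * ?a" using lnz a0 by (intro mult_right_mono) auto
    also have "\<dots> \<le> (5000 * ln z) * (?a + high_part z m f x + 1 / z)" using lnz h0 z by (intro mult_left_mono) auto
    finally show ?thesis by (simp add: N_def)
  next
    case False
    hence Rz: "real R \<ge> z" by simp
    have r1: "r \<ge> 1" using Rz z by (cases r) (auto simp: R_def)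
    let ?L = "sieve_mass z R"
    have L1: "?L \<ge> 1" by (rule sieve_mass_ge_1[OF R1])
    obtain b where b: "\<And>C. prime_set C \<Longrightarrow> \<bar>b C\<bar> \<le> prime_weight C"
      and sq: "\<And>n. (sieve_fun z R n)\<^sup>2 = ?L * (1 + (\<Sum>C\<in>sieve_sets z (R\<^sup>2) - {{}}. b C * ramanujan_sum C n))"
      using sieve_fun_square[OF R1, of z] by blast
    define bad where "bad n = (if \<exists>p i. prime p \<and> p \<le> R \<and> i > 0 \<and> n = int (p ^ i) then 1 else 0 :: real)" for n
    have major: "mangoldt (nat n) \<le> ln (real N) * ((sieve_fun z R n)\<^sup>2 / ?L\<^sup>2 + bad n)" if n: "n \<in> {1..int N}" for n
    proof (cases "primepow (nat n)")
      case True
      then obtain p i where pi: "prime p" "i > 0" "nat n = p ^ i" by (auto simp: primepow_def)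
      have n': "n = int (p ^ i)" unfolding pi(3)[symmetric] using n by simp
      have "1 \<le> (sieve_fun z R n)\<^sup>2 / ?L\<^sup>2 + bad n"
      proof (cases "p \<le> R")
        case True
        hence "bad n = 1" using pi n' by (auto simp: bad_def)
        thus ?thesis by simp
      next
        case False
        have "sieve_fun z R n = ?L"
        proof (rule sieve_fun_eq_mass)
          fix p' assume p': "prime p'" "p' \<le> R"
          show "\<not> int p' dvd n"
          proof
            assume "int p' dvd n"
            hence "p' dvd p ^ i" unfolding n' by (simp only: of_nat_dvd_iff)
            hence "p' dvd p" using p'(1) prime_dvd_power by blast
            hence "p' = p" using p'(1) pi(1) primes_dvd_imp_eq by blast
            thus False using p' False by simp
          qed
        qed
        thus ?thesis using L1 by (simp add: bad_def)
      qed
      hence "ln (real N) * 1 \<le> ln (real N) * ((sieve_fun z R n)\<^sup>2 / ?L\<^sup>2 + bad n)"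
        using N0 by (intro mult_left_mono) auto
      thus ?thesis using mang[OF n] by simp
    next
      case False
      hence "mangoldt (nat n) = (0::real)" by (simp add: mangoldt_def)
      moreover have "0 \<le> ln (real N) * ((sieve_fun z R n)\<^sup>2 / ?L\<^sup>2 + bad n)"
        using N0 by (intro mult_nonneg_nonneg add_nonneg_nonneg) (auto simp: bad_def)
      ultimately show ?thesis by simp
    qed
    have "prime_avg N f x \<le> weighted_avg N (\<lambda>n. ln (real N) * ((sieve_fun z R n)\<^sup>2 / ?L\<^sup>2 + bad n)) f x"
      unfolding prime_avg_conv_weighted_avg using major f by (intro weighted_avg_mono) auto
    also have "\<dots> = ln (real N) * weighted_avg N (\<lambda>n. (sieve_fun z R n)\<^sup>2 / ?L\<^sup>2) f x + ln (real N) * weighted_avg N bad f x"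
      by (simp add: weighted_avg_def sum.distrib sum_distrib_left algebra_simps add_divide_distrib)
    also have "weighted_avg N (\<lambda>n. (sieve_fun z R n)\<^sup>2 / ?L\<^sup>2) f x
        = (?a + (\<Sum>C\<in>sieve_sets z (R\<^sup>2) - {{}}. b C * weighted_avg N (ramanujan_sum C) f x)) / ?L"
    proof -
      have "(\<Sum>n\<in>{1..int N}. (sieve_fun z R n)\<^sup>2 / ?L\<^sup>2 * f (x - n)) =
         (\<Sum>n\<in>{1..int N}. (1 * f (x - n) + (\<Sum>C\<in>sieve_sets z (R\<^sup>2) - {{}}. b C * (ramanujan_sum C n * f (x - n)))) / ?L)"
        unfolding sq using L1 by (intro sum.cong refl) (simp add: power2_eq_square field_simps sum_distrib_left sum_distrib_right)
      also have "\<dots> = ((\<Sum>n\<in>{1..int N}. 1 * f (x - n)) + (\<Sum>n\<in>{1..int N}. \<Sum>C\<in>sieve_sets z (R\<^sup>2) - {{}}. b C * (ramanujan_sum C n * f (x - n)))) / ?L"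
        by (simp add: sum.distrib flip: sum_divide_distrib)
      also have "(\<Sum>n\<in>{1..int N}. \<Sum>C\<in>sieve_sets z (R\<^sup>2) - {{}}. b C * (ramanujan_sum C n * f (x - n)))
         = (\<Sum>C\<in>sieve_sets z (R\<^sup>2) - {{}}. b C * (\<Sum>n\<in>{1..int N}. ramanujan_sum C n * f (x - n)))"
        by (subst sum.swap) (simp add: sum_distrib_left)
      finally have "weighted_avg N (\<lambda>n. (sieve_fun z R n)\<^sup>2 / ?L\<^sup>2) f x = ((\<Sum>n\<in>{1..int N}. 1 * f (x - n))
         + (\<Sum>C\<in>sieve_sets z (R\<^sup>2) - {{}}. b C * (\<Sum>n\<in>{1..int N}. ramanujan_sum C n * f (x - n)))) / ?L / real N"
        by (simp only: weighted_avg_def)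
      also have "\<dots> = ((\<Sum>n\<in>{1..int N}. 1 * f (x - n)) / real N
         + (\<Sum>C\<in>sieve_sets z (R\<^sup>2) - {{}}. b C * (\<Sum>n\<in>{1..int N}. ramanujan_sum C n * f (x - n))) / real N) / ?L"
        by (simp add: add_divide_distrib mult.commute)
      also have "(\<Sum>C\<in>sieve_sets z (R\<^sup>2) - {{}}. b C * (\<Sum>n\<in>{1..int N}. ramanujan_sum C n * f (x - n))) / real N
          = (\<Sum>C\<in>sieve_sets z (R\<^sup>2) - {{}}. b C * ((\<Sum>n\<in>{1..int N}. ramanujan_sum C n * f (x - n)) / real N))"
        by (subst sum_divide_distrib) simp
      finally show ?thesis by (simp only: weighted_avg_def)
    qed
    also have "ln (real N) * ((?a + (\<Sum>C\<in>sieve_sets z (R\<^sup>2) - {{}}. b C * weighted_avg N (ramanujan_sum C) f x)) / ?L)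
      \<le> ln (real N) * ((?a + high_part z m f x) / ?L)"
    proof (intro mult_left_mono divide_right_mono add_left_mono)
      show "(\<Sum>C\<in>sieve_sets z (R\<^sup>2) - {{}}. b C * weighted_avg N (ramanujan_sum C) f x) \<le> high_part z m f x"
        unfolding N_def R_def r_def by (rule high_part_ge[OF b l])
    qed (use L1 N0 in auto)
    also have "ln (real N) * ((?a + high_part z m f x) / ?L) \<le> 1900 * ln z * (?a + high_part z m f x)"
    proof -
      have lnR: "ln (real R) = real r * ln 2" by (simp add: R_def ln_realpow)
      have "real l \<le> 95 * real r" using lr r1 by linarith
      hence "ln (real N) \<le> 95 * ln (real R)" unfolding lnN lnR using mult_right_mono[of "real l" "95 * real r" "ln 2"] by simp
      also have "\<dots> \<le> 95 * (20 * ln z * ?L)" using sieve_mass_ge[OF z R1] by simp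
      finally have "ln (real N) / ?L \<le> 1900 * ln z" using L1 by (simp add: divide_le_eq)
      hence "ln (real N) / ?L * (?a + high_part z m f x) \<le> 1900 * ln z * (?a + high_part z m f x)"
        using a0 h0 by (intro mult_right_mono) auto
      thus ?thesis by simp
    qed
    also have "ln (real N) * weighted_avg N bad f x \<le> 2304 / z"
    proof -
      have "(\<Sum>n\<in>{1..int N}. bad n * f (x - n)) \<le> (\<Sum>n\<in>{1..int N}. bad n)"
        using f(2) by (intro sum_mono) (auto simp: bad_def)
      also have "\<dots> = real (card {n\<in>{1..int N}. \<exists>p i. prime p \<and> p \<le> R \<and> i > 0 \<and> n = int (p ^ i)})"
        unfolding bad_def by (simp add: sum.If_cases Int_def)
      also have "\<dots> \<le> real (R * l)" unfolding N_def using bad_prime_powers_card[OF R1] by (simp only: of_nat_le_iff)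
      finally have "weighted_avg N bad f x \<le> real (R * l) / real N"
        unfolding weighted_avg_def by (intro divide_right_mono) auto
      moreover have "ln (real N) \<le> real l" unfolding lnN using ln2_le_25_over_36 by (intro mult_left_le) auto
      ultimately have "ln (real N) * weighted_avg N bad f x \<le> real l * (real (R * l) / real N)"
        using N0 f(1) by (intro mult_mono) (auto simp: weighted_avg_def bad_def intro!: divide_nonneg_nonneg sum_nonneg)
      also have "real l \<le> 48 * 2 ^ r"
      proof -
        have "r < 2 ^ r" by simp
        hence "r + 1 \<le> 2 ^ r" by linarith
        hence "real (r + 1) \<le> real (2 ^ r)" by (simp only: of_nat_le_iff)
        thus ?thesis using lr by simp
      qed
      hence "real l * (real (R * l) / real N) \<le> (48 * 2 ^ r) * (2 ^ r * (48 * 2 ^ r) / 2 ^ (48 * r))"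
      proof (intro mult_mono frac_le)
        have "48 * r \<le> l" by (simp add: r_def)
        thus "2 ^ (48 * r) \<le> real N" by (simp add: N_def power_increasing)
        show "real (R * l) \<le> 2 ^ r * (48 * 2 ^ r)" using \<open>real l \<le> 48 * 2 ^ r\<close> by (simp add: R_def)
      qed (use \<open>real l \<le> 48 * 2 ^ r\<close> in auto)
      also have "\<dots> = 2304 * (2 ^ (3 * r) / 2 ^ (48 * r))" 
      proof -
        have "(2::real) ^ (3 * r) = 2 ^ r * 2 ^ r * 2 ^ r" by (simp flip: power_add)
        thus ?thesis by simp
      qed
      also have "\<dots> \<le> 2304 * (1 / 2 ^ r)"
      proof -
        have "(2::real) ^ (3 * r) * 2 ^ r \<le> 2 ^ (48 * r)" unfolding power_add[symmetric] by (intro power_increasing) auto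
        thus ?thesis by (simp add: divide_simps mult.commute)
      qed
      also have "\<dots> \<le> 2304 * (1 / z)" using Rz z by (intro mult_left_mono divide_left_mono) (auto simp: R_def)
      finally show ?thesis by simp
    qed
    finally have "prime_avg N f x \<le> 1900 * ln z * (?a + high_part z m f x) + 2304 / z" by simp
    also have "2304 / z \<le> 5000 * ln z * (1 / z)"
    proof -
      have "2304 * (1 / z) \<le> (5000 * ln z) * (1 / z)" using lnz z by (intro mult_right_mono) auto
      thus ?thesis by simp
    qed
    also have "1900 * ln z * (?a + high_part z m f x) \<le> 5000 * ln z * (?a + high_part z m f x)"
      using lnz a0 h0 by (intro mult_right_mono) auto
    finally show ?thesis by (simp add: N_def algebra_simps)
  qed
qed

text \<open>
The scale may depend on the point, so this is a bound for a maximal function. The constant term of the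
majorant costs \<open>ln z\<close> times an ordinary average, which is controlled by \<open>\<alpha>\<close>; the remaining terms
are small in mean square.
\<close>
lemma prime_avg_linearized:
  "\<exists>K>0. \<forall>(F :: int set) X l z \<alpha>. finite F \<longrightarrow> finite X \<longrightarrow> z \<ge> 2 \<longrightarrow>
     (\<forall>x\<in>X. weighted_avg (2 ^ l x) (\<lambda>_. 1) (indicator F) x \<le> \<alpha>) \<longrightarrow>
     (\<Sum>x\<in>X. prime_avg (2 ^ l x) (indicator F) x)
       \<le> K * ln z * (\<alpha> * real (card X) + z powr (-(1/4)) * (sqrt (real (card X)) * sqrt (real (card F))) + real (card X) / z)"
proof -
  from ramanujan_high_maximal obtain K where K: "K > 0" and K_high: "\<forall>\<C> z m f B. finite \<C> \<longrightarrow> z \<ge> 2 \<longrightarrow> (\<forall>C\<in>\<C>. prime_set C \<and> z < real (\<Prod>C)) \<longrightarrow>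
     l2_bounded f B \<longrightarrow> finite {x. f x \<noteq> 0} \<longrightarrow>
     l2_bounded (\<lambda>x. \<Sum>C\<in>\<C>. prime_weight C * ramanujan_max (scales m (\<Prod>C)) C f x)
       (K * z powr (-(1/4)) * B)"
    by (elim exE conjE)
  define K2 where "K2 = 5000 * (K + 1)"
  have K2: "K2 > 0" using K by (simp add: K2_def)
  show ?thesis
  proof (intro exI[of _ K2] conjI allI impI K2)
    fix F X :: "int set" and l :: "int \<Rightarrow> nat" and z \<alpha> :: real
    assume F: "finite F" and X: "finite X" and z: "z \<ge> 2"
      and \<alpha>: "\<forall>x\<in>X. weighted_avg (2 ^ l x) (\<lambda>_. 1) (indicator F) x \<le> \<alpha>"
    define f :: "int \<Rightarrow> real" where "f = indicator F"
    define m where "m = Max (insert 0 (l ` X))"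
    have lm: "l x \<le> m" if "x \<in> X" for x unfolding m_def using X that by (intro Max_ge) auto
    have lnz: "ln z \<ge> 0" using z by simp
    have l2f: "l2_bounded f (sqrt (real (card F)))"
      unfolding l2_bounded_def
    proof (intro allI impI)
      fix Y :: "int set" assume Y: "finite Y"
      have "(\<Sum>x\<in>Y. (f x)\<^sup>2) = (\<Sum>x\<in>Y. if x \<in> F then 1 else 0)" by (intro sum.cong) (auto simp: f_def)
      also have "\<dots> = real (card (Y \<inter> F))" using Y by (simp add: sum.If_cases)
      also have "\<dots> \<le> real (card F)" using F by (simp add: card_mono)
      finally show "L2_set f Y \<le> sqrt (real (card F))" by (simp add: L2_set_def)
    qed
    have suppf: "finite {x. f x \<noteq> 0}" using F by (simp add: f_def indicator_def)
    have l2h: "l2_bounded (high_part z m f) (K * z powr (-(1/4)) * sqrt (real (card F)))"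
      unfolding high_part_def
    proof (rule K_high[rule_format, OF _ z _ l2f suppf])
      show "finite (sieve_sets z ((2 ^ (m div 48))\<^sup>2) - {{}})" by (simp add: sieve_sets_finite)
      fix C assume C: "C \<in> sieve_sets z ((2 ^ (m div 48))\<^sup>2) - {{}}"
      hence pC: "prime_set C" using sieve_sets_prime_set by blast
      obtain p where p: "p \<in> C" using C by auto
      have "p dvd \<Prod>C" using pC p by (intro dvd_prodI) (auto simp: prime_set_def)
      hence "p \<le> \<Prod>C" using prime_set_prod_pos[OF pC] by (rule dvd_imp_le)
      hence "real p \<le> real (\<Prod>C)" by (simp only: of_nat_le_iff)
      moreover have "z < real p" using C p by (auto simp: sieve_sets_def)
      ultimately show "prime_set C \<and> z < real (\<Prod>C)" using pC by linarith
    qed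
    have "(\<Sum>x\<in>X. prime_avg (2 ^ l x) f x) \<le> (\<Sum>x\<in>X. 5000 * ln z * (\<alpha> + high_part z m f x + 1 / z))"
    proof (rule sum_mono)
      fix x assume x: "x \<in> X"
      have "prime_avg (2 ^ l x) f x \<le> 5000 * ln z * (weighted_avg (2 ^ l x) (\<lambda>_. 1) f x + high_part z m f x + 1 / z)"
        using lm[OF x] by (intro prime_avg_le z) (auto simp: f_def)
      also have "\<dots> \<le> 5000 * ln z * (\<alpha> + high_part z m f x + 1 / z)"
        using \<alpha> x lnz by (intro mult_left_mono add_right_mono) (auto simp: f_def)
      finally show "prime_avg (2 ^ l x) f x \<le> 5000 * ln z * (\<alpha> + high_part z m f x + 1 / z)" .
    qed
    also have "\<dots> = 5000 * ln z * (\<alpha> * real (card X) + (\<Sum>x\<in>X. high_part z m f x) + real (card X) / z)"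
      unfolding sum_distrib_left[symmetric] by (simp add: sum.distrib mult.commute)
    also have "(\<Sum>x\<in>X. high_part z m f x) \<le> (\<Sum>x\<in>X. \<bar>1\<bar> * \<bar>high_part z m f x\<bar>)" by (intro sum_mono) simp
    also have "\<dots> \<le> L2_set (\<lambda>_. 1) X * L2_set (high_part z m f) X" by (rule L2_set_mult_ineq)
    also have "\<dots> \<le> sqrt (real (card X)) * (K * z powr (-(1/4)) * sqrt (real (card F)))"
      using l2_boundedD[OF l2h, of X] by (simp add: L2_set_def mult_left_mono)
    also have "\<dots> = K * (z powr (-(1/4)) * (sqrt (real (card X)) * sqrt (real (card F))))" by simp
    finally have s: "(\<Sum>x\<in>X. prime_avg (2 ^ l x) f x) \<le> 5000 * ln z * (\<alpha> * real (card X) + K * (z powr (-(1/4)) * (sqrt (real (card X)) * sqrt (real (card F)))) + real (card X) / z)"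
      using lnz by (simp add: mult_left_mono)
    have \<alpha>0: "0 \<le> \<alpha> * real (card X)"
    proof (cases "X = {}")
      case False
      then obtain x where x: "x \<in> X" by auto
      have "0 \<le> weighted_avg (2 ^ l x) (\<lambda>_. 1) (indicator F) x"
        unfolding weighted_avg_def by (intro divide_nonneg_nonneg sum_nonneg) auto
      thus ?thesis using \<alpha> x by (intro mult_nonneg_nonneg) (auto intro: order_trans)
    qed simp
    let ?w = "z powr (-(1/4)) * (sqrt (real (card X)) * sqrt (real (card F)))"
    have "0 \<le> K * (\<alpha> * real (card X)) + ?w + K * (real (card X) / z)" using mult_nonneg_nonneg[OF less_imp_le[OF K] \<alpha>0] K z by (intro add_nonneg_nonneg) auto
    hence "\<alpha> * real (card X) + K * ?w + real (card X) / z \<le> (K + 1) * (\<alpha> * real (card X) + ?w + real (card X) / z)"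
      unfolding distrib_left distrib_right by linarith
    hence "5000 * ln z * (\<alpha> * real (card X) + K * ?w + real (card X) / z) \<le> 5000 * ln z * ((K + 1) * (\<alpha> * real (card X) + ?w + real (card X) / z))"
      using lnz by (intro mult_left_mono) auto
    also have "\<dots> = K2 * ln z * (\<alpha> * real (card X) + ?w + real (card X) / z)" by (simp only: K2_def mult_ac)
    finally show "(\<Sum>x\<in>X. prime_avg (2 ^ l x) (indicator F) x) \<le> K2 * ln z * (\<alpha> * real (card X) + ?w + real (card X) / z)"
      using s unfolding f_def by (rule order_trans[rotated])
  qed
qed

section \<open>Dyadic intervals and stopping scales\<close>

definition dyadic :: "nat \<Rightarrow> int \<Rightarrow> int set" where
  "dyadic k m = {x. x div 2 ^ k = m}"

text \<open>
The dyadic interval together with its left neighbour. An average over \<open>{x - 2 ^ k..x - 1}\<close> with \<open>x\<close> in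
the dyadic interval sees only this double interval.
\<close>
definition double_dyadic :: "nat \<Rightarrow> int \<Rightarrow> int set" where
  "double_dyadic k m = {(m - 1) * 2 ^ k..(m + 1) * 2 ^ k - 1}"

lemma dyadic_eq: "dyadic k m = {m * 2 ^ k..(m + 1) * 2 ^ k - 1}"
proof (intro equalityI subsetI)
  fix x assume "x \<in> dyadic k m"
  hence x: "x div 2 ^ k = m" by (simp add: dyadic_def)
  have "x = m * 2 ^ k + x mod 2 ^ k" using x by (metis div_mult_mod_eq)
  moreover have "0 \<le> x mod 2 ^ k" "x mod 2 ^ k < 2 ^ k" by simp_all
  moreover have "(m + 1) * 2 ^ k = m * 2 ^ k + 2 ^ k" by (simp add: distrib_right)
  ultimately show "x \<in> {m * 2 ^ k..(m + 1) * 2 ^ k - 1}" unfolding atLeastAtMost_iff by linarith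
next
  fix x :: int assume x: "x \<in> {m * 2 ^ k..(m + 1) * 2 ^ k - 1}"
  have "x div 2 ^ k = m" using x
    by (intro int_div_pos_eq[of _ _ _ "x - m * 2 ^ k"]) (auto simp: algebra_simps)
  thus "x \<in> dyadic k m" by (simp add: dyadic_def)
qed

lemma dyadic_finite: "finite (dyadic k m)" by (simp add: dyadic_eq)

lemma dyadic_card: "card (dyadic k m) = 2 ^ k"
  by (simp add: dyadic_eq algebra_simps nat_power_eq)

lemma double_dyadic_card: "card (double_dyadic k m) = 2 * 2 ^ k"
proof -
  have "(m + 1) * 2 ^ k - 1 + 1 - (m - 1) * 2 ^ k = (2::int) * 2 ^ k" by (simp add: algebra_simps)
  hence "card (double_dyadic k m) = nat (2 * 2 ^ k)" by (simp add: double_dyadic_def)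
  thus ?thesis by (simp add: nat_mult_distrib nat_power_eq)
qed

lemma dyadic_subset_double: "dyadic k m \<subseteq> double_dyadic k m"
  by (auto simp: dyadic_eq double_dyadic_def algebra_simps intro: order_trans)

lemma double_dyadic_inject:
  assumes "double_dyadic k m = double_dyadic k' m'"
  shows "k = k' \<and> m = m'"
proof -
  have "2 * 2 ^ k = 2 * (2::nat) ^ k'" using assms by (metis double_dyadic_card)
  hence k: "k = k'" by simp
  have "(m - 1) * 2 ^ k \<le> (m + 1) * 2 ^ k - 1" for m :: int
    using one_le_power[of "2::int" k] unfolding left_diff_distrib distrib_right by linarith
  hence "(m - 1) * 2 ^ k = (m' - 1) * 2 ^ k" using assms Icc_eq_Icc unfolding double_dyadic_def k by blast
  thus ?thesis using k by simp
qed

text \<open>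
Two points in the same dyadic interval lie in the same dyadic interval at every coarser scale.
\<close>
lemma div_pow_coarser:
  assumes "x div 2 ^ k = (y::int) div 2 ^ k" "k \<le> j"
  shows "x div 2 ^ j = y div 2 ^ j"
proof -
  have "z div 2 ^ j = z div 2 ^ k div 2 ^ (j - k)" for z :: int
    using assms(2) by (simp add: zdiv_zmult2_eq[symmetric] flip: power_add)
  thus ?thesis using assms(1) by simp
qed

lemma double_dyadic_nested:
  assumes "k \<le> j"
  shows "double_dyadic k (x div 2 ^ k) \<subseteq> double_dyadic j (x div 2 ^ j)"
proof -
  define a where "a = x div 2 ^ k"
  define m where "m = x div 2 ^ j"
  have pos: "(0::int) < 2 ^ k" "(2::int) ^ k \<le> 2 ^ j" using assms by (auto intro: power_increasing)
  obtain i where i: "j = k + i" using assms le_Suc_ex by blast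
  have m: "m = a div 2 ^ i" by (simp add: m_def a_def i power_add zdiv_zmult2_eq)
  have "a \<in> dyadic i m" by (simp add: dyadic_def m)
  hence am: "m * 2 ^ i \<le> a" "a + 1 \<le> (m + 1) * 2 ^ i" by (auto simp: dyadic_eq)
  have "(m - 1) * 2 ^ j \<le> (a - 1) * 2 ^ k"
  proof -
    have "(m - 1) * 2 ^ i \<le> a - 1" using am(1) one_le_power[of "2::int" i] unfolding left_diff_distrib by linarith
    hence "(m - 1) * 2 ^ i * 2 ^ k \<le> (a - 1) * 2 ^ k" by (intro mult_right_mono) auto
    thus ?thesis by (simp add: i power_add mult_ac)
  qed
  moreover have "(a + 1) * 2 ^ k \<le> (m + 1) * 2 ^ j"
  proof -
    have "(a + 1) * 2 ^ k \<le> (m + 1) * 2 ^ i * 2 ^ k" using am(2) by (intro mult_right_mono) auto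
    thus ?thesis by (simp add: i power_add mult_ac)
  qed
  ultimately show ?thesis by (auto simp: double_dyadic_def a_def m_def)
qed

lemma sum_indicator_card:
  assumes "finite A"
  shows "(\<Sum>x\<in>A. indicator W x :: real) = real (card (A \<inter> W))"
proof -
  have "(\<Sum>x\<in>A. indicator W x :: real) = (\<Sum>x\<in>A. if x \<in> W then 1 else 0)" by (intro sum.cong) auto
  thus ?thesis using assms by (simp add: sum.If_cases)
qed

lemma avg_indicator:
  assumes "finite J"
  shows "avg J (indicator F) = real (card (F \<inter> J)) / real (card J)"
  using sum_indicator_card[OF assms, of F] by (simp add: avg_def Int_commute)

definition density :: "int set \<Rightarrow> nat \<Rightarrow> int \<Rightarrow> real" where
  "density F k m = avg (double_dyadic k m) (indicator F)"

lemma density_eq: "density F k m = real (card (F \<inter> double_dyadic k m)) / (2 * 2 ^ k)"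
proof -
  have "finite (double_dyadic k m)" by (simp add: double_dyadic_def)
  thus ?thesis unfolding density_def avg_indicator[OF \<open>finite _\<close>] double_dyadic_card by simp
qed

lemma density_nonneg: "0 \<le> density F k m" by (simp add: density_eq)

lemma density_le_1: "density F k m \<le> 1"
proof -
  have "card (F \<inter> double_dyadic k m) \<le> card (double_dyadic k m)" by (intro card_mono) (auto simp: double_dyadic_def)
  hence "real (card (F \<inter> double_dyadic k m)) \<le> real (2 * 2 ^ k)" unfolding double_dyadic_card by (simp only: of_nat_le_iff)
  thus ?thesis by (simp add: density_eq divide_le_eq)
qed

text \<open>
The scales below \<open>k\<close> at which the density of \<open>F\<close> near \<open>x\<close> is much larger than at scale \<open>k\<close>.
\<close>
definition stopping_scales :: "int set \<Rightarrow> nat \<Rightarrow> int \<Rightarrow> nat set" where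
  "stopping_scales F k x = {j. j < k \<and> density F j (x div 2 ^ j) > 16 * density F k (x div 2 ^ k)}"

text \<open>
The points of a dyadic interval without stopping scales. They form the pairwise disjoint sets that
witness sparseness.
\<close>
definition major_part :: "int set \<Rightarrow> nat \<times> int \<Rightarrow> int set" where
  "major_part F = (\<lambda>(k, m). {x\<in>dyadic k m. stopping_scales F k x = {}})"

lemma stopping_scales_finite: "finite (stopping_scales F k x)"
  by (simp add: stopping_scales_def)

text \<open>
If \<open>j\<close> is a stopping scale of \<open>x\<close>, then the double interval of \<open>x\<close> at scale \<open>j\<close> is covered by a window of
its own length that ends at \<open>x\<close> and one that starts at \<open>x\<close>, so one of the two one-sided averages exceeds
\<open>8 * \<rho>\<close>. By the maximal ergodic inequality for the steps \<open>1\<close> and \<open>-1\<close>, each alternative holds for at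
most an eighth of \<open>2 * 2 ^ k\<close> points. This is where the factor 16 in the stopping rule comes from.
\<close>
lemma stopping_set_card:
  "2 * card {x\<in>dyadic k m. stopping_scales F k x \<noteq> {}} \<le> 2 ^ k"
proof -
  define \<rho> where "\<rho> = density F k m"
  define W where "W = F \<inter> double_dyadic k m"
  define h :: "int \<Rightarrow> real" where "h = indicator W"
  define E where "E d = {x. \<exists>n\<in>{1..2 * 2 ^ k}. (\<Sum>i<n. h (x - d * int i)) > 8 * \<rho> * real n}" for d
  let ?B = "{x\<in>dyadic k m. stopping_scales F k x \<noteq> {}}"
  have finW: "finite W" by (simp add: W_def double_dyadic_def)
  show ?thesis
  proof (cases "\<rho> = 0")
    case True
    hence W0: "W = {}" using finW by (simp add: \<rho>_def density_eq W_def)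
    have "?B = {}"
    proof (rule ccontr)
      assume "?B \<noteq> {}"
      then obtain x j where x: "x \<in> dyadic k m" "j < k" "density F j (x div 2 ^ j) > 16 * density F k (x div 2 ^ k)"
        by (auto simp: stopping_scales_def)
      have "F \<inter> double_dyadic j (x div 2 ^ j) \<subseteq> W"
        using double_dyadic_nested[of j k x] x by (auto simp: W_def dyadic_def)
      hence "density F j (x div 2 ^ j) = 0" using W0 by (simp add: density_eq)
      thus False using x density_nonneg[of F k "x div 2 ^ k"] by simp
    qed
    thus ?thesis by (simp only: card.empty mult_0_right le0)
  next
    case False
    hence \<rho>: "\<rho> > 0" using density_nonneg[of F k m] by (simp add: \<rho>_def)
    have sum_h: "(\<Sum>x\<in>A. h x) \<le> real (card W)" if "finite A" for A
    proof -
      have "(\<Sum>x\<in>A. h x) = real (card (A \<inter> W))" using that by (simp add: h_def sum_indicator_card)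
      thus ?thesis using finW by (simp add: card_mono)
    qed
    have E: "finite (E d)" "4 * real (card (E d)) \<le> 2 ^ k" for d
    proof -
      show fin: "finite (E d)" unfolding E_def using \<rho> finW
        by (intro maximal_ergodic(1)[where W = W]) (auto simp: h_def indicator_def)
      have "8 * \<rho> * real (card (E d)) \<le> (\<Sum>x\<in>E d. h x)" unfolding E_def using \<rho> finW
        by (intro maximal_ergodic(2)[where W = W]) (auto simp: h_def indicator_def)
      also have "\<dots> \<le> real (card W)" by (rule sum_h[OF fin])
      also have "\<dots> = \<rho> * (2 * 2 ^ k)" by (simp add: \<rho>_def density_eq W_def)
      finally have "\<rho> * (4 * real (card (E d))) \<le> \<rho> * 2 ^ k" by simp
      thus "4 * real (card (E d)) \<le> 2 ^ k" using \<rho> by (rule mult_left_le_imp_le)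
    qed
    have "?B \<subseteq> E 1 \<union> E (- 1)"
    proof
      fix x assume "x \<in> ?B"
      then obtain j where xm: "x div 2 ^ k = m" and j: "j < k" "density F j (x div 2 ^ j) > 16 * \<rho>"
        by (auto simp: stopping_scales_def dyadic_def \<rho>_def)
      define n :: nat where "n = 2 * 2 ^ j"
      let ?D = "double_dyadic j (x div 2 ^ j)"
      have finD: "finite ?D" by (simp add: double_dyadic_def)
      have FW: "F \<inter> ?D \<subseteq> W" using double_dyadic_nested[of j k x] j(1) xm by (auto simp: W_def)
      have "x \<in> dyadic j (x div 2 ^ j)" by (simp add: dyadic_def)
      hence xb: "(x div 2 ^ j) * 2 ^ j \<le> x" "x \<le> (x div 2 ^ j + 1) * 2 ^ j - 1" by (auto simp: dyadic_eq)
      have cov: "?D \<subseteq> (\<lambda>i. x - 1 * int i) ` {..<n} \<union> (\<lambda>i. x - (- 1) * int i) ` {..<n}"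
      proof
        fix y assume y: "y \<in> ?D"
        have b: "(x div 2 ^ j - 1) * 2 ^ j \<le> y" "y \<le> (x div 2 ^ j + 1) * 2 ^ j - 1" using y by (auto simp: double_dyadic_def)
        have "x - y < int n" "y - x < int n" using b xb unfolding n_def by (simp_all add: algebra_simps)
        thus "y \<in> (\<lambda>i. x - 1 * int i) ` {..<n} \<union> (\<lambda>i. x - (- 1) * int i) ` {..<n}"
        proof (cases "y \<le> x")
          case True
          hence "y = x - 1 * int (nat (x - y))" "nat (x - y) < n" using \<open>x - y < int n\<close> by auto
          thus ?thesis by blast
        next
          case False
          hence "y = x - (- 1) * int (nat (y - x))" "nat (y - x) < n" using \<open>y - x < int n\<close> by auto
          thus ?thesis by blast
        qed
      qed
      have h0: "h y \<ge> 0" for y by (simp add: h_def)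
      have "real (card (F \<inter> ?D)) = (\<Sum>y\<in>F \<inter> ?D. h y)" using FW by (simp add: h_def indicator_def subset_iff)
      also have "\<dots> \<le> (\<Sum>y\<in>(\<lambda>i. x - 1 * int i) ` {..<n} \<union> (\<lambda>i. x - (- 1) * int i) ` {..<n}. h y)"
        using cov h0 by (intro sum_mono2) auto
      also have "\<dots> \<le> (\<Sum>y\<in>(\<lambda>i. x - 1 * int i) ` {..<n}. h y) + (\<Sum>y\<in>(\<lambda>i. x - (- 1) * int i) ` {..<n}. h y)"
        using h0 by (subst sum.union_inter[symmetric]) (auto intro!: sum_nonneg)
      also have "\<dots> = (\<Sum>i<n. h (x - 1 * int i)) + (\<Sum>i<n. h (x - (- 1) * int i))"
        by (simp add: sum.reindex inj_on_def)
      finally have c: "real (card (F \<inter> ?D)) \<le> (\<Sum>i<n. h (x - 1 * int i)) + (\<Sum>i<n. h (x - (- 1) * int i))" .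
      have "16 * \<rho> * real n < real (card (F \<inter> ?D))" using j(2) by (simp add: density_eq n_def field_simps)
      hence "8 * \<rho> * real n < (\<Sum>i<n. h (x - 1 * int i)) \<or> 8 * \<rho> * real n < (\<Sum>i<n. h (x - (- 1) * int i))"
        using c by linarith
      moreover have "n \<in> {1..2 * 2 ^ k}" using j(1) by (auto simp: n_def intro: power_increasing)
      ultimately show "x \<in> E 1 \<union> E (- 1)" unfolding E_def by blast
    qed
    hence "card ?B \<le> card (E 1 \<union> E (- 1))" using E(1) by (intro card_mono) auto
    also have "\<dots> \<le> card (E 1) + card (E (- 1))" by (rule card_Un_le)
    finally have "real (card ?B) \<le> real (card (E 1)) + real (card (E (- 1)))" by linarith
    hence "2 * real (card ?B) \<le> 2 ^ k" using E(2)[of 1] E(2)[of "- 1"] by linarith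
    hence "real (2 * card ?B) \<le> real (2 ^ k)" by simp
    thus ?thesis by (simp only: of_nat_le_iff)
  qed
qed

text \<open>
The double interval has twice the length of the dyadic interval, of which at least half is kept.
\<close>
lemma major_part_card: "card (double_dyadic k m) \<le> 4 * card (major_part F (k, m))"
proof -
  let ?B = "{x\<in>dyadic k m. stopping_scales F k x \<noteq> {}}"
  have "card (dyadic k m) = card (major_part F (k, m)) + card ?B"
    using dyadic_finite[of k m] by (subst card_Un_disjoint[symmetric]) (auto simp: major_part_def intro!: arg_cong[where f = card])
  thus ?thesis using stopping_set_card[of k m F] unfolding dyadic_card double_dyadic_card by linarith
qed

definition sparse_term :: "int set \<Rightarrow> int set \<Rightarrow> nat \<times> int \<Rightarrow> real" where
  "sparse_term F G = (\<lambda>(k, m). let \<delta> = density F k m * density G k m in \<delta> * Log \<delta> * (2 * 2 ^ k))"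

lemma sparse_term_nonneg: "0 \<le> sparse_term F G p"
  by (cases p) (auto simp: sparse_term_def Let_def Log_def density_nonneg intro!: mult_nonneg_nonneg)

lemma prime_avg_nonneg: "(\<And>y. 0 \<le> f y) \<Longrightarrow> 0 \<le> prime_avg N f x"
  unfolding prime_avg_def by (intro mult_nonneg_nonneg sum_nonneg) (auto simp: mangoldt_nonneg)

lemma dyadic_shift_in_double:
  assumes "x \<in> dyadic k m" "1 \<le> n" "n \<le> 2 ^ j" "j \<le> k"
  shows "x - n \<in> double_dyadic k m"
proof -
  have "(2::int) ^ j \<le> 2 ^ k" using assms(4) by (rule power_increasing) simp
  hence "n \<le> 2 ^ k" using assms(3) by linarith
  thus ?thesis using assms(1,2) by (auto simp: dyadic_eq double_dyadic_def algebra_simps)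
qed

text \<open>
The contribution of a single interval, when each point uses a scale at which the density of \<open>F\<close> is not
much larger than on the interval. With \<open>\<delta>\<close> the product of the two densities, the sieve parameter
\<open>z = 2 / \<delta>\<^sup>2\<close> makes \<open>z powr (-(1/4))\<close> at most \<open>sqrt \<delta>\<close>; this brings the mean square error, which is
proportional to \<open>sqrt \<delta>\<close>, down to the size of the main term, and \<open>ln z\<close> is \<open>O(Log \<delta>)\<close>.
\<close>
lemma admissible_sum_le:
  "\<exists>K>0. \<forall>F G k m l. finite F \<longrightarrow> finite G \<longrightarrow>
     (\<forall>x\<in>G \<inter> dyadic k m. l x \<le> k \<and> density F (l x) (x div 2 ^ l x) \<le> 16 * density F k m) \<longrightarrow>
     (\<Sum>x\<in>G \<inter> dyadic k m. prime_avg (2 ^ l x) (indicator F) x) \<le> K * sparse_term F G (k, m)"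
proof -
  from prime_avg_linearized obtain K where K: "K > 0" and K_lin: "\<forall>(F :: int set) X l z \<alpha>. finite F \<longrightarrow> finite X \<longrightarrow> z \<ge> 2 \<longrightarrow>
     (\<forall>x\<in>X. weighted_avg (2 ^ l x) (\<lambda>_. 1) (indicator F) x \<le> \<alpha>) \<longrightarrow>
     (\<Sum>x\<in>X. prime_avg (2 ^ l x) (indicator F) x)
       \<le> K * ln z * (\<alpha> * real (card X) + z powr (-(1/4)) * (sqrt (real (card X)) * sqrt (real (card F))) + real (card X) / z)"
    by (elim exE conjE)
  have K68: "68 * K > 0" using K by simp
  show ?thesis
  proof (intro exI[of _ "68 * K"] conjI allI impI K68)
    fix F G :: "int set" and k :: nat and m :: int and l :: "int \<Rightarrow> nat"
    assume F: "finite F" and G: "finite G"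
      and l: "\<forall>x\<in>G \<inter> dyadic k m. l x \<le> k \<and> density F (l x) (x div 2 ^ l x) \<le> 16 * density F k m"
    define X where "X = G \<inter> dyadic k m"
    define F' where "F' = F \<inter> double_dyadic k m"
    define \<rho> where "\<rho> = density F k m"
    define \<beta> where "\<beta> = density G k m"
    define D :: real where "D = 2 * 2 ^ k"
    have finX: "finite X" and finF': "finite F'" using F G by (auto simp: X_def F'_def)
    have D0: "D > 0" by (simp add: D_def)
    have restrict: "prime_avg (2 ^ l x) (indicator F) x = prime_avg (2 ^ l x) (indicator F') x" if x: "x \<in> X" for x
      unfolding prime_avg_def
    proof (intro arg_cong[where f = "\<lambda>s. _ * s"] sum.cong refl)
      fix n :: nat assume n: "n \<in> {1..2 ^ l x}"
      have "int n \<le> int (2 ^ l x)" using n by (simp only: of_nat_le_iff atLeastAtMost_iff)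
      hence "x - int n \<in> double_dyadic k m"
        using x n l by (intro dyadic_shift_in_double[of _ _ _ _ "l x"]) (auto simp: X_def)
      thus "indicator F (x - int n) * mangoldt n = indicator F' (x - int n) * (mangoldt n :: real)"
        by (simp add: F'_def indicator_def)
    qed
    show "(\<Sum>x\<in>G \<inter> dyadic k m. prime_avg (2 ^ l x) (indicator F) x) \<le> 68 * K * sparse_term F G (k, m)"
    proof (cases "X = {} \<or> F' = {}")
      case True
      have "(\<Sum>x\<in>X. prime_avg (2 ^ l x) (indicator F) x) = 0"
        using True
      proof
        assume "F' = {}"
        thus ?thesis by (intro sum.neutral ballI) (simp add: restrict, simp add: prime_avg_def)
      qed simp
      thus ?thesis using sparse_term_nonneg[of F G "(k, m)"] K by (simp add: X_def)
    next
      case False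
      have cF: "real (card F') = \<rho> * D" by (simp add: \<rho>_def density_eq F'_def D_def)
      have "X \<subseteq> G \<inter> double_dyadic k m" using dyadic_subset_double[of k m] by (auto simp: X_def)
      hence "card X \<le> card (G \<inter> double_dyadic k m)" using G by (intro card_mono) auto
      hence cX: "real (card X) \<le> \<beta> * D" by (simp add: \<beta>_def density_eq D_def)
      have "card F' > 0" using False finF' by (simp add: card_gt_0_iff)
      hence \<rho>0: "\<rho> > 0" using cF D0 by (metis of_nat_0_less_iff zero_less_mult_pos2)
      have "card X > 0" using False finX by (simp add: card_gt_0_iff)
      hence "0 < \<beta> * D" using cX by linarith
      hence \<beta>0: "\<beta> > 0" using D0 by (rule zero_less_mult_pos2)
      have \<rho>1: "\<rho> \<le> 1" and \<beta>1: "\<beta> \<le> 1" by (simp_all add: \<rho>_def \<beta>_def density_le_1)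
      define \<delta> where "\<delta> = \<rho> * \<beta>"
      have \<delta>0: "\<delta> > 0" using \<rho>0 \<beta>0 by (simp add: \<delta>_def)
      have \<delta>1: "\<delta> \<le> 1" using \<rho>0 \<beta>0 \<rho>1 \<beta>1 by (simp add: \<delta>_def mult_le_one)
      have \<delta>2: "\<delta>\<^sup>2 \<le> 1" using \<delta>0 \<delta>1 by (simp add: power_le_one)
      \<comment> \<open>The numerator 2 only serves to keep z above 2.\<close>
      define z where "z = 2 / \<delta>\<^sup>2"
      have z2: "z \<ge> 2" using \<delta>0 \<delta>2 by (simp add: z_def field_simps)
      have lnz: "ln z \<le> 2 * Log \<delta>"
      proof -
        have "ln z = ln 2 + 2 * - ln \<delta>" using \<delta>0 by (simp add: z_def ln_div ln_realpow)
        also have "ln 2 \<le> (2::real)" using ln2_le_25_over_36 by simp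
        also have "- ln \<delta> \<le> \<bar>ln \<delta>\<bar>" by simp
        finally show ?thesis by (simp add: Log_def)
      qed
      have avg: "\<forall>x\<in>X. weighted_avg (2 ^ l x) (\<lambda>_. 1) (indicator F') x \<le> 32 * \<rho>"
      proof
        fix x assume x: "x \<in> X"
        let ?m = "x div 2 ^ l x"
        have "(\<Sum>n\<in>{1..int (2 ^ l x)}. 1 * indicator F' (x - n)) = (\<Sum>y\<in>(\<lambda>n. x - n) ` {1..int (2 ^ l x)}. indicator F' y :: real)"
          by (subst sum.reindex) (auto simp: inj_on_def)
        also have "\<dots> = real (card ((\<lambda>n. x - n) ` {1..int (2 ^ l x)} \<inter> F'))" by (rule sum_indicator_card) simp
        also have "\<dots> \<le> real (card (F \<inter> double_dyadic (l x) ?m))"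
        proof -
          have "(\<lambda>n. x - n) ` {1..int (2 ^ l x)} \<inter> F' \<subseteq> F \<inter> double_dyadic (l x) ?m"
          proof
            fix y assume "y \<in> (\<lambda>n. x - n) ` {1..int (2 ^ l x)} \<inter> F'"
            then obtain n where "n \<in> {1..int (2 ^ l x)}" "y = x - n" "y \<in> F" unfolding F'_def by blast
            hence n: "1 \<le> n" "n \<le> 2 ^ l x" "y = x - n" "y \<in> F" by auto
            have "x \<in> dyadic (l x) ?m" by (simp add: dyadic_def)
            thus "y \<in> F \<inter> double_dyadic (l x) ?m" using n dyadic_shift_in_double[of x "l x" ?m n "l x"] by simp
          qed
          thus ?thesis using F by (simp add: card_mono)
        qed
        also have "\<dots> = density F (l x) ?m * (2 * 2 ^ l x)" by (simp add: density_eq)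
        also have "\<dots> \<le> (16 * \<rho>) * (2 * 2 ^ l x)" using l x by (intro mult_right_mono) (auto simp: X_def \<rho>_def)
        finally show "weighted_avg (2 ^ l x) (\<lambda>_. 1) (indicator F') x \<le> 32 * \<rho>"
          by (simp add: weighted_avg_def divide_le_eq mult_ac)
      qed
      have "(\<Sum>x\<in>X. prime_avg (2 ^ l x) (indicator F) x) = (\<Sum>x\<in>X. prime_avg (2 ^ l x) (indicator F') x)"
        by (intro sum.cong refl restrict)
      also have "\<dots> \<le> K * ln z * (32 * \<rho> * real (card X) + z powr (-(1/4)) * (sqrt (real (card X)) * sqrt (real (card F'))) + real (card X) / z)"
        by (rule K_lin[rule_format, OF finF' finX z2]) (use avg in blast)
      also have "\<dots> \<le> K * ln z * (34 * \<delta> * D)"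
      proof (intro mult_left_mono)
        have a: "32 * \<rho> * real (card X) \<le> 32 * \<delta> * D"
          using mult_left_mono[OF cX, of "32 * \<rho>"] \<rho>0 by (simp add: \<delta>_def mult_ac)
        have "sqrt (real (card X)) * sqrt (real (card F')) \<le> sqrt (\<beta> * D) * sqrt (\<rho> * D)"
          using cX cF \<rho>0 D0 by (intro mult_mono) auto
        also have "\<dots> = sqrt \<delta> * D"
          using D0 \<rho>0 \<beta>0 by (simp add: \<delta>_def real_sqrt_mult)
        finally have s: "sqrt (real (card X)) * sqrt (real (card F')) \<le> sqrt \<delta> * D" .
        have "z powr (-(1/4)) = (2 powr (-(1/4))) * \<delta> powr (1/2)"
        proof -
          have "z = 2 * \<delta> powr (-2)" using \<delta>0 by (simp add: z_def powr_minus powr_numeral divide_inverse)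
          hence "z powr (-(1/4)) = (2 * \<delta> powr (-2)) powr (-(1/4))" by (rule arg_cong)
          also have "\<dots> = (2 powr (-(1/4))) * \<delta> powr (1/2)" using \<delta>0 by (simp add: powr_mult powr_powr)
          finally show ?thesis .
        qed
        also have "\<dots> \<le> 1 * \<delta> powr (1/2)" using powr_mono[of "-(1/4)" 0 "2::real"] by (intro mult_right_mono) auto
        also have "\<dots> = sqrt \<delta>" using \<delta>0 by (simp add: powr_half_sqrt)
        finally have "z powr (-(1/4)) \<le> sqrt \<delta>" .
        hence "z powr (-(1/4)) * (sqrt (real (card X)) * sqrt (real (card F'))) \<le> sqrt \<delta> * (sqrt \<delta> * D)"
          using s \<delta>0 by (intro mult_mono[OF _ s]) (auto intro!: mult_nonneg_nonneg)
        hence b: "z powr (-(1/4)) * (sqrt (real (card X)) * sqrt (real (card F'))) \<le> \<delta> * D"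
          using \<delta>0 by (simp flip: mult.assoc)
        have "real (card X) / z \<le> (\<beta> * D) / z" using cX z2 by (intro divide_right_mono) auto
        also have "\<dots> = \<beta> * D * \<delta>\<^sup>2 / 2" by (simp add: z_def)
        also have "\<dots> \<le> 1 * D * \<delta>\<^sup>2 / 2" using \<beta>1 D0 by (intro divide_right_mono mult_right_mono) auto
        also have "\<dots> \<le> D * \<delta>"
        proof -
          have "\<delta>\<^sup>2 \<le> \<delta>" using \<delta>0 \<delta>1 by (simp add: power2_eq_square mult_left_le)
          hence "D * \<delta>\<^sup>2 \<le> D * \<delta>" using D0 by (intro mult_left_mono) auto
          moreover have "0 \<le> D * \<delta>" using D0 \<delta>0 by simp
          ultimately show ?thesis by simp
        qed
        finally have c: "real (card X) / z \<le> \<delta> * D" by (simp add: mult.commute)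
        show "32 * \<rho> * real (card X) + z powr (-(1/4)) * (sqrt (real (card X)) * sqrt (real (card F'))) + real (card X) / z \<le> 34 * \<delta> * D"
          using a b c by (simp add: mult.assoc)
      qed (use K z2 in auto)
      also have "\<dots> = (K * (34 * \<delta> * D)) * ln z" by simp
      also have "\<dots> \<le> (K * (34 * \<delta> * D)) * (2 * Log \<delta>)" using lnz K \<delta>0 D0 by (intro mult_left_mono) auto
      also have "\<dots> = 68 * K * sparse_term F G (k, m)"
        by (simp add: sparse_term_def Let_def \<delta>_def \<rho>_def \<beta>_def D_def)
      finally show ?thesis by (simp add: X_def)
    qed
  qed
qed

section \<open>Sparse domination\<close>

definition dyadic_max :: "int set \<Rightarrow> nat \<Rightarrow> int \<Rightarrow> real" where
  "dyadic_max F k x = Max ((\<lambda>j. prime_avg (2 ^ j) (indicator F) x) ` {..k})"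

lemma dyadic_max_ge: "j \<le> k \<Longrightarrow> prime_avg (2 ^ j) (indicator F) x \<le> dyadic_max F k x"
  unfolding dyadic_max_def by (intro Max_ge) auto

lemma dyadic_max_nonneg: "0 \<le> dyadic_max F k x"
  using prime_avg_nonneg[of "indicator F" "2 ^ 0" x] dyadic_max_ge[of 0 k F x] by simp

lemma dyadic_subset_imp_le:
  assumes "dyadic k m \<subseteq> dyadic k' m'"
  shows "k \<le> k'"
proof -
  have "card (dyadic k m) \<le> card (dyadic k' m')" by (rule card_mono[OF dyadic_finite assms])
  thus ?thesis by (simp add: dyadic_card)
qed

text \<open>
The largest stopping scale is the same at all points of the dyadic interval that it selects around
\<open>x\<close>. Hence the selected intervals coincide or are disjoint.
\<close>
lemma stopping_time_localizes:
  assumes "stopping_scales F k x \<noteq> {}" "\<kappa> = Max (stopping_scales F k x)" "y div 2 ^ \<kappa> = x div 2 ^ \<kappa>"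
  shows "stopping_scales F k y \<noteq> {}" "Max (stopping_scales F k y) = \<kappa>"
proof -
  have \<kappa>: "\<kappa> \<in> stopping_scales F k x" unfolding assms(2) using assms(1) by (intro Max_in stopping_scales_finite)
  have \<kappa>k: "\<kappa> < k" using \<kappa> by (simp add: stopping_scales_def)
  have same: "j \<in> stopping_scales F k y \<longleftrightarrow> j \<in> stopping_scales F k x" if "\<kappa> \<le> j" for j
    using div_pow_coarser[OF assms(3) that] div_pow_coarser[OF assms(3), of k] \<kappa>k
    by (simp add: stopping_scales_def)
  hence \<kappa>y: "\<kappa> \<in> stopping_scales F k y" using \<kappa> by simp
  thus "stopping_scales F k y \<noteq> {}" by blast
  show "Max (stopping_scales F k y) = \<kappa>"
  proof (rule Max_eqI[OF stopping_scales_finite _ \<kappa>y])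
    fix j assume j: "j \<in> stopping_scales F k y"
    show "j \<le> \<kappa>"
    proof (cases "\<kappa> \<le> j")
      case True
      hence "j \<in> stopping_scales F k x" using j same by blast
      thus ?thesis unfolding assms(2) by (intro Max_ge stopping_scales_finite)
    qed simp
  qed
qed

text \<open>
Induction on the scale \<open>k\<close>. At a point \<open>x\<close>, a scale \<open>j \<le> k\<close> either exceeds all stopping scales, and then
\<open>admissible_sum_le\<close> applies to the interval itself, or it is at most the largest stopping scale \<open>\<kappa> x\<close>, and
then it belongs to the maximal function of the interval selected at scale \<open>\<kappa> x\<close>. The selected intervals
are pairwise disjoint and avoid the major part, so the collections provided by the induction hypothesis
can be joined.
\<close>
lemma local_sparse_domination:
  "\<exists>K>0. \<forall>F G k m. finite F \<longrightarrow> finite G \<longrightarrow>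
     (\<exists>S. finite S \<and> (\<forall>p\<in>S. dyadic (fst p) (snd p) \<subseteq> dyadic k m) \<and> disjoint_family_on (major_part F) S \<and>
       (\<Sum>x\<in>G \<inter> dyadic k m. dyadic_max F k x) \<le> K * (\<Sum>p\<in>S. sparse_term F G p))"
proof -
  from admissible_sum_le obtain K where K: "K > 0" and K_adm: "\<forall>F G k m l. finite F \<longrightarrow> finite G \<longrightarrow>
     (\<forall>x\<in>G \<inter> dyadic k m. l x \<le> k \<and> density F (l x) (x div 2 ^ l x) \<le> 16 * density F k m) \<longrightarrow>
     (\<Sum>x\<in>G \<inter> dyadic k m. prime_avg (2 ^ l x) (indicator F) x) \<le> K * sparse_term F G (k, m)"
    by (elim exE conjE)
  show ?thesis
  proof (intro exI[of _ K] conjI allI impI K)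
    fix F G :: "int set" and k :: nat and m :: int
    assume F: "finite F" and G: "finite G"
    show "\<exists>S. finite S \<and> (\<forall>p\<in>S. dyadic (fst p) (snd p) \<subseteq> dyadic k m) \<and> disjoint_family_on (major_part F) S \<and>
       (\<Sum>x\<in>G \<inter> dyadic k m. dyadic_max F k x) \<le> K * (\<Sum>p\<in>S. sparse_term F G p)"
    proof (induction k arbitrary: m rule: less_induct)
      case (less k)
      define X where "X = G \<inter> dyadic k m"
      define T where "T x = stopping_scales F k x" for x
      define \<kappa> where "\<kappa> x = Max (T x)" for x
      define A where "A = {x\<in>X. T x \<noteq> {}}"
      define c where "c x = (\<kappa> x, x div 2 ^ \<kappa> x)" for x
      have finX: "finite X" using G by (simp add: X_def)
      have finA: "finite A" using finX by (simp add: A_def)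
      have finT: "finite (T x)" for x by (simp add: T_def stopping_scales_finite)
      have \<kappa>T: "\<kappa> x \<in> T x" if "T x \<noteq> {}" for x unfolding \<kappa>_def using finT that by (rule Max_in)
      have \<kappa>k: "\<kappa> x < k" if "T x \<noteq> {}" for x using \<kappa>T[OF that] by (simp add: T_def stopping_scales_def)
      have xk: "x div 2 ^ k = m" if "x \<in> X" for x using that by (simp add: X_def dyadic_def)
      have local: "T y \<noteq> {} \<and> \<kappa> y = \<kappa> x" if "T x \<noteq> {}" "y div 2 ^ \<kappa> x = x div 2 ^ \<kappa> x" for x y
        using stopping_time_localizes[of F k x "\<kappa> x" y] that by (simp add: T_def \<kappa>_def)
      \<comment> \<open>The scale k itself is always admissible, since stopping scales are smaller.\<close>
      define adm where "adm x = {j. j \<le> k \<and> (\<forall>i\<in>T x. i < j)}" for x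
      have fin_adm: "finite (adm x)" for x by (simp add: adm_def)
      have k_adm: "k \<in> adm x" for x by (auto simp: adm_def T_def stopping_scales_def)
      have "\<exists>l. \<forall>x. l x \<in> adm x \<and> (\<forall>j\<in>adm x. prime_avg (2 ^ j) (indicator F) x \<le> prime_avg (2 ^ l x) (indicator F) x)"
      proof (rule choice, rule allI)
        fix x
        let ?M = "Max ((\<lambda>j. prime_avg (2 ^ j) (indicator F) x) ` adm x)"
        have "?M \<in> (\<lambda>j. prime_avg (2 ^ j) (indicator F) x) ` adm x" using fin_adm k_adm by (intro Max_in) auto
        then obtain l where "l \<in> adm x" "?M = prime_avg (2 ^ l) (indicator F) x" by auto
        moreover have "prime_avg (2 ^ j) (indicator F) x \<le> ?M" if "j \<in> adm x" for j using fin_adm that by (intro Max_ge) auto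
        ultimately show "\<exists>l. l \<in> adm x \<and> (\<forall>j\<in>adm x. prime_avg (2 ^ j) (indicator F) x \<le> prime_avg (2 ^ l) (indicator F) x)" by auto
      qed
      then obtain l where l: "\<And>x. l x \<in> adm x" "\<And>x j. j \<in> adm x \<Longrightarrow> prime_avg (2 ^ j) (indicator F) x \<le> prime_avg (2 ^ l x) (indicator F) x"
        by blast
      have pa0: "0 \<le> prime_avg N (indicator F) x" for N x by (rule prime_avg_nonneg) simp
      have split: "dyadic_max F k x \<le> prime_avg (2 ^ l x) (indicator F) x + (if T x \<noteq> {} then dyadic_max F (\<kappa> x) x else 0)" for x
        unfolding dyadic_max_def[of F k]
      proof (rule Max.boundedI)
        fix a assume "a \<in> (\<lambda>j. prime_avg (2 ^ j) (indicator F) x) ` {..k}"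
        then obtain j where j: "j \<le> k" "a = prime_avg (2 ^ j) (indicator F) x" by auto
        show "a \<le> prime_avg (2 ^ l x) (indicator F) x + (if T x \<noteq> {} then dyadic_max F (\<kappa> x) x else 0)"
        proof (cases "j \<in> adm x")
          case True
          thus ?thesis using l(2)[OF True] j dyadic_max_nonneg[of F "\<kappa> x" x] by auto
        next
          case False
          then obtain i where i: "i \<in> T x" "j \<le> i" using j by (auto simp: adm_def not_less)
          have "i \<le> \<kappa> x" unfolding \<kappa>_def using finT i(1) by (intro Max_ge)
          hence "a \<le> dyadic_max F (\<kappa> x) x" using j i by (auto intro: dyadic_max_ge)
          thus ?thesis using i pa0[of "2 ^ l x" x] by auto
        qed
      qed auto
      have adm_sum: "(\<Sum>x\<in>X. prime_avg (2 ^ l x) (indicator F) x) \<le> K * sparse_term F G (k, m)"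
        unfolding X_def
      proof (rule K_adm[rule_format, OF F G])
        fix x assume x: "x \<in> G \<inter> dyadic k m"
        have lk: "l x \<le> k" using l(1)[of x] by (simp add: adm_def)
        have "l x \<notin> T x" using l(1)[of x] by (auto simp: adm_def)
        hence "density F (l x) (x div 2 ^ l x) \<le> 16 * density F k m"
        proof (cases "l x = k")
          case True
          thus ?thesis using x density_nonneg[of F k m] by (simp add: dyadic_def)
        next
          case False
          thus ?thesis using \<open>l x \<notin> T x\<close> lk x by (auto simp: T_def stopping_scales_def dyadic_def)
        qed
        thus "l x \<le> k \<and> density F (l x) (x div 2 ^ l x) \<le> 16 * density F k m" using lk by simp
      qed
      have child_sub: "dyadic (fst (c x)) (snd (c x)) \<subseteq> {y\<in>dyadic k m. T y \<noteq> {}}" if "x \<in> A" for x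
      proof
        fix y assume "y \<in> dyadic (fst (c x)) (snd (c x))"
        hence y: "y div 2 ^ \<kappa> x = x div 2 ^ \<kappa> x" by (simp add: c_def dyadic_def)
        have x: "T x \<noteq> {}" "x div 2 ^ k = m" using that xk by (auto simp: A_def)
        have "y div 2 ^ k = m" using div_pow_coarser[OF y, of k] \<kappa>k[OF x(1)] x(2) by simp
        thus "y \<in> {y\<in>dyadic k m. T y \<noteq> {}}" using local[OF x(1) y] by (simp add: dyadic_def)
      qed
      have child_disj: "c x = c x'" if "x \<in> A" "x' \<in> A" "y \<in> dyadic (fst (c x)) (snd (c x))" "y \<in> dyadic (fst (c x')) (snd (c x'))" for x x' y
      proof -
        have y: "y div 2 ^ \<kappa> x = x div 2 ^ \<kappa> x" "y div 2 ^ \<kappa> x' = x' div 2 ^ \<kappa> x'" using that(3,4) by (simp_all add: c_def dyadic_def)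
        have "\<kappa> y = \<kappa> x" "\<kappa> y = \<kappa> x'" using local[of x y] local[of x' y] y that(1,2) by (auto simp: A_def)
        thus ?thesis using y by (simp add: c_def)
      qed
      have "\<exists>S. \<forall>q\<in>c ` A. finite (S q) \<and> (\<forall>p\<in>S q. dyadic (fst p) (snd p) \<subseteq> dyadic (fst q) (snd q)) \<and> disjoint_family_on (major_part F) (S q) \<and>
         (\<Sum>x\<in>G \<inter> dyadic (fst q) (snd q). dyadic_max F (fst q) x) \<le> K * (\<Sum>p\<in>S q. sparse_term F G p)"
      proof (rule bchoice, rule ballI)
        fix q assume "q \<in> c ` A"
        then obtain x where x: "x \<in> A" "q = c x" by auto
        hence "fst q < k" using \<kappa>k[of x] by (simp add: c_def A_def)
        thus "\<exists>S. finite S \<and> (\<forall>p\<in>S. dyadic (fst p) (snd p) \<subseteq> dyadic (fst q) (snd q)) \<and> disjoint_family_on (major_part F) S \<and>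
         (\<Sum>x\<in>G \<inter> dyadic (fst q) (snd q). dyadic_max F (fst q) x) \<le> K * (\<Sum>p\<in>S. sparse_term F G p)"
          by (rule less.IH)
      qed
      then obtain S where S_fin: "\<And>q. q \<in> c ` A \<Longrightarrow> finite (S q)"
        and S_sub: "\<And>q p. q \<in> c ` A \<Longrightarrow> p \<in> S q \<Longrightarrow> dyadic (fst p) (snd p) \<subseteq> dyadic (fst q) (snd q)"
        and S_disj: "\<And>q. q \<in> c ` A \<Longrightarrow> disjoint_family_on (major_part F) (S q)"
        and S_sum: "\<And>q. q \<in> c ` A \<Longrightarrow> (\<Sum>x\<in>G \<inter> dyadic (fst q) (snd q). dyadic_max F (fst q) x) \<le> K * (\<Sum>p\<in>S q. sparse_term F G p)"
        by blast
      define S0 where "S0 = (\<Union>q\<in>c ` A. S q)"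
      have finS0: "finite S0" unfolding S0_def using finA S_fin by blast
      have ne: "\<exists>y. y \<in> dyadic j i" for j i by (intro exI[of _ "i * 2 ^ j"]) (simp add: dyadic_def)
      have major_sub: "major_part F p \<subseteq> dyadic (fst p) (snd p)" for p by (cases p) (auto simp: major_part_def)
      have unique: "q = q'" if q: "q \<in> c ` A" "q' \<in> c ` A" and y: "y \<in> dyadic (fst q) (snd q)" "y \<in> dyadic (fst q') (snd q')" for q q' y
        using q y child_disj by blast
      have top_disj: "major_part F (k, m) \<inter> major_part F p = {}" if pS0: "p \<in> S0" for p
      proof -
        obtain x where x: "x \<in> A" "p \<in> S (c x)" using pS0 by (auto simp: S0_def)
        have "major_part F p \<subseteq> {y\<in>dyadic k m. T y \<noteq> {}}"
          by (rule subset_trans[OF major_sub subset_trans[OF S_sub[OF imageI[OF x(1)] x(2)] child_sub[OF x(1)]]])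
        moreover have "major_part F (k, m) \<subseteq> {y. T y = {}}" by (auto simp: major_part_def T_def)
        ultimately show ?thesis by blast
      qed
      have new: "(k, m) \<notin> S0"
      proof
        assume "(k, m) \<in> S0"
        then obtain x where x: "x \<in> A" "(k, m) \<in> S (c x)" by (auto simp: S0_def)
        have "dyadic k m \<subseteq> dyadic (fst (c x)) (snd (c x))" using S_sub[of "c x" "(k, m)"] x by simp
        hence "k \<le> fst (c x)" by (rule dyadic_subset_imp_le)
        thus False using \<kappa>k[of x] x by (simp add: c_def A_def)
      qed
      have disj0: "disjoint_family_on (major_part F) S0"
        unfolding disjoint_family_on_def
      proof (intro ballI impI)
        fix p p' assume p: "p \<in> S0" "p' \<in> S0" "p \<noteq> p'"
        obtain q where q: "q \<in> c ` A" "p \<in> S q" using p(1) unfolding S0_def by blast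
        obtain q' where q': "q' \<in> c ` A" "p' \<in> S q'" using p(2) unfolding S0_def by blast
        show "major_part F p \<inter> major_part F p' = {}"
        proof (cases "q = q'")
          case True
          thus ?thesis using S_disj[OF q(1)] q q' p(3) by (auto simp: disjoint_family_on_def)
        next
          case False
          thus ?thesis using unique[OF q(1) q'(1)] S_sub[OF q] S_sub[OF q'] major_sub[of p] major_sub[of p'] by blast
        qed
      qed
      have "(\<Sum>x\<in>X. dyadic_max F k x) \<le> (\<Sum>x\<in>X. prime_avg (2 ^ l x) (indicator F) x + (if T x \<noteq> {} then dyadic_max F (\<kappa> x) x else 0))"
        by (intro sum_mono split)
      also have "\<dots> = (\<Sum>x\<in>X. prime_avg (2 ^ l x) (indicator F) x) + (\<Sum>x\<in>A. dyadic_max F (\<kappa> x) x)"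
        unfolding sum.distrib A_def by (subst sum.inter_filter[OF finX]) simp
      also have "(\<Sum>x\<in>A. dyadic_max F (\<kappa> x) x) = (\<Sum>q\<in>c ` A. \<Sum>x\<in>{x\<in>A. c x = q}. dyadic_max F (\<kappa> x) x)"
        by (rule sum.image_gen[OF finA])
      also have "\<dots> \<le> (\<Sum>q\<in>c ` A. K * (\<Sum>p\<in>S q. sparse_term F G p))"
      proof (rule sum_mono)
        fix q assume q: "q \<in> c ` A"
        have "(\<Sum>x\<in>{x\<in>A. c x = q}. dyadic_max F (\<kappa> x) x) = (\<Sum>x\<in>{x\<in>A. c x = q}. dyadic_max F (fst q) x)"
          by (intro sum.cong refl) (auto simp: c_def)
        also have "\<dots> \<le> (\<Sum>x\<in>G \<inter> dyadic (fst q) (snd q). dyadic_max F (fst q) x)"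
          using G dyadic_max_nonneg by (intro sum_mono2) (auto simp: A_def X_def c_def dyadic_def)
        also note S_sum[OF q]
        finally show "(\<Sum>x\<in>{x\<in>A. c x = q}. dyadic_max F (\<kappa> x) x) \<le> K * (\<Sum>p\<in>S q. sparse_term F G p)" .
      qed
      also have "\<dots> = K * (\<Sum>p\<in>S0. sparse_term F G p)"
      proof -
        have "(\<Sum>p\<in>S0. sparse_term F G p) = (\<Sum>q\<in>c ` A. \<Sum>p\<in>S q. sparse_term F G p)"
          unfolding S0_def
        proof (rule sum.UNION_disjoint)
          show "\<forall>q\<in>c ` A. \<forall>q'\<in>c ` A. q \<noteq> q' \<longrightarrow> S q \<inter> S q' = {}"
          proof (intro ballI impI, rule ccontr)
            fix q q' assume q: "q \<in> c ` A" "q' \<in> c ` A" "q \<noteq> q'" "S q \<inter> S q' \<noteq> {}"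
            then obtain p where p: "p \<in> S q" "p \<in> S q'" by blast
            obtain y where "y \<in> dyadic (fst p) (snd p)" using ne by blast
            hence "q = q'" using unique[OF q(1,2)] S_sub[OF q(1) p(1)] S_sub[OF q(2) p(2)] by blast
            thus False using q(3) by simp
          qed
        qed (use finA S_fin in auto)
        thus ?thesis by (simp add: sum_distrib_left)
      qed
      finally have "(\<Sum>x\<in>X. dyadic_max F k x) \<le> K * sparse_term F G (k, m) + K * (\<Sum>p\<in>S0. sparse_term F G p)"
        using adm_sum by simp
      also have "\<dots> = K * (\<Sum>p\<in>insert (k, m) S0. sparse_term F G p)"
        using finS0 new by (simp add: distrib_left)
      finally have total: "(\<Sum>x\<in>G \<inter> dyadic k m. dyadic_max F k x) \<le> K * (\<Sum>p\<in>insert (k, m) S0. sparse_term F G p)"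
        by (simp add: X_def)
      show ?case
      proof (intro exI[of _ "insert (k, m) S0"] conjI total)
        show "\<forall>p\<in>insert (k, m) S0. dyadic (fst p) (snd p) \<subseteq> dyadic k m"
        proof
          fix p assume "p \<in> insert (k, m) S0"
          thus "dyadic (fst p) (snd p) \<subseteq> dyadic k m"
          proof
            assume "p \<in> S0"
            then obtain x where x: "x \<in> A" "p \<in> S (c x)" by (auto simp: S0_def)
            thus ?thesis using S_sub[of "c x" p] child_sub[of x] by blast
          qed simp
        qed
        show "disjoint_family_on (major_part F) (insert (k, m) S0)"
          using disj0 top_disj unfolding disjoint_family_on_def by blast
      qed (use finS0 in simp)
    qed
  qed
qed

text \<open>
Passing to the next power of two costs a factor 2. Beyond \<open>2 ^ k\<close> the average only decreases, as no
further point of \<open>F\<close> is met.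
\<close>
lemma prime_max_le_dyadic_max:
  assumes "\<And>y. y \<in> F \<Longrightarrow> x - y \<le> 2 ^ k"
  shows "prime_max (indicator F) x \<le> 2 * dyadic_max F k x"
  unfolding prime_max_def
proof (rule cSUP_least)
  fix N :: nat assume N: "N \<in> {1..}"
  define f :: "int \<Rightarrow> real" where "f = indicator F"
  have f0: "f y \<ge> 0" for y by (simp add: f_def)
  define t where "t n = f (x - int n) * mangoldt n" for n
  have t0: "t n \<ge> 0" for n using f0 mangoldt_nonneg[of n] by (simp add: t_def)
  have pa: "prime_avg M f x = (\<Sum>n\<in>{1..M}. t n) / real M" for M by (simp add: prime_avg_def t_def)
  have pa0: "prime_avg N f x \<ge> 0" using f0 by (rule prime_avg_nonneg)
  obtain j where j: "j \<le> k" "real (2 ^ j) \<le> 2 * real N" "(\<Sum>n\<in>{1..N}. t n) \<le> (\<Sum>n\<in>{1..2 ^ j}. t n)"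
  proof (cases "N \<le> 2 ^ k")
    case True
    define j where "j = (LEAST i. N \<le> 2 ^ i)"
    have 1: "N \<le> 2 ^ j" unfolding j_def using True by (rule LeastI)
    have 2: "j \<le> k" unfolding j_def using True by (rule Least_le)
    have 3: "2 ^ j \<le> 2 * N"
    proof (cases j)
      case 0
      thus ?thesis using N by simp
    next
      case (Suc i)
      hence "\<not> N \<le> 2 ^ i" using not_less_Least[of i "\<lambda>i. N \<le> 2 ^ i"] by (simp add: j_def)
      thus ?thesis using Suc by simp
    qed
    have "(\<Sum>n\<in>{1..N}. t n) \<le> (\<Sum>n\<in>{1..2 ^ j}. t n)" using 1 t0 by (intro sum_mono2) auto
    moreover have "real (2 ^ j) \<le> real (2 * N)" using 3 by (simp only: of_nat_le_iff)
    ultimately show ?thesis using that 2 by simp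
  next
    case False
    have "(\<Sum>n\<in>{1..N}. t n) = (\<Sum>n\<in>{1..2 ^ k}. t n)"
    proof (rule sum.mono_neutral_right)
      show "\<forall>n\<in>{1..N} - {1..2 ^ k}. t n = 0"
      proof
        fix n assume "n \<in> {1..N} - {1..2 ^ k}"
        hence "n > 2 ^ k" by auto
        hence "int n > int (2 ^ k)" by (simp only: of_nat_less_iff)
        hence "x - int n \<notin> F" using assms[of "x - int n"] by auto
        thus "t n = 0" by (simp add: t_def f_def)
      qed
    qed (use False in auto)
    moreover have "real (2 ^ k) \<le> real N" using False by (simp only: of_nat_le_iff)
    hence "real (2 ^ k) \<le> 2 * real N" by linarith
    ultimately show ?thesis by (intro that[of k]) simp_all
  qed
  have "prime_avg N f x \<le> (\<Sum>n\<in>{1..2 ^ j}. t n) / real N" unfolding pa using j(3) by (intro divide_right_mono) auto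
  also have "\<dots> = (real (2 ^ j) / real N) * prime_avg (2 ^ j) f x" by (simp add: pa)
  also have "\<dots> \<le> 2 * prime_avg (2 ^ j) f x"
    using j(2) N f0 by (intro mult_right_mono prime_avg_nonneg) (auto simp: divide_le_eq)
  also have "\<dots> \<le> 2 * dyadic_max F k x" using dyadic_max_ge[OF j(1), of F x] by (simp add: f_def)
  finally show "\<bar>prime_avg N (indicator F) x\<bar> \<le> 2 * dyadic_max F k x" using pa0 by (simp add: f_def)
qed auto

lemma pairing_indicator:
  assumes "finite G"
  shows "pairing u (indicator G) = (\<Sum>x\<in>G. u x)"
proof -
  have "pairing u (indicator G) = (\<Sum>\<^sub>\<infinity>x\<in>G. u x)"
    unfolding pairing_def by (intro infsum_cong_neutral) auto
  thus ?thesis using assms by simp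
qed

lemma sparse_form_image_eq:
  assumes "finite S"
  shows "sparse_form t ((\<lambda>(k, m). double_dyadic k m) ` S) (indicator F) (indicator G) =
    (\<Sum>(k, m)\<in>S. density F k m * density G k m * Log (density F k m * density G k m) ^ t * (2 * 2 ^ k))"
proof -
  let ?J = "\<lambda>(k, m). double_dyadic k m"
  have inj: "inj_on ?J S" using double_dyadic_inject by (auto intro!: inj_onI)
  have "sparse_form t (?J ` S) (indicator F) (indicator G) =
     (\<Sum>I\<in>?J ` S. avg I (indicator F) * avg I (indicator G) * Log (avg I (indicator F) * avg I (indicator G)) ^ t * real (card I))"
    unfolding sparse_form_def using assms by (intro infsum_finite) simp
  also have "\<dots> = (\<Sum>(k, m)\<in>S. density F k m * density G k m * Log (density F k m * density G k m) ^ t * (2 * 2 ^ k))"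
    unfolding sum.reindex[OF inj] by (intro sum.cong) (auto simp: density_def double_dyadic_card)
  finally show ?thesis .
qed

text \<open>
A double interval determines its dyadic interval, so the major parts can serve as witnesses for the
double intervals.
\<close>
lemma sparse_collection_image:
  assumes "disjoint_family_on (major_part F) S"
  shows "sparse_collection ((\<lambda>(k, m). double_dyadic k m) ` S)"
proof -
  let ?J = "\<lambda>(k, m). double_dyadic k m"
  define E where "E I = major_part F (the_inv_into S ?J I)" for I
  have inj: "inj_on ?J S" using double_dyadic_inject by (auto intro!: inj_onI)
  have E: "E (?J p) = major_part F p" if "p \<in> S" for p
    unfolding E_def using the_inv_into_f_f[OF inj that] by simp
  have "int_interval (?J p)" for p
  proof (cases p)
    case (Pair k m)
    have "(m - 1) * 2 ^ k \<le> (m + 1) * 2 ^ k - 1"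
      using one_le_power[of "2::int" k] unfolding left_diff_distrib distrib_right by linarith
    thus ?thesis unfolding int_interval_def Pair double_dyadic_def by auto
  qed
  moreover have "E (?J p) \<subseteq> ?J p \<and> card (?J p) \<le> 4 * card (E (?J p))" if "p \<in> S" for p
  proof (cases p)
    case (Pair k m)
    have "major_part F (k, m) \<subseteq> double_dyadic k m" using dyadic_subset_double[of k m] by (auto simp: major_part_def)
    thus ?thesis unfolding E[OF that] using major_part_card[of k m F] by (simp add: Pair)
  qed
  moreover have "disjoint_family_on E (?J ` S)"
    unfolding disjoint_family_on_def
  proof (intro ballI impI)
    fix I I' assume "I \<in> ?J ` S" "I' \<in> ?J ` S" "I \<noteq> I'"
    then obtain p p' where p: "p \<in> S" "I = ?J p" "p' \<in> S" "I' = ?J p'" "p \<noteq> p'" by blast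
    thus "E I \<inter> E I' = {}" using E assms by (auto simp: disjoint_family_on_def)
  qed
  ultimately show ?thesis unfolding sparse_collection_def by blast
qed

text \<open>
At a large scale the dyadic intervals with indices \<open>0\<close> and \<open>-1\<close> together contain \<open>G\<close>. No dyadic
interval contains points on both sides of the origin, so both serve as starting points.
\<close>
lemma prime_max_sparse_bound:
  "\<exists>C>0. \<forall>F G. finite F \<longrightarrow> finite G \<longrightarrow> (\<exists>S. finite S \<and> sparse_collection ((\<lambda>(k, m). double_dyadic k m) ` S) \<and>
     pairing (prime_max (indicator F)) (indicator G) \<le> C * (\<Sum>p\<in>S. sparse_term F G p))"
proof -
  from local_sparse_domination obtain K where K: "K > 0" and K_loc: "\<forall>F G k m. finite F \<longrightarrow> finite G \<longrightarrow>
     (\<exists>S. finite S \<and> (\<forall>p\<in>S. dyadic (fst p) (snd p) \<subseteq> dyadic k m) \<and> disjoint_family_on (major_part F) S \<and>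
       (\<Sum>x\<in>G \<inter> dyadic k m. dyadic_max F k x) \<le> K * (\<Sum>p\<in>S. sparse_term F G p))"
    by (elim exE conjE)
  have K2: "2 * K > 0" using K by simp
  show ?thesis
  proof (intro exI[of _ "2 * K"] conjI allI impI K2)
    fix F G :: "int set" assume F: "finite F" and G: "finite G"
    obtain k :: nat where k: "\<And>x. x \<in> F \<union> G \<Longrightarrow> 2 * \<bar>x\<bar> < 2 ^ k"
    proof -
      define b where "b = Max (insert 0 ((\<lambda>x. nat (2 * \<bar>x\<bar>)) ` (F \<union> G)))"
      have "2 * \<bar>x\<bar> < 2 ^ b" if "x \<in> F \<union> G" for x
      proof -
        have "nat (2 * \<bar>x\<bar>) \<le> b" unfolding b_def using F G that by (intro Max_ge) auto
        also have "b < 2 ^ b" by simp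
        finally have "int (nat (2 * \<bar>x\<bar>)) < int (2 ^ b)" by (simp only: of_nat_less_iff)
        thus ?thesis by simp
      qed
      thus ?thesis using that by blast
    qed
    have fit: "x - y \<le> 2 ^ k" if "x \<in> G" "y \<in> F" for x y
      using k[of x] k[of y] that by auto
    have cover: "G \<subseteq> dyadic k 0 \<union> dyadic k (- 1)"
    proof
      fix x assume "x \<in> G"
      hence "2 * \<bar>x\<bar> < 2 ^ k" using k by simp
      thus "x \<in> dyadic k 0 \<union> dyadic k (- 1)" by (auto simp: dyadic_eq)
    qed
    obtain S0 where S0: "finite S0" "\<forall>p\<in>S0. dyadic (fst p) (snd p) \<subseteq> dyadic k 0" "disjoint_family_on (major_part F) S0"
      "(\<Sum>x\<in>G \<inter> dyadic k 0. dyadic_max F k x) \<le> K * (\<Sum>p\<in>S0. sparse_term F G p)"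
      using K_loc[rule_format, OF F G, of k 0] by (elim exE conjE)
    obtain S1 where S1: "finite S1" "\<forall>p\<in>S1. dyadic (fst p) (snd p) \<subseteq> dyadic k (- 1)" "disjoint_family_on (major_part F) S1"
      "(\<Sum>x\<in>G \<inter> dyadic k (- 1). dyadic_max F k x) \<le> K * (\<Sum>p\<in>S1. sparse_term F G p)"
      using K_loc[rule_format, OF F G, of k "- 1"] by (elim exE conjE)
    have dd: "dyadic k 0 \<inter> dyadic k (- 1) = {}" by (auto simp: dyadic_def)
    have major_sub: "major_part F p \<subseteq> dyadic (fst p) (snd p)" for p by (cases p) (auto simp: major_part_def)
    have ne: "snd p * 2 ^ fst p \<in> dyadic (fst p) (snd p)" for p by (simp add: dyadic_def)
    have cross: "major_part F p \<inter> major_part F p' = {}" if "p \<in> S0" "p' \<in> S1" for p p'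
      using major_sub[of p] major_sub[of p'] S0(2) S1(2) that dd by blast
    have S01: "S0 \<inter> S1 = {}" using S0(2) S1(2) dd ne by blast
    have disj: "disjoint_family_on (major_part F) (S0 \<union> S1)"
      using S0(3) S1(3) cross unfolding disjoint_family_on_def by blast
    have "pairing (prime_max (indicator F)) (indicator G) = (\<Sum>x\<in>G. prime_max (indicator F) x)"
      by (rule pairing_indicator[OF G])
    also have "\<dots> \<le> (\<Sum>x\<in>G. 2 * dyadic_max F k x)"
      using fit by (intro sum_mono prime_max_le_dyadic_max) auto
    also have "\<dots> = 2 * (\<Sum>x\<in>G. dyadic_max F k x)" by (simp add: sum_distrib_left)
    also have "(\<Sum>x\<in>G. dyadic_max F k x) = (\<Sum>x\<in>G \<inter> dyadic k 0. dyadic_max F k x) + (\<Sum>x\<in>G \<inter> dyadic k (- 1). dyadic_max F k x)"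
      using G dd cover by (subst sum.union_disjoint[symmetric]) (auto intro!: sum.cong)
    also have "2 * \<dots> \<le> 2 * (K * (\<Sum>p\<in>S0. sparse_term F G p) + K * (\<Sum>p\<in>S1. sparse_term F G p))"
      using S0(4) S1(4) by simp
    also have "\<dots> = 2 * K * (\<Sum>p\<in>S0 \<union> S1. sparse_term F G p)"
      using S0(1) S1(1) S01 by (simp add: sum.union_disjoint algebra_simps)
    finally show "\<exists>S. finite S \<and> sparse_collection ((\<lambda>(k, m). double_dyadic k m) ` S) \<and>
      pairing (prime_max (indicator F)) (indicator G) \<le> 2 * K * (\<Sum>p\<in>S. sparse_term F G p)"
      using S0(1) S1(1) sparse_collection_image[OF disj] by (intro exI[of _ "S0 \<union> S1"]) simp
  qed
qed

theorem theorem1p3: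
  shows "\<exists>C::real. \<forall>t::nat. t = 2 \<or> (t = 1 \<and> GRH) \<longrightarrow>
    (\<forall>F G :: int set. finite F \<longrightarrow> finite G \<longrightarrow>
      (\<exists>S. sparse_collection S \<and>
        pairing (prime_max (indicator F)) (indicator G)
          \<le> C * sparse_form t S (indicator F) (indicator G)))"
proof -
  from prime_max_sparse_bound obtain C where C: "C > 0" and C_sparse: "\<forall>F G. finite F \<longrightarrow> finite G \<longrightarrow>
     (\<exists>S. finite S \<and> sparse_collection ((\<lambda>(k, m). double_dyadic k m) ` S) \<and>
     pairing (prime_max (indicator F)) (indicator G) \<le> C * (\<Sum>p\<in>S. sparse_term F G p))"
    by (elim exE conjE)
  show ?thesis
  proof (intro exI[of _ C] allI impI)
    fix t :: nat and F G :: "int set"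
    assume t: "t = 2 \<or> (t = 1 \<and> GRH)" and F: "finite F" and G: "finite G"
    obtain S where S: "finite S" "sparse_collection ((\<lambda>(k, m). double_dyadic k m) ` S)"
      "pairing (prime_max (indicator F)) (indicator G) \<le> C * (\<Sum>p\<in>S. sparse_term F G p)"
      using C_sparse[rule_format, OF F G] by (elim exE conjE)
    have "(\<Sum>p\<in>S. sparse_term F G p) \<le> sparse_form t ((\<lambda>(k, m). double_dyadic k m) ` S) (indicator F) (indicator G)"
      unfolding sparse_form_image_eq[OF S(1)]
    proof (rule sum_mono)
      fix p :: "nat \<times> int"
      obtain k m where p: "p = (k, m)" by (cases p)
      let ?d = "density F k m * density G k m"
      have "Log ?d \<ge> 1" by (simp add: Log_def)
      hence "Log ?d ^ 1 \<le> Log ?d ^ t" using t by (intro power_increasing) auto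
      hence "?d * Log ?d * (2 * 2 ^ k) \<le> ?d * Log ?d ^ t * (2 * 2 ^ k)"
        using density_nonneg by (intro mult_right_mono mult_left_mono) auto
      thus "sparse_term F G p \<le> (case p of (k, m) \<Rightarrow> density F k m * density G k m * Log (density F k m * density G k m) ^ t * (2 * 2 ^ k))"
        by (simp add: p sparse_term_def Let_def)
    qed
    hence "C * (\<Sum>p\<in>S. sparse_term F G p) \<le> C * sparse_form t ((\<lambda>(k, m). double_dyadic k m) ` S) (indicator F) (indicator G)"
      using C by (intro mult_left_mono) auto
    hence "pairing (prime_max (indicator F)) (indicator G) \<le> C * sparse_form t ((\<lambda>(k, m). double_dyadic k m) ` S) (indicator F) (indicator G)"
      using S(3) by (rule order_trans[rotated])
    thus "\<exists>S. sparse_collection S \<and> pairing (prime_max (indicator F)) (indicator G) \<le> C * sparse_form t S (indicator F) (indicator G)"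
      using S(2) by blast
  qed
qed

end
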